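(* The Waldhausen $S$-construction $S\mathscr{A}$ of an abelian category $\mathscr{A}$ is a decomposition space.
   Context: $\mathbf{Grpd}$ is the $\infty$-category of $\infty$-groupoids (spaces); pullbacks are homotopy pullbacks. $\Delta$ is the category of nonempty finite ordinals. A map in $\Delta$ is generic if it preserves both end-points, and free if $f(i+1)=f(i)+1$ for all $i$; generic and free maps admit pushouts along each other. A decomposition space is a functor $X:\Delta^{\mathrm{op}}\to\mathbf{Grpd}$ sending every pushout square in $\Delta$ of a generic map along a free map to a pullback. For a linearly ordered set $I$, let $\mathrm{Ar}(I)$ be the category whose objects are pairs $i\le j$ in $I$, with a unique morphism $(i,j)\to(i',j')$ whenever $i\le i'$ and $j\le j'$. A gap complex in an abelian category $\mathscr{A}$ is a functor $F:\mathrm{Ar}(I)\to\mathscr{A}$ such that (1) $F(i,i)$ is a zero object for each $i\in I$; and (2) for every $i\le j\le k$ the square with horizontal maps $F(i,j)\to F(i,k)$ and $F(j,j)\to F(j,k)$ and vertical maps $F(i,j)\to F(j,j)=0$ and $F(i,k)\to F(j,k)$, in which moreover horizontal maps are monomorphisms and vertical maps are epimorphisms, is a pushout (equivalently a pullback); i.e. $F(i,j)\rightarrowtail F(i,k)\twoheadrightarrow F(j,k)$ is a short exact sequence. $\mathrm{Gap}(I,\mathscr{A})$ is the full subcategory of $\mathrm{Fun}(\mathrm{Ar}(I),\mathscr{A})$ on gap complexes. The Waldhausen $S$-construction is the simplicial groupoid $S\mathscr{A}:\Delta^{\mathrm{op}}\to\mathbf{Grpd}$, $[n]\mapsto\mathrm{Gap}([n],\mathscr{A})^{\mathrm{eq}}$,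 where $(-)^{\mathrm{eq}}$ denotes the maximal subgroupoid. *)

theory Defs
  imports Main "HOL-Library.FuncSet" "HOL-Algebra.Group"
begin

record ('o, 'm) cat =
  Ob :: "'o set"
  Arr :: "'m set"
  Dom :: "'m \<Rightarrow> 'o"
  Cod :: "'m \<Rightarrow> 'o"
  Id :: "'o \<Rightarrow> 'm"
  Comp :: "'m \<Rightarrow> 'm \<Rightarrow> 'm"

definition homs :: "('o, 'm) cat \<Rightarrow> 'o \<Rightarrow> 'o \<Rightarrow> 'm set" where
  "homs C a b = {f \<in> Arr C. Dom C f = a \<and> Cod C f = b}"

text \<open>\<open>Comp C g f\<close> is \<open>g\<close> after \<open>f\<close>; its value is irrelevant unless \<open>Dom C g = Cod C f\<close>.\<close>

locale category =
  fixes C :: "('o, 'm) cat"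
  assumes dom_in: "f \<in> Arr C \<Longrightarrow> Dom C f \<in> Ob C"
    and cod_in: "f \<in> Arr C \<Longrightarrow> Cod C f \<in> Ob C"
    and id_in: "a \<in> Ob C \<Longrightarrow> Id C a \<in> homs C a a"
    and comp_in: "\<lbrakk>f \<in> homs C a b; g \<in> homs C b c\<rbrakk> \<Longrightarrow> Comp C g f \<in> homs C a c"
    and id_left: "f \<in> homs C a b \<Longrightarrow> Comp C (Id C b) f = f"
    and id_right: "f \<in> homs C a b \<Longrightarrow> Comp C f (Id C a) = f"
    and comp_assoc: "\<lbrakk>f \<in> homs C a b; g \<in> homs C b c; h \<in> homs C c d\<rbrakk>
      \<Longrightarrow> Comp C h (Comp C g f) = Comp C (Comp C h g) f"

definition is_iso :: "('o, 'm) cat \<Rightarrow> 'm \<Rightarrow> bool" where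
  "is_iso C f \<longleftrightarrow> f \<in> Arr C \<and>
     (\<exists>g \<in> homs C (Cod C f) (Dom C f).
        Comp C g f = Id C (Dom C f) \<and> Comp C f g = Id C (Cod C f))"

definition is_mono :: "('o, 'm) cat \<Rightarrow> 'm \<Rightarrow> bool" where
  "is_mono C f \<longleftrightarrow> f \<in> Arr C \<and>
     (\<forall>x. \<forall>u \<in> homs C x (Dom C f). \<forall>v \<in> homs C x (Dom C f).
        Comp C f u = Comp C f v \<longrightarrow> u = v)"

definition is_epi :: "('o, 'm) cat \<Rightarrow> 'm \<Rightarrow> bool" where
  "is_epi C f \<longleftrightarrow> f \<in> Arr C \<and>
     (\<forall>x. \<forall>u \<in> homs C (Cod C f) x. \<forall>v \<in> homs C (Cod C f) x.
        Comp C u f = Comp C v f \<longrightarrow> u = v)"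

definition commuting_square :: "('o, 'm) cat \<Rightarrow> 'm \<Rightarrow> 'm \<Rightarrow> 'm \<Rightarrow> 'm \<Rightarrow> bool" where
  "commuting_square C f g f' g' \<longleftrightarrow>
     f \<in> Arr C \<and> g \<in> Arr C \<and> f' \<in> Arr C \<and> g' \<in> Arr C \<and>
     Dom C f = Dom C g \<and> Dom C f' = Cod C f \<and> Dom C g' = Cod C g \<and> Cod C f' = Cod C g' \<and>
     Comp C f' f = Comp C g' g"

text \<open>The span is \<open>(f, g)\<close>, the cospan \<open>(f', g')\<close>, and \<open>f' f = g' g\<close>.\<close>

definition is_pushout :: "('o, 'm) cat \<Rightarrow> 'm \<Rightarrow> 'm \<Rightarrow> 'm \<Rightarrow> 'm \<Rightarrow> bool" where
  "is_pushout C f g f' g' \<longleftrightarrow> commuting_square C f g f' g' \<and>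
     (\<forall>x. \<forall>h \<in> homs C (Cod C f) x. \<forall>k \<in> homs C (Cod C g) x.
        Comp C h f = Comp C k g \<longrightarrow>
        (\<exists>!u. u \<in> homs C (Cod C f') x \<and> Comp C u f' = h \<and> Comp C u g' = k))"

definition opposite :: "('o, 'm) cat \<Rightarrow> ('o, 'm) cat" where
  "opposite C = \<lparr>Ob = Ob C, Arr = Arr C, Dom = Cod C, Cod = Dom C, Id = Id C,
     Comp = (\<lambda>g f. Comp C f g)\<rparr>"

definition full_subcat :: "('o, 'm) cat \<Rightarrow> ('o \<Rightarrow> bool) \<Rightarrow> ('o, 'm) cat" where
  "full_subcat C P =
     C\<lparr>Ob := {x \<in> Ob C. P x}, Arr := {f \<in> Arr C. P (Dom C f) \<and> P (Cod C f)}\<rparr>"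

definition max_subgroupoid :: "('o, 'm) cat \<Rightarrow> ('o, 'm) cat" where
  "max_subgroupoid C = C\<lparr>Arr := {f \<in> Arr C. is_iso C f}\<rparr>"

locale groupoid = category +
  assumes arr_iso: "f \<in> Arr C \<Longrightarrow> is_iso C f"

definition zero_object :: "('o, 'm) cat \<Rightarrow> 'o \<Rightarrow> bool" where
  "zero_object C z \<longleftrightarrow> z \<in> Ob C \<and>
     (\<forall>x \<in> Ob C. (\<exists>!f. f \<in> homs C x z) \<and> (\<exists>!f. f \<in> homs C z x))"

definition zero_arrow :: "('o, 'm) cat \<Rightarrow> 'm \<Rightarrow> bool" where
  "zero_arrow C f \<longleftrightarrow> (\<exists>z u v. zero_object C z \<and>
     u \<in> homs C (Dom C f) z \<and> v \<in> homs C z (Cod C f) \<and> f = Comp C v u)"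

definition is_kernel :: "('o, 'm) cat \<Rightarrow> 'm \<Rightarrow> 'm \<Rightarrow> bool" where
  "is_kernel C k f \<longleftrightarrow> f \<in> Arr C \<and> k \<in> Arr C \<and> Cod C k = Dom C f \<and> zero_arrow C (Comp C f k) \<and>
     (\<forall>x. \<forall>h \<in> homs C x (Dom C f). zero_arrow C (Comp C f h) \<longrightarrow>
        (\<exists>!u. u \<in> homs C x (Dom C k) \<and> Comp C k u = h))"

definition is_cokernel :: "('o, 'm) cat \<Rightarrow> 'm \<Rightarrow> 'm \<Rightarrow> bool" where
  "is_cokernel C q f \<longleftrightarrow> f \<in> Arr C \<and> q \<in> Arr C \<and> Dom C q = Cod C f \<and> zero_arrow C (Comp C q f) \<and>
     (\<forall>x. \<forall>h \<in> homs C (Cod C f) x. zero_arrow C (Comp C h f) \<longrightarrow>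
        (\<exists>!u. u \<in> homs C (Cod C q) x \<and> Comp C u q = h))"

definition is_product :: "('o, 'm) cat \<Rightarrow> 'o \<Rightarrow> 'o \<Rightarrow> 'o \<Rightarrow> 'm \<Rightarrow> 'm \<Rightarrow> bool" where
  "is_product C a b p pa pb \<longleftrightarrow> p \<in> Ob C \<and> pa \<in> homs C p a \<and> pb \<in> homs C p b \<and>
     (\<forall>x. \<forall>f \<in> homs C x a. \<forall>g \<in> homs C x b.
        \<exists>!u. u \<in> homs C x p \<and> Comp C pa u = f \<and> Comp C pb u = g)"

text \<open>A single function \<open>add\<close> serves for all hom-sets because they are pairwise disjoint.\<close>

definition preadditive_structure :: "('o, 'm) cat \<Rightarrow> ('m \<Rightarrow> 'm \<Rightarrow> 'm) \<Rightarrow> bool" where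
  "preadditive_structure C add \<longleftrightarrow>
     (\<forall>a \<in> Ob C. \<forall>b \<in> Ob C.
        \<exists>z. comm_group \<lparr>carrier = homs C a b, monoid.mult = add, one = z\<rparr>) \<and>
     (\<forall>a b c. \<forall>f \<in> homs C a b. \<forall>f' \<in> homs C a b. \<forall>g \<in> homs C b c.
        Comp C g (add f f') = add (Comp C g f) (Comp C g f')) \<and>
     (\<forall>a b c. \<forall>f \<in> homs C a b. \<forall>g \<in> homs C b c. \<forall>g' \<in> homs C b c.
        Comp C (add g g') f = add (Comp C g f) (Comp C g' f))"

text \<open>Being abelian is a property of the underlying category: in the presence of binary
  products the preadditive structure is unique.\<close>

locale abelian_category = category +
  assumes ex_preadditive: "\<exists>add. preadditive_structure C add"
    and ex_zero_object: "\<exists>z. zero_object C z"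
    and ex_product: "\<lbrakk>a \<in> Ob C; b \<in> Ob C\<rbrakk> \<Longrightarrow> \<exists>p pa pb. is_product C a b p pa pb"
    and ex_kernel: "f \<in> Arr C \<Longrightarrow> \<exists>k. is_kernel C k f"
    and ex_cokernel: "f \<in> Arr C \<Longrightarrow> \<exists>q. is_cokernel C q f"
    and mono_normal: "is_mono C f \<Longrightarrow> \<exists>g. is_kernel C f g"
    and epi_normal: "is_epi C f \<Longrightarrow> \<exists>g. is_cokernel C f g"

text \<open>All maps are extensional (undefined off the objects/arrows of the source), so that equality
  of functors and of natural transformations is the usual one. Functor data do not record source
  and target.\<close>

record ('o, 'm, 'p, 'n) functr =
  fobj :: "'o \<Rightarrow> 'p"
  farr :: "'m \<Rightarrow> 'n"

definition is_functor ::
  "('o, 'm) cat \<Rightarrow> ('p, 'n) cat \<Rightarrow> ('o, 'm, 'p, 'n) functr \<Rightarrow> bool" where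
  "is_functor C D F \<longleftrightarrow> category C \<and> category D \<and>
     fobj F \<in> extensional (Ob C) \<and> farr F \<in> extensional (Arr C) \<and>
     (\<forall>a \<in> Ob C. fobj F a \<in> Ob D) \<and>
     (\<forall>f \<in> Arr C. farr F f \<in> homs D (fobj F (Dom C f)) (fobj F (Cod C f))) \<and>
     (\<forall>a \<in> Ob C. farr F (Id C a) = Id D (fobj F a)) \<and>
     (\<forall>f \<in> Arr C. \<forall>g \<in> Arr C. Dom C g = Cod C f \<longrightarrow>
        farr F (Comp C g f) = Comp D (farr F g) (farr F f))"

definition id_functor :: "('o, 'm) cat \<Rightarrow> ('o, 'm, 'o, 'm) functr" where
  "id_functor C = \<lparr>fobj = (\<lambda>a \<in> Ob C. a), farr = (\<lambda>f \<in> Arr C. f)\<rparr>"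

text \<open>\<open>comp_functor C G F\<close> is \<open>G\<close> after \<open>F\<close>, where \<open>C\<close> is the source of \<open>F\<close>.\<close>

definition comp_functor :: "('o, 'm) cat \<Rightarrow> ('p, 'n, 'q, 'l) functr \<Rightarrow>
    ('o, 'm, 'p, 'n) functr \<Rightarrow> ('o, 'm, 'q, 'l) functr" where
  "comp_functor C G F =
     \<lparr>fobj = compose (Ob C) (fobj G) (fobj F), farr = compose (Arr C) (farr G) (farr F)\<rparr>"

type_synonym ('o, 'm, 'p, 'n) nattrans =
  "('o, 'm, 'p, 'n) functr \<times> ('o, 'm, 'p, 'n) functr \<times> ('o \<Rightarrow> 'n)"

definition is_nattrans ::
  "('o, 'm) cat \<Rightarrow> ('p, 'n) cat \<Rightarrow> ('o, 'm, 'p, 'n) nattrans \<Rightarrow> bool" where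
  "is_nattrans C D = (\<lambda>(F, G, t).
     is_functor C D F \<and> is_functor C D G \<and> t \<in> extensional (Ob C) \<and>
     (\<forall>a \<in> Ob C. t a \<in> homs D (fobj F a) (fobj G a)) \<and>
     (\<forall>f \<in> Arr C. Comp D (t (Cod C f)) (farr F f) = Comp D (farr G f) (t (Dom C f))))"

definition functor_cat :: "('o, 'm) cat \<Rightarrow> ('p, 'n) cat \<Rightarrow>
    (('o, 'm, 'p, 'n) functr, ('o, 'm, 'p, 'n) nattrans) cat" where
  "functor_cat C D =
     \<lparr>Ob = {F. is_functor C D F},
      Arr = {t. is_nattrans C D t},
      Dom = (\<lambda>(F, G, t). F),
      Cod = (\<lambda>(F, G, t). G),
      Id = (\<lambda>F. (F, F, \<lambda>a \<in> Ob C. Id D (fobj F a))),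
      Comp = (\<lambda>(G, H, s) (F, G', t). (F, H, \<lambda>a \<in> Ob C. Comp D (s a) (t a)))\<rparr>"

definition is_equivalence ::
  "('o, 'm) cat \<Rightarrow> ('p, 'n) cat \<Rightarrow> ('o, 'm, 'p, 'n) functr \<Rightarrow> bool" where
  "is_equivalence C D F \<longleftrightarrow> is_functor C D F \<and>
     (\<exists>G. is_functor D C G \<and>
        (\<exists>t. is_iso (functor_cat C C) t \<and>
             t \<in> homs (functor_cat C C) (id_functor C) (comp_functor C G F)) \<and>
        (\<exists>t. is_iso (functor_cat D D) t \<and>
             t \<in> homs (functor_cat D D) (comp_functor D F G) (id_functor D)))"

text \<open>A morphism of groupoids is a triple (source, target, functor).\<close>

type_synonym ('o, 'm) grpd_map = "('o, 'm) cat \<times> ('o, 'm) cat \<times> ('o, 'm, 'o, 'm) functr"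

definition Grpd :: "(('o, 'm) cat, ('o, 'm) grpd_map) cat" where
  "Grpd =
     \<lparr>Ob = {G. groupoid G},
      Arr = {(G, H, F). groupoid G \<and> groupoid H \<and> is_functor G H F},
      Dom = (\<lambda>(G, H, F). G),
      Cod = (\<lambda>(G, H, F). H),
      Id = (\<lambda>G. (G, G, id_functor G)),
      Comp = (\<lambda>(H, K, F') (G, H', F). (G, K, comp_functor G F' F))\<rparr>"

text \<open>The homotopy fibre product of functors \<open>f: A \<rightarrow> C\<close> and \<open>g: B \<rightarrow> C\<close> of groupoids. Objects are
  triples \<open>(a, b, \<phi>: f a \<cong> g b)\<close>; an arrow is given by its source, its target and a pair
  \<open>(\<alpha>: a \<rightarrow> a', \<beta>: b \<rightarrow> b')\<close> compatible with \<open>\<phi>\<close> and \<open>\<phi>'\<close>.\<close>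

definition homotopy_fibre_product ::
  "('o, 'm) cat \<Rightarrow> ('p, 'n) cat \<Rightarrow> ('q, 'l) cat \<Rightarrow>
   ('o, 'm, 'q, 'l) functr \<Rightarrow> ('p, 'n, 'q, 'l) functr \<Rightarrow>
   ('o \<times> 'p \<times> 'l, ('o \<times> 'p \<times> 'l) \<times> ('o \<times> 'p \<times> 'l) \<times> 'm \<times> 'n) cat" where
  "homotopy_fibre_product A B C f g =
    (let obs = {(a, b, \<phi>). a \<in> Ob A \<and> b \<in> Ob B \<and> \<phi> \<in> homs C (fobj f a) (fobj g b)} in
     \<lparr>Ob = obs,
      Arr = {((a, b, \<phi>), (a', b', \<phi>'), \<alpha>, \<beta>).
               (a, b, \<phi>) \<in> obs \<and> (a', b', \<phi>') \<in> obs \<and> \<alpha> \<in> homs A a a' \<and> \<beta> \<in> homs B b b' \<and>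
               Comp C \<phi>' (farr f \<alpha>) = Comp C (farr g \<beta>) \<phi>},
      Dom = (\<lambda>(x, y, \<alpha>, \<beta>). x),
      Cod = (\<lambda>(x, y, \<alpha>, \<beta>). y),
      Id = (\<lambda>(a, b, \<phi>). ((a, b, \<phi>), (a, b, \<phi>), Id A a, Id B b)),
      Comp = (\<lambda>(y, z, \<alpha>', \<beta>') (x, y', \<alpha>, \<beta>). (x, z, Comp A \<alpha>' \<alpha>, Comp B \<beta>' \<beta>))\<rparr>)"

text \<open>The comparison functor of a strictly commuting square \<open>f p = g q\<close> with corner \<open>P\<close>:
  it sends \<open>x\<close> to \<open>(p x, q x, id)\<close>.\<close>

definition comparison_functor ::
  "('r, 'k) cat \<Rightarrow> ('q, 'l) cat \<Rightarrow> ('r, 'k, 'o, 'm) functr \<Rightarrow> ('r, 'k, 'p, 'n) functr \<Rightarrow>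
   ('o, 'm, 'q, 'l) functr \<Rightarrow>
   ('r, 'k, 'o \<times> 'p \<times> 'l, ('o \<times> 'p \<times> 'l) \<times> ('o \<times> 'p \<times> 'l) \<times> 'm \<times> 'n) functr" where
  "comparison_functor P C p q f =
    (let ob = (\<lambda>x. (fobj p x, fobj q x, Id C (fobj f (fobj p x)))) in
     \<lparr>fobj = (\<lambda>x \<in> Ob P. ob x),
      farr = (\<lambda>u \<in> Arr P. (ob (Dom P u), ob (Cod P u), farr p u, farr q u))\<rparr>)"

text \<open>Groupoids are regarded as 1-truncated spaces. A strictly commuting square of groupoids is
  a pullback in the \<open>\<infinity>\<close>-category of spaces iff the comparison with the homotopy fibre product is
  an equivalence. The cospan is \<open>(f, g)\<close>, the projections are \<open>(p, q)\<close>, and \<open>f p = g q\<close>.\<close>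

definition is_homotopy_pullback ::
  "('o, 'm) grpd_map \<Rightarrow> ('o, 'm) grpd_map \<Rightarrow> ('o, 'm) grpd_map \<Rightarrow> ('o, 'm) grpd_map \<Rightarrow> bool" where
  "is_homotopy_pullback p q f g \<longleftrightarrow> commuting_square Grpd p q f g \<and>
    (case (p, q, f, g) of ((P, A, p'), (_, B, q'), (_, C, f'), (_, _, g')) \<Rightarrow>
      is_equivalence P (homotopy_fibre_product A B C f' g') (comparison_functor P C p' q' f'))"

text \<open>The object \<open>n\<close> stands for the ordinal \<open>[n] = {0, \<dots>, n}\<close>; an arrow \<open>(m, n, f)\<close> is a monotone
  map \<open>f: [m] \<rightarrow> [n]\<close>.\<close>

type_synonym delta_map = "nat \<times> nat \<times> (nat \<Rightarrow> nat)"

definition Delta :: "(nat, delta_map) cat" where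
  "Delta =
     \<lparr>Ob = UNIV,
      Arr = {(m, n, f). f \<in> {0..m} \<rightarrow>\<^sub>E {0..n} \<and> mono_on {0..m} f},
      Dom = (\<lambda>(m, n, f). m),
      Cod = (\<lambda>(m, n, f). n),
      Id = (\<lambda>n. (n, n, \<lambda>i \<in> {0..n}. i)),
      Comp = (\<lambda>(n, k, g) (m, n', f). (m, k, compose {0..m} g f))\<rparr>"

definition generic :: "delta_map \<Rightarrow> bool" where
  "generic = (\<lambda>(m, n, f). (m, n, f) \<in> Arr Delta \<and> f 0 = 0 \<and> f m = n)"

definition free :: "delta_map \<Rightarrow> bool" where
  "free = (\<lambda>(m, n, f). (m, n, f) \<in> Arr Delta \<and> (\<forall>i < m. f (i + 1) = f i + 1))"

definition decomposition_space ::
  "(nat, delta_map, ('o, 'm) cat, ('o, 'm) grpd_map) functr \<Rightarrow> bool" where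
  "decomposition_space X \<longleftrightarrow> is_functor (opposite Delta) Grpd X \<and>
     (\<forall>g f g' f'. generic g \<longrightarrow> free f \<longrightarrow> is_pushout Delta g f f' g' \<longrightarrow>
        is_homotopy_pullback (farr X f') (farr X g') (farr X g) (farr X f))"

definition Ar :: "'i::linorder set \<Rightarrow> ('i \<times> 'i, ('i \<times> 'i) \<times> ('i \<times> 'i)) cat" where
  "Ar I =
    (let obs = {(i, j). i \<in> I \<and> j \<in> I \<and> i \<le> j} in
     \<lparr>Ob = obs,
      Arr = {((i, j), (i', j')). (i, j) \<in> obs \<and> (i', j') \<in> obs \<and> i \<le> i' \<and> j \<le> j'},
      Dom = fst,
      Cod = snd,
      Id = (\<lambda>x. (x, x)),
      Comp = (\<lambda>(y, z) (x, y'). (x, z))\<rparr>)"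

definition gap_complex :: "'i::linorder set \<Rightarrow> ('o, 'm) cat \<Rightarrow>
    ('i \<times> 'i, ('i \<times> 'i) \<times> ('i \<times> 'i), 'o, 'm) functr \<Rightarrow> bool" where
  "gap_complex I A F \<longleftrightarrow> is_functor (Ar I) A F \<and>
     (\<forall>i \<in> I. zero_object A (fobj F (i, i))) \<and>
     (\<forall>i \<in> I. \<forall>j \<in> I. \<forall>k \<in> I. i \<le> j \<longrightarrow> j \<le> k \<longrightarrow>
        is_mono A (farr F ((i, j), (i, k))) \<and> is_mono A (farr F ((j, j), (j, k))) \<and>
        is_epi A (farr F ((i, j), (j, j))) \<and> is_epi A (farr F ((i, k), (j, k))) \<and>
        is_pushout A (farr F ((i, j), (i, k))) (farr F ((i, j), (j, j)))
                     (farr F ((i, k), (j, k))) (farr F ((j, j), (j, k))))"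

definition Gap :: "'i::linorder set \<Rightarrow> ('o, 'm) cat \<Rightarrow>
    (('i \<times> 'i, ('i \<times> 'i) \<times> ('i \<times> 'i), 'o, 'm) functr,
     ('i \<times> 'i, ('i \<times> 'i) \<times> ('i \<times> 'i), 'o, 'm) nattrans) cat" where
  "Gap I A = full_subcat (functor_cat (Ar I) A) (gap_complex I A)"

definition Ar_map :: "'i::linorder set \<Rightarrow> ('i \<Rightarrow> 'j::linorder) \<Rightarrow>
    ('i \<times> 'i, ('i \<times> 'i) \<times> ('i \<times> 'i), 'j \<times> 'j, ('j \<times> 'j) \<times> ('j \<times> 'j)) functr" where
  "Ar_map I f =
     \<lparr>fobj = (\<lambda>x \<in> Ob (Ar I). map_prod f f x),
      farr = (\<lambda>u \<in> Arr (Ar I). map_prod (map_prod f f) (map_prod f f) u)\<rparr>"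

text \<open>Precomposition with \<open>K\<close> as a functor on a subcategory \<open>E\<close> of a functor category; \<open>C\<close> is the
  source of \<open>K\<close>.\<close>

definition precomp_functor ::
  "('o, 'm) cat \<Rightarrow> (('p, 'n, 'q, 'l) functr, ('p, 'n, 'q, 'l) nattrans) cat \<Rightarrow>
   ('o, 'm, 'p, 'n) functr \<Rightarrow>
   (('p, 'n, 'q, 'l) functr, ('p, 'n, 'q, 'l) nattrans,
    ('o, 'm, 'q, 'l) functr, ('o, 'm, 'q, 'l) nattrans) functr" where
  "precomp_functor C E K =
     \<lparr>fobj = (\<lambda>F \<in> Ob E. comp_functor C F K),
      farr = (\<lambda>t \<in> Arr E. case t of (F, G, s) \<Rightarrow>
                (comp_functor C F K, comp_functor C G K, compose (Ob C) s (fobj K)))\<rparr>"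

type_synonym ('o, 'm) nat_gap = "(nat \<times> nat, (nat \<times> nat) \<times> (nat \<times> nat), 'o, 'm) functr"

type_synonym ('o, 'm) nat_gap_map = "(nat \<times> nat, (nat \<times> nat) \<times> (nat \<times> nat), 'o, 'm) nattrans"

definition S_groupoid ::
  "('o, 'm) cat \<Rightarrow> nat \<Rightarrow> (('o, 'm) nat_gap, ('o, 'm) nat_gap_map) cat" where
  "S_groupoid A n = max_subgroupoid (Gap {0..n} A)"

text \<open>A monotone map \<open>f: [m] \<rightarrow> [n]\<close> acts by restriction along \<open>Ar [m] \<rightarrow> Ar [n]\<close>.\<close>

definition waldhausen_S :: "('o, 'm) cat \<Rightarrow>
    (nat, delta_map, (('o, 'm) nat_gap, ('o, 'm) nat_gap_map) cat,
     (('o, 'm) nat_gap, ('o, 'm) nat_gap_map) grpd_map) functr" where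
  "waldhausen_S A =
     \<lparr>fobj = S_groupoid A,
      farr = (\<lambda>u \<in> Arr Delta. case u of (m, n, f) \<Rightarrow>
                (S_groupoid A n, S_groupoid A m,
                 precomp_functor (Ar {0..m}) (S_groupoid A n) (Ar_map {0..m} f)))\<rparr>"

end

theory Submission
  imports Defs
begin

text \<open>A gap complex on \<open>[p]\<close> is determined by the filtration of \<open>F (0, p)\<close> by the subobjects
  \<open>F (0, j)\<close>: the other entries are the quotients \<open>F (0, j) / F (0, i)\<close>. Hence a transformation
  of gap complexes is the same as an arrow between the top objects that respects the filtrations.
  The pushout of a generic \<open>g: [m] \<rightarrow> [n]\<close> along a free \<open>i \<mapsto> a + i: [m] \<rightarrow> [k]\<close> replaces the
  interval \<open>[a, a + m]\<close> of \<open>[k]\<close> by a copy of \<open>[n]\<close>. To glue \<open>U\<close> on \<open>[n]\<close> and \<open>V\<close> on \<open>[k]\<close>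
  along \<open>U (0, n) \<cong> V (a, a + m)\<close>, insert into the filtration of \<open>V (0, k)\<close> the preimages in
  \<open>V (0, a + m)\<close> of the subobjects \<open>U (0, j)\<close>; this gives essential surjectivity of the comparison
  functor. It is fully faithful because an arrow that respects the filtrations of \<open>V (0, k)\<close> and of
  \<open>U (0, n)\<close> respects the refined one.\<close>

section \<open>Categories in arrow form\<close>

text \<open>Kernels and cokernels are determined only up to isomorphism, so a glued complex
  restricts to the given \<open>U\<close> and \<open>V\<close> only up to isomorphism. Hence no
  inverse of the comparison functor is written down; the equivalence comes from
  \<open>equivalenceI\<close>. Respecting a filtration is expressed without subobjects: since G (0,
  j) is the kernel of G (0, p) -> G (j, p), an arrow F (0, p) -> G (0, p) carries F (0, j) into G
  (0, j) exactly when F (0, j) -> F (0, p) -> G (0, p) -> G (j, p) vanishes. This condition on an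
  isomorphism says nothing about its inverse, so an invertible transformation is obtained by
  extending the inverse arrow as well; the two composites are identities because they are so at the
  top object. Genericity of g enters through g 0 = 0 and g m = n: the restriction of
  \<open>U\<close> to [m] has the same top object as \<open>U\<close>, so a datum on [m] sees all of
  U (0, n). An arbitrary pushout square in \<open>Delta\<close> equals the explicit one because
  ordinals have no nontrivial automorphisms.\<close>

lemma homs_iff: "f \<in> homs C a b \<longleftrightarrow> f \<in> Arr C \<and> Dom C f = a \<and> Cod C f = b"
  by (simp add: homs_def)

context category
begin

abbreviation cmp (infixr "\<cdot>" 70) where "g \<cdot> f \<equiv> Comp C g f"

lemma cmp_homs: "\<lbrakk>f \<in> Arr C; g \<in> Arr C; Dom C g = Cod C f\<rbrakk> \<Longrightarrow> g \<cdot> f \<in> homs C (Dom C f) (Cod C g)"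
  using comp_in[of f "Dom C f" "Cod C f" g "Cod C g"] by (simp add: homs_iff)

lemma cmp_simps [simp]:
  assumes "f \<in> Arr C" "g \<in> Arr C" "Dom C g = Cod C f"
  shows "g \<cdot> f \<in> Arr C" "Dom C (g \<cdot> f) = Dom C f" "Cod C (g \<cdot> f) = Cod C g"
  using cmp_homs[OF assms] by (simp_all add: homs_iff)

text \<open>Composites are normalised to the right. An identity about two adjacent factors then does
  not rewrite inside a longer composite; hence the local steps that use \<open>assoc\<close>
  backwards, and the \<open>_ext\<close> variants further on.\<close>

lemma assoc [simp]:
  "\<lbrakk>f \<in> Arr C; g \<in> Arr C; h \<in> Arr C; Dom C g = Cod C f; Dom C h = Cod C g\<rbrakk>
    \<Longrightarrow> (h \<cdot> g) \<cdot> f = h \<cdot> g \<cdot> f"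
  using comp_assoc[of f "Dom C f" "Cod C f" g "Cod C g" h "Cod C h"] by (simp add: homs_iff)

lemma id_simps [simp]:
  assumes "a \<in> Ob C"
  shows "Id C a \<in> Arr C" "Dom C (Id C a) = a" "Cod C (Id C a) = a"
  using id_in[OF assms] by (simp_all add: homs_iff)

lemma ident_left [simp]: "\<lbrakk>f \<in> Arr C; Cod C f = b\<rbrakk> \<Longrightarrow> Id C b \<cdot> f = f"
  using id_left[of f "Dom C f" b] by (simp add: homs_iff)

lemma ident_right [simp]: "\<lbrakk>f \<in> Arr C; Dom C f = a\<rbrakk> \<Longrightarrow> f \<cdot> Id C a = f"
  using id_right[of f a "Cod C f"] by (simp add: homs_iff)

lemmas dom_cod_in [simp] = dom_in cod_in

lemma isoI: "\<lbrakk>f \<in> homs C a b; g \<in> homs C b a; g \<cdot> f = Id C a; f \<cdot> g = Id C b\<rbrakk> \<Longrightarrow> is_iso C f"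
  unfolding is_iso_def homs_iff by (intro conjI bexI[where x=g]) (auto simp: homs_iff)

lemma isoE:
  assumes "is_iso C f"
  obtains g where "f \<in> Arr C" "g \<in> Arr C" "Dom C g = Cod C f" "Cod C g = Dom C f"
    "g \<cdot> f = Id C (Dom C f)" "f \<cdot> g = Id C (Cod C f)" "is_iso C g"
proof -
  obtain g where g: "f \<in> Arr C" "g \<in> Arr C" "Dom C g = Cod C f" "Cod C g = Dom C f"
    "g \<cdot> f = Id C (Dom C f)" "f \<cdot> g = Id C (Cod C f)"
    using assms unfolding is_iso_def homs_def by blast
  then have "is_iso C g"
    by (intro isoI[where a="Cod C f" and b="Dom C f" and g=f]) (auto simp: homs_iff)
  with g show ?thesis by (rule that)
qed

lemma iso_id: "a \<in> Ob C \<Longrightarrow> is_iso C (Id C a)"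
  by (rule isoI[where a=a and b=a and g="Id C a"]) (auto simp: homs_iff)

lemma iso_cmp:
  assumes "is_iso C f" "is_iso C g" "Dom C g = Cod C f"
  shows "is_iso C (g \<cdot> f)"
proof -
  obtain f' where f: "f \<in> Arr C" "f' \<in> Arr C" "Dom C f' = Cod C f" "Cod C f' = Dom C f"
    "f' \<cdot> f = Id C (Dom C f)" "f \<cdot> f' = Id C (Cod C f)" using assms(1) by (rule isoE)
  obtain g' where g: "g \<in> Arr C" "g' \<in> Arr C" "Dom C g' = Cod C g" "Cod C g' = Dom C g"
    "g' \<cdot> g = Id C (Dom C g)" "g \<cdot> g' = Id C (Cod C g)" using assms(2) by (rule isoE)
  have "g' \<cdot> g \<cdot> f = f" "f \<cdot> f' \<cdot> g' = g'"
    using f g assms(3) by (simp_all flip: assoc)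
  then show ?thesis
    using f g assms(3)
    by (intro isoI[where a="Dom C f" and b="Cod C g" and g="f' \<cdot> g'"]) (auto simp: homs_iff)
qed

lemma epi_cancel:
  "\<lbrakk>is_epi C e; u \<cdot> e = v \<cdot> e; u \<in> Arr C; v \<in> Arr C; Dom C u = Cod C e; Dom C v = Cod C e;
    Cod C u = Cod C v\<rbrakk> \<Longrightarrow> u = v"
  unfolding is_epi_def homs_def by simp

lemma mono_cancel:
  "\<lbrakk>is_mono C m; m \<cdot> u = m \<cdot> v; u \<in> Arr C; v \<in> Arr C; Cod C u = Dom C m; Cod C v = Dom C m;
    Dom C u = Dom C v\<rbrakk> \<Longrightarrow> u = v"
  unfolding is_mono_def homs_def by simp

lemma epi_arr: "is_epi C e \<Longrightarrow> e \<in> Arr C"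
  by (simp add: is_epi_def)

lemma mono_arr: "is_mono C e \<Longrightarrow> e \<in> Arr C"
  by (simp add: is_mono_def)

lemma mono_cmp:
  assumes "is_mono C f" "is_mono C g" "Dom C g = Cod C f"
  shows "is_mono C (g \<cdot> f)"
proof -
  have [simp]: "f \<in> Arr C" "g \<in> Arr C" using assms mono_arr by auto
  have "u = v" if "u \<in> Arr C" "v \<in> Arr C" "Cod C u = Dom C f" "Cod C v = Dom C f" "Dom C u = Dom C v"
      "(g \<cdot> f) \<cdot> u = (g \<cdot> f) \<cdot> v" for u v
  proof -
    have "f \<cdot> u = f \<cdot> v" by (rule mono_cancel[OF assms(2)]) (use that assms in auto)
    then show ?thesis by (rule mono_cancel[OF assms(1)]) (use that assms in auto)
  qed
  then show ?thesis unfolding is_mono_def homs_def using assms(3) by auto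
qed

lemma epi_cmp:
  assumes "is_epi C f" "is_epi C g" "Dom C g = Cod C f"
  shows "is_epi C (g \<cdot> f)"
proof -
  have [simp]: "f \<in> Arr C" "g \<in> Arr C" using assms epi_arr by auto
  have "u = v" if "u \<in> Arr C" "v \<in> Arr C" "Dom C u = Cod C g" "Dom C v = Cod C g" "Cod C u = Cod C v"
      "u \<cdot> g \<cdot> f = v \<cdot> g \<cdot> f" for u v
  proof -
    have "u \<cdot> g = v \<cdot> g" by (rule epi_cancel[OF assms(1)]) (use that assms in auto)
    then show ?thesis by (rule epi_cancel[OF assms(2)]) (use that assms in auto)
  qed
  then show ?thesis unfolding is_epi_def homs_def using assms(3) by auto
qed

lemma iso_mono:
  assumes "is_iso C f" shows "is_mono C f"
proof -
  obtain g where g: "f \<in> Arr C" "g \<in> Arr C" "Dom C g = Cod C f" "Cod C g = Dom C f"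
    "g \<cdot> f = Id C (Dom C f)" "f \<cdot> g = Id C (Cod C f)" using assms by (rule isoE)
  have "u = v" if "u \<in> Arr C" "v \<in> Arr C" "Cod C u = Dom C f" "Cod C v = Dom C f"
      "f \<cdot> u = f \<cdot> v" for u v
  proof -
    have "(g \<cdot> f) \<cdot> u = (g \<cdot> f) \<cdot> v" using that g(1-4) by simp
    then show ?thesis using that(1-4) g by simp
  qed
  then show ?thesis using g unfolding is_mono_def homs_def by auto
qed

lemma iso_epi:
  assumes "is_iso C f" shows "is_epi C f"
proof -
  obtain g where g: "f \<in> Arr C" "g \<in> Arr C" "Dom C g = Cod C f" "Cod C g = Dom C f"
    "g \<cdot> f = Id C (Dom C f)" "f \<cdot> g = Id C (Cod C f)" using assms by (rule isoE)
  have "u = v" if "u \<in> Arr C" "v \<in> Arr C" "Dom C u = Cod C f" "Dom C v = Cod C f"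
      "u \<cdot> f = v \<cdot> f" for u v
  proof -
    have "(u \<cdot> f) \<cdot> g = (v \<cdot> f) \<cdot> g" using that by simp
    then show ?thesis using that(1-4) g by simp
  qed
  then show ?thesis using g unfolding is_epi_def homs_def by auto
qed

end

section \<open>Functors and natural transformations\<close>

lemma is_functorD:
  assumes "is_functor C D F"
  shows "category C" "category D"
    "a \<in> Ob C \<Longrightarrow> fobj F a \<in> Ob D"
    "f \<in> Arr C \<Longrightarrow> farr F f \<in> Arr D"
    "f \<in> Arr C \<Longrightarrow> Dom D (farr F f) = fobj F (Dom C f)"
    "f \<in> Arr C \<Longrightarrow> Cod D (farr F f) = fobj F (Cod C f)"
    "a \<in> Ob C \<Longrightarrow> farr F (Id C a) = Id D (fobj F a)"
    "\<lbrakk>f \<in> Arr C; g \<in> Arr C; Dom C g = Cod C f\<rbrakk>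
      \<Longrightarrow> farr F (Comp C g f) = Comp D (farr F g) (farr F f)"
    "fobj F \<in> extensional (Ob C)" "farr F \<in> extensional (Arr C)"
  using assms unfolding is_functor_def homs_iff by auto

lemma functr_eqI:
  fixes F G :: "('o, 'm, 'p, 'n) functr"
  assumes "is_functor C D F" "is_functor C D' G"
    and "\<And>a. a \<in> Ob C \<Longrightarrow> fobj F a = fobj G a"
    and "\<And>f. f \<in> Arr C \<Longrightarrow> farr F f = farr G f"
  shows "F = G"
proof -
  have "fobj F = fobj G"
    by (rule extensionalityI[where A="Ob C"]) (use assms is_functorD(9) in auto)
  moreover have "farr F = farr G"
    by (rule extensionalityI[where A="Arr C"]) (use assms is_functorD(10) in auto)
  ultimately show ?thesis by simp
qed

lemma id_functor_functor: "category C \<Longrightarrow> is_functor C C (id_functor C)"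
  unfolding is_functor_def id_functor_def
  by (auto simp: homs_iff category.dom_in category.cod_in category.cmp_simps category.id_simps)

lemma comp_functor_apply [simp]:
  "a \<in> Ob C \<Longrightarrow> fobj (comp_functor C G F) a = fobj G (fobj F a)"
  "f \<in> Arr C \<Longrightarrow> farr (comp_functor C G F) f = farr G (farr F f)"
  by (simp_all add: comp_functor_def compose_def)

lemma id_functor_apply [simp]:
  "a \<in> Ob C \<Longrightarrow> fobj (id_functor C) a = a"
  "f \<in> Arr C \<Longrightarrow> farr (id_functor C) f = f"
  by (simp_all add: id_functor_def)

lemma comp_functor_functor:
  assumes "is_functor C D F" "is_functor D E G"
  shows "is_functor C E (comp_functor C G F)"
  using is_functorD[OF assms(1)] is_functorD[OF assms(2)]
  unfolding is_functor_def homs_iff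
  by (auto simp: comp_functor_def compose_def category.cmp_simps category.id_simps
      category.dom_in category.cod_in)

lemma comp_functor_id_left:
  assumes "is_functor C D F" shows "comp_functor C (id_functor D) F = F"
proof (rule functr_eqI[OF comp_functor_functor[OF assms id_functor_functor] assms])
qed (use is_functorD[OF assms] in auto)

lemma comp_functor_id_right:
  assumes "is_functor C D F" shows "comp_functor C F (id_functor C) = F"
proof (rule functr_eqI[OF comp_functor_functor[OF id_functor_functor assms] assms])
qed (use is_functorD[OF assms] in auto)

lemma comp_functor_assoc:
  assumes "is_functor B C F" "is_functor C D G" "is_functor D E H"
  shows "comp_functor B H (comp_functor B G F) = comp_functor B (comp_functor C H G) F"
proof (rule functr_eqI)
  show "is_functor B E (comp_functor B H (comp_functor B G F))"
    using assms comp_functor_functor by metis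
  show "is_functor B E (comp_functor B (comp_functor C H G) F)"
    using assms comp_functor_functor by metis
qed (use is_functorD[OF assms(1)] in auto)

lemma is_nattransD:
  assumes "is_nattrans C D (F, G, t)"
  shows "is_functor C D F" "is_functor C D G"
    "a \<in> Ob C \<Longrightarrow> t a \<in> Arr D"
    "a \<in> Ob C \<Longrightarrow> Dom D (t a) = fobj F a"
    "a \<in> Ob C \<Longrightarrow> Cod D (t a) = fobj G a"
    "f \<in> Arr C \<Longrightarrow> Comp D (t (Cod C f)) (farr F f) = Comp D (farr G f) (t (Dom C f))"
    "t \<in> extensional (Ob C)"
  using assms unfolding is_nattrans_def homs_iff by auto

lemma is_nattransI:
  assumes "is_functor C D F" "is_functor C D G" "t \<in> extensional (Ob C)"
    "\<And>a. a \<in> Ob C \<Longrightarrow> t a \<in> Arr D \<and> Dom D (t a) = fobj F a \<and> Cod D (t a) = fobj G a"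
    "\<And>f. f \<in> Arr C \<Longrightarrow> Comp D (t (Cod C f)) (farr F f) = Comp D (farr G f) (t (Dom C f))"
  shows "is_nattrans C D (F, G, t)"
  using assms unfolding is_nattrans_def homs_iff by auto

lemma is_nattrans_id:
  assumes "is_functor C D F"
  shows "is_nattrans C D (F, F, \<lambda>a \<in> Ob C. Id D (fobj F a))"
  by (rule is_nattransI) (use is_functorD[OF assms] assms in
      \<open>auto simp: category.id_simps category.dom_in category.cod_in category.ident_left
        category.ident_right\<close>)

lemma is_nattrans_comp:
  assumes "is_nattrans C D (F, G, t)" "is_nattrans C D (G, H, s)"
  shows "is_nattrans C D (F, H, \<lambda>a \<in> Ob C. Comp D (s a) (t a))"
proof -
  note t = is_nattransD[OF assms(1)] and s = is_nattransD[OF assms(2)]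
  note F = is_functorD[OF t(1)] and G = is_functorD[OF t(2)] and H = is_functorD[OF s(2)]
  interpret C: category C by (rule F)
  interpret D: category D by (rule F)
  show ?thesis
  proof (rule is_nattransI)
    fix f assume f: "f \<in> Arr C"
    have "D.cmp (D.cmp (s (Cod C f)) (t (Cod C f))) (farr F f)
        = D.cmp (s (Cod C f)) (D.cmp (t (Cod C f)) (farr F f))"
      using f t(3-5) s(3-5) F by simp
    also have "\<dots> = D.cmp (s (Cod C f)) (D.cmp (farr G f) (t (Dom C f)))"
      using f t(6) by simp
    also have "\<dots> = D.cmp (D.cmp (s (Cod C f)) (farr G f)) (t (Dom C f))"
      using f t(3-5) s(3-5) F G by simp
    also have "\<dots> = D.cmp (D.cmp (farr H f) (s (Dom C f))) (t (Dom C f))"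
      using f s(6) by simp
    also have "\<dots> = D.cmp (farr H f) (D.cmp (s (Dom C f)) (t (Dom C f)))"
      using f t(3-5) s(3-5) F G H by simp
    finally show "D.cmp ((\<lambda>a \<in> Ob C. D.cmp (s a) (t a)) (Cod C f)) (farr F f)
        = D.cmp (farr H f) ((\<lambda>a \<in> Ob C. D.cmp (s a) (t a)) (Dom C f))"
      using f by simp
  qed (use t(1-5) s(1-5) in auto)
qed

lemma functor_cat_sel [simp]:
  "Ob (functor_cat C D) = {F. is_functor C D F}"
  "Arr (functor_cat C D) = {t. is_nattrans C D t}"
  "Dom (functor_cat C D) (F, G, t) = F"
  "Cod (functor_cat C D) (F, G, t) = G"
  "Id (functor_cat C D) F = (F, F, \<lambda>a \<in> Ob C. Id D (fobj F a))"
  "Comp (functor_cat C D) (G', H, s) (F, G, t) = (F, H, \<lambda>a \<in> Ob C. Comp D (s a) (t a))"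
  by (simp_all add: functor_cat_def)

lemma homs_functor_cat:
  "x \<in> homs (functor_cat C D) F G \<longleftrightarrow> (\<exists>t. x = (F, G, t) \<and> is_nattrans C D (F, G, t))"
  by (cases x) (auto simp: homs_iff)

lemma category_functor_cat:
  fixes C :: "('o, 'm) cat" and D :: "('p, 'n) cat"
  shows "category (functor_cat C D)"
proof (unfold_locales, goal_cases)
  case (1 f)
  then show ?case by (cases f) (auto dest: is_nattransD)
next
  case (2 f)
  then show ?case by (cases f) (auto dest: is_nattransD)
next
  case (3 a)
  then show ?case by (auto simp: homs_iff intro: is_nattrans_id)
next
  case (4 f a b g c)
  then show ?case by (auto simp: homs_functor_cat intro: is_nattrans_comp)
next
  case (5 f a b)
  then obtain t where f: "f = (a, b, t)" and t: "is_nattrans C D (a, b, t)"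
    by (auto simp: homs_functor_cat)
  note D = is_functorD(2)[OF is_nattransD(1)[OF t]]
  have "(\<lambda>x \<in> Ob C. Comp D ((\<lambda>x \<in> Ob C. Id D (fobj b x)) x) (t x)) = t"
    by (rule extensionalityI[where A="Ob C"])
      (use is_nattransD[OF t] D in \<open>auto simp: category.ident_left\<close>)
  then show ?case by (simp add: f)
next
  case (6 f a b)
  then obtain t where f: "f = (a, b, t)" and t: "is_nattrans C D (a, b, t)"
    by (auto simp: homs_functor_cat)
  note D = is_functorD(2)[OF is_nattransD(1)[OF t]]
  have "(\<lambda>x \<in> Ob C. Comp D (t x) ((\<lambda>x \<in> Ob C. Id D (fobj a x)) x)) = t"
    by (rule extensionalityI[where A="Ob C"])
      (use is_nattransD[OF t] D in \<open>auto simp: category.ident_right\<close>)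
  then show ?case by (simp add: f)
next
  case (7 f a b g c h d)
  then obtain t s r where eq: "f = (a, b, t)" "g = (b, c, s)" "h = (c, d, r)"
    and t: "is_nattrans C D (a, b, t)" and s: "is_nattrans C D (b, c, s)"
    and r: "is_nattrans C D (c, d, r)"
    by (auto simp: homs_functor_cat)
  note D = is_functorD(2)[OF is_nattransD(1)[OF t]]
  show ?case
    using is_nattransD[OF t] is_nattransD[OF s] is_nattransD[OF r] D
    by (auto simp: eq category.assoc restrict_def)
qed

text \<open>Pointwise inverses are automatically natural: compose the naturality square of
  \<open>t\<close> with the inverses on both sides.\<close>

lemma nattrans_iso:
  assumes t: "is_nattrans C D (F, G, t)" and iso: "\<And>a. a \<in> Ob C \<Longrightarrow> is_iso D (t a)"
  shows "is_iso (functor_cat C D) (F, G, t)"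
proof -
  note nt = is_nattransD[OF t]
  note F = is_functorD[OF nt(1)] and G = is_functorD[OF nt(2)]
  interpret C: category C by (rule F)
  interpret D: category D by (rule F)
  have "\<exists>g. g \<in> homs D (Cod D (t a)) (Dom D (t a)) \<and>
        D.cmp g (t a) = Id D (Dom D (t a)) \<and> D.cmp (t a) g = Id D (Cod D (t a))" if "a \<in> Ob C" for a
    using iso[OF that] unfolding is_iso_def by blast
  then obtain s where s: "\<And>a. a \<in> Ob C \<Longrightarrow> s a \<in> homs D (Cod D (t a)) (Dom D (t a)) \<and>
        D.cmp (s a) (t a) = Id D (Dom D (t a)) \<and> D.cmp (t a) (s a) = Id D (Cod D (t a))"
    by metis
  define s' where "s' = (\<lambda>a \<in> Ob C. s a)"
  have s': "s' a \<in> Arr D" "Dom D (s' a) = fobj G a" "Cod D (s' a) = fobj F a"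
      "D.cmp (s' a) (t a) = Id D (fobj F a)" "D.cmp (t a) (s' a) = Id D (fobj G a)" if "a \<in> Ob C" for a
    using s[OF that] that nt(3-5)[OF that] by (auto simp: homs_iff s'_def)
  have nat: "is_nattrans C D (G, F, s')"
  proof (rule is_nattransI)
    fix f assume f: "f \<in> Arr C"
    have "D.cmp (s' (Cod C f)) (farr G f) = D.cmp (s' (Cod C f)) (D.cmp (D.cmp (farr G f) (t (Dom C f))) (s' (Dom C f)))"
      using f s' nt(3-5) G by simp
    also have "\<dots> = D.cmp (s' (Cod C f)) (D.cmp (D.cmp (t (Cod C f)) (farr F f)) (s' (Dom C f)))"
      using f nt(6) by simp
    also have "\<dots> = D.cmp (D.cmp (s' (Cod C f)) (t (Cod C f))) (D.cmp (farr F f) (s' (Dom C f)))"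
      using f s'(1-3) nt(3-5) F by simp
    also have "\<dots> = D.cmp (farr F f) (s' (Dom C f))"
      using f s' nt(3-5) F by simp
    finally show "D.cmp (s' (Cod C f)) (farr G f) = D.cmp (farr F f) (s' (Dom C f))" .
  qed (use nt s' in \<open>auto simp: s'_def\<close>)
  show ?thesis
    by (rule category.isoI[OF category_functor_cat, where a=F and b=G and g="(G, F, s')"])
      (use t nat s' in \<open>auto simp: homs_functor_cat restrict_def\<close>)
qed

text \<open>The quasi-inverse sends d to a chosen preimage \<open>o1 d\<close> with an isomorphism
  \<open>e d\<close>, and an arrow h to the lift of its conjugate by \<open>e\<close> and
  \<open>e'\<close>. Faithfulness makes this a functor; it also makes the lifts \<open>n\<close> of
  \<open>e'\<close> natural and inverse to the lifts \<open>k\<close> of \<open>e\<close>.\<close>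

lemma equivalenceI:
  fixes C :: "('o, 'm) cat" and D :: "('p, 'n) cat"
  assumes F: "is_functor C D F"
    and faithful: "\<And>u v. \<lbrakk>u \<in> Arr C; v \<in> Arr C; Dom C u = Dom C v; Cod C u = Cod C v;
        farr F u = farr F v\<rbrakk> \<Longrightarrow> u = v"
    and full: "\<And>a b h. \<lbrakk>a \<in> Ob C; b \<in> Ob C; h \<in> homs D (fobj F a) (fobj F b)\<rbrakk>
        \<Longrightarrow> \<exists>u \<in> homs C a b. farr F u = h"
    and ess: "\<And>d. d \<in> Ob D \<Longrightarrow> \<exists>a \<in> Ob C. \<exists>e \<in> homs D (fobj F a) d. is_iso D e"
  shows "is_equivalence C D F"
proof -
  note Fs [simp] = is_functorD(3-8)[OF F]
  interpret C: category C by (rule is_functorD[OF F])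
  interpret D: category D by (rule is_functorD[OF F])
  have "\<exists>a e e'. a \<in> Ob C \<and> e \<in> homs D (fobj F a) d \<and> e' \<in> homs D d (fobj F a) \<and>
     D.cmp e' e = Id D (fobj F a) \<and> D.cmp e e' = Id D d" if d: "d \<in> Ob D" for d
  proof -
    obtain a e where a: "a \<in> Ob C" "e \<in> homs D (fobj F a) d" "is_iso D e" using ess[OF d] by blast
    obtain e' where "e' \<in> Arr D" "Dom D e' = Cod D e" "Cod D e' = Dom D e"
      "D.cmp e' e = Id D (Dom D e)" "D.cmp e e' = Id D (Cod D e)" using a(3) by (rule D.isoE)
    then have "e' \<in> homs D d (fobj F a)" "D.cmp e' e = Id D (fobj F a)" "D.cmp e e' = Id D d"
      using a(2) by (auto simp: homs_iff)
    then show ?thesis using a by blast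
  qed
  then obtain o1 e e' where o1: "\<And>d. d \<in> Ob D \<Longrightarrow> o1 d \<in> Ob C \<and> e d \<in> homs D (fobj F (o1 d)) d \<and>
     e' d \<in> homs D d (fobj F (o1 d)) \<and>
     D.cmp (e' d) (e d) = Id D (fobj F (o1 d)) \<and> D.cmp (e d) (e' d) = Id D d" by metis
  have e [simp]: "o1 d \<in> Ob C" "e d \<in> Arr D" "Dom D (e d) = fobj F (o1 d)" "Cod D (e d) = d"
      "e' d \<in> Arr D" "Dom D (e' d) = d" "Cod D (e' d) = fobj F (o1 d)"
      "D.cmp (e' d) (e d) = Id D (fobj F (o1 d))" "D.cmp (e d) (e' d) = Id D d"
    if "d \<in> Ob D" for d
    using o1[OF that] by (auto simp: homs_iff)
  have eiso: "is_iso D (e d)" "is_iso D (e' d)" if "d \<in> Ob D" for d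
    using that by (intro D.isoI[where g="e' d"] D.isoI[where g="e d"]; simp add: homs_iff)+
  have "\<exists>u. u \<in> homs C (o1 (Dom D h)) (o1 (Cod D h)) \<and>
      farr F u = D.cmp (e' (Cod D h)) (D.cmp h (e (Dom D h)))" if "h \<in> Arr D" for h
    using full[of "o1 (Dom D h)" "o1 (Cod D h)" "D.cmp (e' (Cod D h)) (D.cmp h (e (Dom D h)))"] that
    by (auto simp: homs_iff)
  then obtain a1 where a1: "\<And>h. h \<in> Arr D \<Longrightarrow> a1 h \<in> homs C (o1 (Dom D h)) (o1 (Cod D h)) \<and>
      farr F (a1 h) = D.cmp (e' (Cod D h)) (D.cmp h (e (Dom D h)))" by metis
  have a1 [simp]: "a1 h \<in> Arr C" "Dom C (a1 h) = o1 (Dom D h)" "Cod C (a1 h) = o1 (Cod D h)"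
      "farr F (a1 h) = D.cmp (e' (Cod D h)) (D.cmp h (e (Dom D h)))" if "h \<in> Arr D" for h
    using a1[OF that] by (auto simp: homs_iff)
  have ee'[simp]: "D.cmp (e d) (D.cmp (e' d) x) = x" if "d \<in> Ob D" "x \<in> Arr D" "Cod D x = d" for d x
    using that by (simp flip: D.assoc)
  define G where "G = \<lparr>fobj = (\<lambda>d \<in> Ob D. o1 d), farr = (\<lambda>h \<in> Arr D. a1 h)\<rparr>"
  have Gs [simp]: "\<And>d. d \<in> Ob D \<Longrightarrow> fobj G d = o1 d" "\<And>h. h \<in> Arr D \<Longrightarrow> farr G h = a1 h"
    by (auto simp: G_def)
  have G: "is_functor D C G"
    unfolding is_functor_def
  proof (intro conjI ballI impI)
    fix d assume "d \<in> Ob D"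
    then show "farr G (Id D d) = Id C (fobj G d)" by (auto intro!: faithful)
  next
    fix f g assume "f \<in> Arr D" "g \<in> Arr D" "Dom D g = Cod D f"
    then show "farr G (D.cmp g f) = C.cmp (farr G g) (farr G f)"
      by (auto intro!: faithful)
  qed (auto simp: G_def homs_iff C.category_axioms D.category_axioms)
  have "\<exists>u. u \<in> homs C c (o1 (fobj F c)) \<and> farr F u = e' (fobj F c)" if "c \<in> Ob C" for c
    using full[of c "o1 (fobj F c)" "e' (fobj F c)"] that by (auto simp: homs_iff)
  then obtain n where n: "\<And>c. c \<in> Ob C \<Longrightarrow> n c \<in> homs C c (o1 (fobj F c)) \<and> farr F (n c) = e' (fobj F c)"
    by metis
  have "\<exists>u. u \<in> homs C (o1 (fobj F c)) c \<and> farr F u = e (fobj F c)" if "c \<in> Ob C" for c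
    using full[of "o1 (fobj F c)" c "e (fobj F c)"] that by (auto simp: homs_iff)
  then obtain k where k: "\<And>c. c \<in> Ob C \<Longrightarrow> k c \<in> homs C (o1 (fobj F c)) c \<and> farr F (k c) = e (fobj F c)"
    by metis
  have n [simp]: "n c \<in> Arr C" "Dom C (n c) = c" "Cod C (n c) = o1 (fobj F c)"
      "farr F (n c) = e' (fobj F c)" if "c \<in> Ob C" for c using n[OF that] by (auto simp: homs_iff)
  have k [simp]: "k c \<in> Arr C" "Cod C (k c) = c" "Dom C (k c) = o1 (fobj F c)"
      "farr F (k c) = e (fobj F c)" if "c \<in> Ob C" for c using k[OF that] by (auto simp: homs_iff)
  have niso: "is_iso C (n c)" if "c \<in> Ob C" for c
    by (rule C.isoI[where a=c and b="o1 (fobj F c)" and g="k c"])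
      (use that in \<open>auto simp: homs_iff intro!: faithful\<close>)
  have Nn: "is_nattrans C C (id_functor C, comp_functor C G F, \<lambda>c \<in> Ob C. n c)"
  proof (rule is_nattransI)
    fix f assume f: "f \<in> Arr C"
    then show "C.cmp ((\<lambda>c \<in> Ob C. n c) (Cod C f)) (farr (id_functor C) f) =
         C.cmp (farr (comp_functor C G F) f) ((\<lambda>c \<in> Ob C. n c) (Dom C f))"
      by (auto intro!: faithful)
  qed (use F G comp_functor_functor id_functor_functor C.category_axioms in auto)
  have Ne: "is_nattrans D D (comp_functor D F G, id_functor D, \<lambda>c \<in> Ob D. e c)"
  proof (rule is_nattransI)
    fix f assume f: "f \<in> Arr D"
    then show "D.cmp ((\<lambda>c \<in> Ob D. e c) (Cod D f)) (farr (comp_functor D F G) f) =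
         D.cmp (farr (id_functor D) f) ((\<lambda>c \<in> Ob D. e c) (Dom D f))"
      by auto
  qed (use F G comp_functor_functor id_functor_functor D.category_axioms in auto)
  show ?thesis
    unfolding is_equivalence_def
  proof (intro conjI exI)
    show "is_iso (functor_cat C C) (id_functor C, comp_functor C G F, \<lambda>c \<in> Ob C. n c)"
      by (rule nattrans_iso[OF Nn]) (simp add: niso)
    show "is_iso (functor_cat D D) (comp_functor D F G, id_functor D, \<lambda>c \<in> Ob D. e c)"
      by (rule nattrans_iso[OF Ne]) (simp add: eiso)
  qed (use F G Nn Ne in \<open>auto simp: homs_functor_cat\<close>)
qed

section \<open>Zero arrows, kernels and cokernels\<close>

context category
begin

lemma zero_arrowE:
  assumes "zero_arrow C f"
  obtains z u v where "zero_object C z" "u \<in> Arr C" "v \<in> Arr C" "Dom C u = Dom C f" "Cod C u = z"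
    "Dom C v = z" "Cod C v = Cod C f" "f = v \<cdot> u" "f \<in> Arr C"
proof -
  obtain z u v where *: "zero_object C z" "u \<in> Arr C" "v \<in> Arr C" "Dom C u = Dom C f" "Cod C u = z"
    "Dom C v = z" "Cod C v = Cod C f" "f = v \<cdot> u"
    using assms unfolding zero_arrow_def homs_def by blast
  then have "v \<cdot> u \<in> Arr C" by simp
  with * that show ?thesis by metis
qed

lemma zero_arrow_arr: "zero_arrow C f \<Longrightarrow> f \<in> Arr C"
  by (erule zero_arrowE)

lemma zero_arrowI:
  assumes "zero_object C (Cod C u)" "u \<in> Arr C" "v \<in> Arr C" "Dom C v = Cod C u"
  shows "zero_arrow C (v \<cdot> u)"
  unfolding zero_arrow_def
  by (rule exI[of _ "Cod C u"], rule exI[of _ u], rule exI[of _ v]) (use assms in \<open>simp add: homs_iff\<close>)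

lemma zero_object_Ob: "zero_object C z \<Longrightarrow> z \<in> Ob C"
  by (simp add: zero_object_def)

lemma zero_object_in_unique:
  assumes "zero_object C z" "f \<in> Arr C" "g \<in> Arr C" "Cod C f = z" "Cod C g = z" "Dom C f = Dom C g"
  shows "f = g"
proof -
  have "\<exists>!h. h \<in> homs C (Dom C f) z" using assms dom_in[of f] unfolding zero_object_def by blast
  moreover have "f \<in> homs C (Dom C f) z" "g \<in> homs C (Dom C f) z" using assms by (auto simp: homs_iff)
  ultimately show ?thesis by blast
qed

lemma zero_object_out_unique:
  assumes "zero_object C z" "f \<in> Arr C" "g \<in> Arr C" "Dom C f = z" "Dom C g = z" "Cod C f = Cod C g"
  shows "f = g"
proof -
  have "\<exists>!h. h \<in> homs C z (Cod C f)" using assms cod_in[of f] unfolding zero_object_def by blast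
  moreover have "f \<in> homs C z (Cod C f)" "g \<in> homs C z (Cod C f)" using assms by (auto simp: homs_iff)
  ultimately show ?thesis by blast
qed

lemma zero_object_ex:
  assumes "zero_object C z" "x \<in> Ob C"
  obtains u v where "u \<in> Arr C" "Dom C u = x" "Cod C u = z" "v \<in> Arr C" "Dom C v = z" "Cod C v = x"
proof -
  have "\<exists>u. u \<in> homs C x z" "\<exists>v. v \<in> homs C z x"
    using assms unfolding zero_object_def by blast+
  then show ?thesis using that unfolding homs_def by blast
qed

lemma zero_arrow_outof: "\<lbrakk>zero_object C z; f \<in> Arr C; Dom C f = z\<rbrakk> \<Longrightarrow> zero_arrow C f"
  using zero_arrowI[of "Id C z" f] by (simp add: zero_object_Ob)

text \<open>The two arrows may factor through different zero objects; an arrow \<open>w\<close>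
  between these objects compares the factorisations.\<close>

lemma zero_arrow_unique:
  assumes "zero_arrow C f" "zero_arrow C g" "Dom C f = Dom C g" "Cod C f = Cod C g"
  shows "f = g"
proof -
  obtain z u v where f: "zero_object C z" "u \<in> Arr C" "v \<in> Arr C" "Dom C u = Dom C f" "Cod C u = z"
    "Dom C v = z" "Cod C v = Cod C f" "f = v \<cdot> u" using assms(1) by (rule zero_arrowE)
  obtain z' u' v' where g: "zero_object C z'" "u' \<in> Arr C" "v' \<in> Arr C" "Dom C u' = Dom C g"
    "Cod C u' = z'" "Dom C v' = z'" "Cod C v' = Cod C g" "g = v' \<cdot> u'"
    using assms(2) by (rule zero_arrowE)
  obtain w where w: "w \<in> Arr C" "Dom C w = z" "Cod C w = z'"
    using zero_object_ex[OF g(1) zero_object_Ob[OF f(1)]] by metis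
  have "u' = w \<cdot> u" by (rule zero_object_in_unique[OF g(1)]) (use f(1-7) g(1-7) w assms(3,4) in auto)
  moreover have "v = v' \<cdot> w" by (rule zero_object_out_unique[OF f(1)]) (use f(1-7) g(1-7) w assms(3,4) in auto)
  ultimately show ?thesis unfolding f(8) g(8) using f(2-7) g(2-7) w by simp
qed

lemma zero_cmp_left:
  assumes "zero_arrow C f" "g \<in> Arr C" "Dom C g = Cod C f"
  shows "zero_arrow C (g \<cdot> f)"
proof -
  obtain z u v where f: "zero_object C z" "u \<in> Arr C" "v \<in> Arr C" "Dom C u = Dom C f" "Cod C u = z"
    "Dom C v = z" "Cod C v = Cod C f" "f = v \<cdot> u" using assms(1) by (rule zero_arrowE)
  have "zero_arrow C ((g \<cdot> v) \<cdot> u)"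
    by (rule zero_arrowI) (use f(1-7) assms in auto)
  then show ?thesis using f(2,3,5,6) assms(2,3) unfolding f(8) by simp
qed

lemma zero_cmp_right:
  assumes "zero_arrow C g" "f \<in> Arr C" "Dom C g = Cod C f"
  shows "zero_arrow C (g \<cdot> f)"
proof -
  obtain z u v where g: "zero_object C z" "u \<in> Arr C" "v \<in> Arr C" "Dom C u = Dom C g" "Cod C u = z"
    "Dom C v = z" "Cod C v = Cod C g" "g = v \<cdot> u" using assms(1) by (rule zero_arrowE)
  have "zero_arrow C (v \<cdot> u \<cdot> f)"
    by (rule zero_arrowI) (use g(1-7) assms in auto)
  then show ?thesis using g(2,3,5,6) assms(2,3) unfolding g(8) by simp
qed

lemma pushoutD:
  assumes "is_pushout C f g f' g'" "h \<in> homs C (Cod C f) x" "k \<in> homs C (Cod C g) x"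
    "h \<cdot> f = k \<cdot> g"
  shows "\<exists>!u. u \<in> homs C (Cod C f') x \<and> u \<cdot> f' = h \<and> u \<cdot> g' = k"
  using assms unfolding is_pushout_def by blast

text \<open>Monicity is the uniqueness clause: if k u = k v, then \<open>u\<close> and
  \<open>v\<close> both factor \<open>k \<cdot> u\<close>, an arrow that \<open>f\<close>
  kills.\<close>

lemma kernelD:
  assumes "is_kernel C k f"
  shows "f \<in> Arr C" "k \<in> Arr C" "Cod C k = Dom C f" "zero_arrow C (f \<cdot> k)" "is_mono C k"
    and "\<lbrakk>h \<in> Arr C; Cod C h = Dom C f; zero_arrow C (f \<cdot> h)\<rbrakk>
      \<Longrightarrow> \<exists>u. u \<in> Arr C \<and> Dom C u = Dom C h \<and> Cod C u = Dom C k \<and> k \<cdot> u = h"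
proof -
  show k: "f \<in> Arr C" "k \<in> Arr C" "Cod C k = Dom C f" and z: "zero_arrow C (f \<cdot> k)"
    using assms by (auto simp: is_kernel_def)
  have U: "\<exists>!u. u \<in> homs C (Dom C h) (Dom C k) \<and> k \<cdot> u = h"
    if "h \<in> Arr C" "Cod C h = Dom C f" "zero_arrow C (f \<cdot> h)" for h
    using assms that unfolding is_kernel_def homs_def by blast
  show "\<exists>u. u \<in> Arr C \<and> Dom C u = Dom C h \<and> Cod C u = Dom C k \<and> k \<cdot> u = h"
    if "h \<in> Arr C" "Cod C h = Dom C f" "zero_arrow C (f \<cdot> h)"
    using U[OF that] unfolding homs_def by blast
  have "u = v" if "u \<in> Arr C" "v \<in> Arr C" "Cod C u = Dom C k" "Cod C v = Dom C k"
      "Dom C u = Dom C v" "k \<cdot> u = k \<cdot> v" for u v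
  proof -
    have "zero_arrow C ((f \<cdot> k) \<cdot> u)" by (rule zero_cmp_right[OF z]) (use that k in auto)
    then have "\<exists>!w. w \<in> homs C (Dom C u) (Dom C k) \<and> k \<cdot> w = k \<cdot> u"
      using U[of "k \<cdot> u"] that k by simp
    moreover have "u \<in> homs C (Dom C u) (Dom C k)" "v \<in> homs C (Dom C u) (Dom C k)"
      using that by (auto simp: homs_iff)
    ultimately show ?thesis using that(6) by metis
  qed
  then show "is_mono C k" using k unfolding is_mono_def homs_def by auto
qed

lemma cokernelD:
  assumes "is_cokernel C q f"
  shows "f \<in> Arr C" "q \<in> Arr C" "Dom C q = Cod C f" "zero_arrow C (q \<cdot> f)" "is_epi C q"
    and "\<lbrakk>h \<in> Arr C; Dom C h = Cod C f; zero_arrow C (h \<cdot> f)\<rbrakk>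
      \<Longrightarrow> \<exists>u. u \<in> Arr C \<and> Dom C u = Cod C q \<and> Cod C u = Cod C h \<and> u \<cdot> q = h"
proof -
  show k: "f \<in> Arr C" "q \<in> Arr C" "Dom C q = Cod C f" and z: "zero_arrow C (q \<cdot> f)"
    using assms by (auto simp: is_cokernel_def)
  have U: "\<exists>!u. u \<in> homs C (Cod C q) (Cod C h) \<and> u \<cdot> q = h"
    if "h \<in> Arr C" "Dom C h = Cod C f" "zero_arrow C (h \<cdot> f)" for h
    using assms that unfolding is_cokernel_def homs_def by blast
  show "\<exists>u. u \<in> Arr C \<and> Dom C u = Cod C q \<and> Cod C u = Cod C h \<and> u \<cdot> q = h"
    if "h \<in> Arr C" "Dom C h = Cod C f" "zero_arrow C (h \<cdot> f)"
    using U[OF that] unfolding homs_def by blast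
  have "u = v" if "u \<in> Arr C" "v \<in> Arr C" "Dom C u = Cod C q" "Dom C v = Cod C q"
      "Cod C u = Cod C v" "u \<cdot> q = v \<cdot> q" for u v
  proof -
    have "zero_arrow C (u \<cdot> q \<cdot> f)" by (rule zero_cmp_left[OF z]) (use that k in auto)
    then have "\<exists>!w. w \<in> homs C (Cod C q) (Cod C u) \<and> w \<cdot> q = u \<cdot> q"
      using U[of "u \<cdot> q"] that(1,3) k by simp
    moreover have "u \<in> homs C (Cod C q) (Cod C u)" "v \<in> homs C (Cod C q) (Cod C u)"
      using that by (auto simp: homs_iff)
    ultimately show ?thesis using that(6) by metis
  qed
  then show "is_epi C q" using k unfolding is_epi_def homs_def by auto
qed

lemma kernelI:
  assumes "f \<in> Arr C" "is_mono C k" "Cod C k = Dom C f" "zero_arrow C (f \<cdot> k)"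
    and fact: "\<And>h. \<lbrakk>h \<in> Arr C; Cod C h = Dom C f; zero_arrow C (f \<cdot> h)\<rbrakk>
      \<Longrightarrow> \<exists>u. u \<in> Arr C \<and> Dom C u = Dom C h \<and> Cod C u = Dom C k \<and> k \<cdot> u = h"
  shows "is_kernel C k f"
proof -
  have "\<exists>!u. u \<in> homs C (Dom C h) (Dom C k) \<and> k \<cdot> u = h"
    if h: "h \<in> Arr C" "Cod C h = Dom C f" "zero_arrow C (f \<cdot> h)" for h
  proof -
    obtain u where u: "u \<in> Arr C" "Dom C u = Dom C h" "Cod C u = Dom C k" "k \<cdot> u = h"
      using fact[OF h] by blast
    show ?thesis
    proof (rule ex1I[of _ u])
      fix v assume "v \<in> homs C (Dom C h) (Dom C k) \<and> k \<cdot> v = h"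
      then have "v \<in> homs C (Dom C h) (Dom C k)" "k \<cdot> v = h" by auto
      then show "v = u"
        using u mono_cancel[OF assms(2), of v u] by (simp add: homs_iff)
    qed (use u in \<open>auto simp: homs_iff\<close>)
  qed
  then show ?thesis using assms(1,3,4) mono_arr[OF assms(2)] unfolding is_kernel_def homs_def by simp
qed

end

section \<open>Exactness in abelian categories\<close>

context abelian_category
begin

lemma zero_arrow_ex:
  assumes "a \<in> Ob C" "b \<in> Ob C"
  obtains z where "zero_arrow C z" "Dom C z = a" "Cod C z = b"
proof -
  obtain z where z: "zero_object C z" using ex_zero_object by blast
  obtain u where u: "u \<in> Arr C" "Dom C u = a" "Cod C u = z" using zero_object_ex[OF z assms(1)] by metis
  obtain v where v: "v \<in> Arr C" "Dom C v = z" "Cod C v = b" using zero_object_ex[OF z assms(2)] by metis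
  show thesis using that[of "v \<cdot> u"] zero_arrowI[of u v] u v z by simp
qed

lemma epi_zero_cancel:
  assumes "is_epi C e" "zero_arrow C (f \<cdot> e)" "f \<in> Arr C" "Dom C f = Cod C e"
  shows "zero_arrow C f"
proof -
  obtain z where z: "zero_arrow C z" "Dom C z = Dom C f" "Cod C z = Cod C f"
    using zero_arrow_ex[OF dom_in[OF assms(3)] cod_in[OF assms(3)]] by metis
  note zero_arrow_arr[OF z(1), simp] epi_arr[OF assms(1), simp]
  have "z \<cdot> e = f \<cdot> e"
    by (rule zero_arrow_unique[OF zero_cmp_right[OF z(1)] assms(2)]) (use z assms in auto)
  then have "z = f" by (rule epi_cancel[OF assms(1)]) (use z assms in auto)
  then show ?thesis using z by simp
qed

lemma mono_zero_cancel:
  assumes "is_mono C e" "zero_arrow C (e \<cdot> f)" "f \<in> Arr C" "Dom C e = Cod C f"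
  shows "zero_arrow C f"
proof -
  obtain z where z: "zero_arrow C z" "Dom C z = Dom C f" "Cod C z = Cod C f"
    using zero_arrow_ex[OF dom_in[OF assms(3)] cod_in[OF assms(3)]] by metis
  note zero_arrow_arr[OF z(1), simp] mono_arr[OF assms(1), simp]
  have "e \<cdot> z = e \<cdot> f"
    by (rule zero_arrow_unique[OF zero_cmp_left[OF z(1)] assms(2)]) (use z assms in auto)
  then have "z = f" by (rule mono_cancel[OF assms(1)]) (use z assms in auto)
  then show ?thesis using z by simp
qed

text \<open>By subtraction: f u = f v gives f (u - v) = 0, so u - v = 0. The preadditive structure
  enters here and is translated at once into zero arrows.\<close>

lemma mono_if_kernel_zero:
  assumes f: "f \<in> Arr C"
    and ker: "\<And>x. \<lbrakk>x \<in> Arr C; Cod C x = Dom C f; zero_arrow C (f \<cdot> x)\<rbrakk> \<Longrightarrow> zero_arrow C x"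
  shows "is_mono C f"
proof -
  obtain add where add: "preadditive_structure C add" using ex_preadditive by blast
  define H where "H a b z = \<lparr>carrier = homs C a b, monoid.mult = add, one = z\<rparr>" for a b z
  have grp: "\<exists>z. comm_group (H a b z)" if "a \<in> Ob C" "b \<in> Ob C" for a b
    using add that unfolding preadditive_structure_def H_def by blast
  have distr: "g \<cdot> add s t = add (g \<cdot> s) (g \<cdot> t)"
    if "s \<in> homs C a b" "t \<in> homs C a b" "g \<in> homs C b c" for g s t a b c
    using add that unfolding preadditive_structure_def by blast
  \<comment> \<open>Composition is assumed additive, with no clause about units; the unit of a
    hom-group is therefore recognised as its only idempotent.\<close>
  have idem: "x = z" if "comm_group (H a b z)" "x \<in> homs C a b" "add x x = x" for x a b z
  proof -
    interpret G: comm_group "H a b z" by fact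
    show ?thesis using that(2,3) G.r_cancel_one[of x x] by (simp add: H_def)
  qed
  \<comment> \<open>The only arrow \<open>u\<close> into a zero object satisfies
    \<open>add u u = u\<close>, so \<open>v \<cdot> u\<close> is idempotent and equals the
    unit.\<close>
  have zero_one: "zero_arrow C z" if G: "comm_group (H a b z)" and ab: "a \<in> Ob C" "b \<in> Ob C" for a b z
  proof -
    obtain o1 where o1: "zero_object C o1" using ex_zero_object by blast
    obtain u where u: "u \<in> Arr C" "Dom C u = a" "Cod C u = o1" using zero_object_ex[OF o1 ab(1)] by metis
    obtain v where v: "v \<in> Arr C" "Dom C v = o1" "Cod C v = b" using zero_object_ex[OF o1 ab(2)] by metis
    obtain y where "comm_group (H a o1 y)" using grp[OF ab(1) zero_object_Ob[OF o1]] by blast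
    then interpret Y: comm_group "H a o1 y" .
    have "add u u \<in> homs C a o1"
      using Y.m_closed[of u u] u by (simp add: H_def homs_iff)
    then have "add u u = u"
      using u zero_object_in_unique[OF o1] by (auto simp: homs_iff)
    moreover have "v \<cdot> add u u = add (v \<cdot> u) (v \<cdot> u)"
      by (rule distr[where a=a and b=o1 and c=b]) (use u v in \<open>auto simp: homs_iff\<close>)
    ultimately have "v \<cdot> u = z"
      by (intro idem[OF G]) (use u v in \<open>auto simp: homs_iff\<close>)
    then show ?thesis using zero_arrowI[of u v] u v o1 by simp
  qed
  have "u = v" if uv: "u \<in> Arr C" "v \<in> Arr C" "Cod C u = Dom C f" "Cod C v = Dom C f"
      "Dom C u = Dom C v" "f \<cdot> u = f \<cdot> v" for u v
  proof -
    let ?a = "Dom C u" and ?b = "Dom C f"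
    obtain z where G: "comm_group (H ?a ?b z)" using grp uv f by fastforce
    then interpret G: comm_group "H ?a ?b z" .
    have u: "u \<in> carrier (H ?a ?b z)" "v \<in> carrier (H ?a ?b z)" using uv by (auto simp: H_def homs_iff)
    \<comment> \<open>\<open>w\<close> is -v, so that \<open>add u w\<close> is the difference u -
      v.\<close>
    define w where "w = inv\<^bsub>H ?a ?b z\<^esub> v"
    have w: "w \<in> carrier (H ?a ?b z)" using u by (simp add: w_def)
    have homs: "u \<in> homs C ?a ?b" "v \<in> homs C ?a ?b" "w \<in> homs C ?a ?b" "add u w \<in> homs C ?a ?b"
      using u w G.m_closed[OF u(1) w] by (auto simp: H_def)
    have zz: "add v w = z" using G.r_inv[OF u(2)] by (simp add: w_def H_def)
    have "f \<cdot> add u w = f \<cdot> add v w"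
      using distr[OF homs(1,3), of f "Cod C f"] distr[OF homs(2,3), of f "Cod C f"] f uv(6)
      by (simp add: homs_iff)
    moreover have z0: "zero_arrow C z" using zero_one[OF G] uv f by simp
    moreover have "z \<in> homs C ?a ?b" using G.one_closed by (simp add: H_def)
    ultimately have "zero_arrow C (f \<cdot> add u w)"
      using zero_cmp_left[OF z0 f] zz by (simp add: homs_iff)
    then have "zero_arrow C (add u w)" using ker homs by (simp add: homs_iff)
    then have "add u w = z"
      using zero_arrow_unique[OF _ z0] homs \<open>z \<in> homs C ?a ?b\<close> by (simp add: homs_iff)
    then have "inv\<^bsub>H ?a ?b z\<^esub> w = u"
      using G.inv_equality[of u w] u w by (simp add: H_def)
    then show "u = v" using u by (simp add: w_def)
  qed
  then show ?thesis using f unfolding is_mono_def homs_def by auto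
qed

text \<open>Let \<open>g\<close> kill \<open>x\<close> and let \<open>w\<close> be the cokernel of
  \<open>x\<close>, so that \<open>g\<close> factors through \<open>w\<close>. The epi w q is the
  cokernel of some \<open>h\<close>; as \<open>f\<close> kills \<open>h\<close>, the latter factors
  through \<open>k\<close>, hence q h = 0. So \<open>q\<close> factors through w q, which makes
  \<open>w\<close> a split mono, and w x = 0 gives x = 0.\<close>

lemma coimage_mono:
  assumes k: "is_kernel C k f" and q: "is_cokernel C q k"
    and g: "g \<in> Arr C" "Dom C g = Cod C q" "g \<cdot> q = f"
  shows "is_mono C g"
proof (rule mono_if_kernel_zero[OF g(1)])
  note [simp] = kernelD(1-3)[OF k] cokernelD(2,3)[OF q] g(1,2)
  fix x assume x [simp]: "x \<in> Arr C" "Cod C x = Dom C g" and zx: "zero_arrow C (g \<cdot> x)"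
  obtain w where w: "is_cokernel C w x" using ex_cokernel[of x] by auto
  note [simp] = cokernelD(2,3)[OF w]
  obtain g' where g' [simp]: "g' \<in> Arr C" "Dom C g' = Cod C w" and gw: "g' \<cdot> w = g"
    using cokernelD(6)[OF w g(1)] zx by auto
  have "is_epi C (w \<cdot> q)" by (rule epi_cmp[OF cokernelD(5)[OF q] cokernelD(5)[OF w]]) simp
  then obtain h where h: "is_cokernel C (w \<cdot> q) h" using epi_normal by blast
  have h2 [simp]: "h \<in> Arr C" "Cod C h = Dom C q" using cokernelD(1,3)[OF h] by simp_all
  have z: "zero_arrow C (w \<cdot> q \<cdot> h)" using cokernelD(4)[OF h] by simp
  have "f \<cdot> h = g' \<cdot> w \<cdot> q \<cdot> h"
    unfolding g(3)[symmetric] gw[symmetric] by simp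
  then have "zero_arrow C (f \<cdot> h)" using zero_cmp_left[OF z] by simp
  then obtain h' where h': "h' \<in> Arr C" "Cod C h' = Dom C k" "k \<cdot> h' = h"
    using kernelD(6)[OF k, of h] by auto
  have "zero_arrow C ((q \<cdot> k) \<cdot> h')"
    by (rule zero_cmp_right[OF cokernelD(4)[OF q]]) (use h' in auto)
  then have "zero_arrow C (q \<cdot> h)"
    using h'(1,2) unfolding h'(3)[symmetric] by simp
  then obtain v where v: "v \<in> Arr C" "Dom C v = Cod C w" "Cod C v = Cod C q" "v \<cdot> w \<cdot> q = q"
    using cokernelD(6)[OF h, of q] by auto
  have "v \<cdot> w = Id C (Cod C q)"
    by (rule epi_cancel[OF cokernelD(5)[OF q]]) (use v in auto)
  then have "x = (v \<cdot> w) \<cdot> x" by simp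
  then have "x = v \<cdot> w \<cdot> x" using v by simp
  then show "zero_arrow C x" using zero_cmp_left[OF cokernelD(4)[OF w], of v] v by simp
qed

text \<open>\<open>m\<close> is the kernel of some \<open>g\<close>, and \<open>g\<close> factors
  through \<open>q\<close>; hence what \<open>q\<close> kills is killed by \<open>g\<close> and
  factors through \<open>m\<close>.\<close>

lemma mono_kernel_of_cokernel:
  assumes m: "is_mono C m" and q: "is_cokernel C q m"
  shows "is_kernel C m q"
proof (rule kernelI)
  note [simp] = mono_arr[OF m] cokernelD(2,3)[OF q]
  fix h assume h: "h \<in> Arr C" "Cod C h = Dom C q" "zero_arrow C (q \<cdot> h)"
  obtain g where g: "is_kernel C m g" using mono_normal[OF m] by blast
  obtain g' where g': "g' \<in> Arr C" "Dom C g' = Cod C q" "g' \<cdot> q = g"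
    using cokernelD(6)[OF q kernelD(1)[OF g]] kernelD(3,4)[OF g] by auto
  have "zero_arrow C (g \<cdot> h)"
    using zero_cmp_left[OF h(3), of g'] h(1,2) g'(1,2) by (simp flip: g'(3))
  then show "\<exists>u. u \<in> Arr C \<and> Dom C u = Dom C h \<and> Cod C u = Dom C m \<and> m \<cdot> u = h"
    using kernelD(6)[OF g h(1)] h(2) kernelD(3)[OF g] by simp
qed (use assms cokernelD[OF q] in auto)

end

section \<open>Gap complexes\<close>

lemma Ar_sel [simp]:
  "(i, j) \<in> Ob (Ar I) \<longleftrightarrow> i \<in> I \<and> j \<in> I \<and> i \<le> j"
  "((i, j), (k, l)) \<in> Arr (Ar I) \<longleftrightarrow>
     (i, j) \<in> Ob (Ar I) \<and> (k, l) \<in> Ob (Ar I) \<and> i \<le> k \<and> j \<le> l"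
  "Dom (Ar I) = fst" "Cod (Ar I) = snd" "Id (Ar I) x = (x, x)"
  "Comp (Ar I) (y, z) (x, y') = (x, z)"
  by (auto simp: Ar_def Let_def)

lemma category_Ar: "category (Ar (I :: 'i::linorder set))"
  by unfold_locales (auto simp: homs_iff split: prod.splits)

abbreviation amap where "amap F i j k l \<equiv> farr F ((i, j), (k, l))"

locale gap = abelian_category C for C :: "('o, 'm) cat" +
  fixes p :: nat and F :: "(nat \<times> nat, (nat \<times> nat) \<times> (nat \<times> nat), 'o, 'm) functr"
  assumes gap_complex: "gap_complex {0..p} C F"
begin

lemma is_functor: "is_functor (Ar {0..p}) C F"
  using gap_complex by (simp add: gap_complex_def)

lemma fobj_Ob [simp]: "\<lbrakk>i \<le> j; j \<le> p\<rbrakk> \<Longrightarrow> fobj F (i, j) \<in> Ob C"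
  using is_functorD(3)[OF is_functor, of "(i, j)"] by simp

lemma amap_simps [simp]:
  assumes "i \<le> k" "j \<le> l" "i \<le> j" "k \<le> l" "l \<le> p"
  shows "amap F i j k l \<in> Arr C" "Dom C (amap F i j k l) = fobj F (i, j)"
    "Cod C (amap F i j k l) = fobj F (k, l)"
  using is_functorD(4-6)[OF is_functor, of "((i, j), (k, l))"] assms by auto

lemma amap_id [simp]: "\<lbrakk>i \<le> j; j \<le> p\<rbrakk> \<Longrightarrow> amap F i j i j = Id C (fobj F (i, j))"
  using is_functorD(7)[OF is_functor, of "(i, j)"] by simp

lemma amap_comp [simp]:
  assumes "i \<le> k" "j \<le> l" "i \<le> j" "k \<le> l" "l \<le> s" "k \<le> r" "r \<le> s" "s \<le> p"
  shows "amap F k l r s \<cdot> amap F i j k l = amap F i j r s"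
  using is_functorD(8)[OF is_functor, of "((i, j), (k, l))" "((k, l), (r, s))"] assms by simp

lemma amap_comp_ext [simp]:
  assumes "i \<le> k" "j \<le> l" "i \<le> j" "k \<le> l" "l \<le> s" "k \<le> r" "r \<le> s" "s \<le> p"
    and "x \<in> Arr C" "Cod C x = fobj F (i, j)"
  shows "amap F k l r s \<cdot> amap F i j k l \<cdot> x = amap F i j r s \<cdot> x"
  using amap_comp[OF assms(1-8)] assms by (simp flip: assoc)

lemma gapD:
  assumes "i \<le> j" "j \<le> k" "k \<le> p"
  shows "is_mono C (amap F i j i k)" "is_epi C (amap F i k j k)" "zero_object C (fobj F (i, i))"
    "is_pushout C (amap F i j i k) (amap F i j j j) (amap F i k j k) (amap F j j j k)"
  using gap_complex assms unfolding gap_complex_def by auto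

text \<open>The arrow passes through the zero object F (j, j).\<close>

lemma zero_amap:
  assumes "i \<le> j" "j \<le> k" "k \<le> l" "l \<le> p"
  shows "zero_arrow C (amap F i j k l)"
proof -
  have "zero_arrow C (amap F j j k l \<cdot> amap F i j j j)"
    by (rule zero_arrowI) (use assms gapD(3)[of j j j] in auto)
  then show ?thesis using assms by simp
qed

text \<open>A pushout whose corner F (j, j) is a zero object is a cokernel: an arrow that kills F
  (i, j) forms a cocone together with the only arrow out of that corner.\<close>

lemma amap_cokernel:
  assumes ijk: "i \<le> j" "j \<le> k" "k \<le> p"
  shows "is_cokernel C (amap F i k j k) (amap F i j i k)"
proof -
  have "\<exists>!u. u \<in> homs C (fobj F (j, k)) x \<and> u \<cdot> amap F i k j k = h"
    if h: "h \<in> homs C (fobj F (i, k)) x" and z: "zero_arrow C (h \<cdot> amap F i j i k)" for x h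
  proof -
    have zj: "zero_object C (fobj F (j, j))" using gapD(3)[of j j j] ijk by simp
    have hx: "h \<in> Arr C" "Dom C h = fobj F (i, k)" "Cod C h = x" "x \<in> Ob C"
      using h cod_in by (auto simp: homs_iff)
    obtain v where v: "v \<in> Arr C" "Dom C v = fobj F (j, j)" "Cod C v = x"
      using zero_object_ex[OF zj \<open>x \<in> Ob C\<close>] by metis
    have "zero_arrow C (v \<cdot> amap F i j j j)" by (rule zero_arrowI) (use zj ijk v in auto)
    then have "h \<cdot> amap F i j i k = v \<cdot> amap F i j j j"
      using zero_arrow_unique[OF z] hx v ijk by simp
    then obtain u where u: "u \<in> homs C (fobj F (j, k)) x" "u \<cdot> amap F i k j k = h"
      using pushoutD[OF gapD(4)[OF ijk], of h x v] h v ijk by (auto simp: homs_iff)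
    show ?thesis
    proof (rule ex1I[of _ u])
      fix w assume w: "w \<in> homs C (fobj F (j, k)) x \<and> w \<cdot> amap F i k j k = h"
      then have "w \<in> Arr C" "Dom C w = fobj F (j, k)" "Cod C w = x" "w \<cdot> amap F i k j k = h"
        by (auto simp: homs_iff)
      then show "w = u" using u epi_cancel[OF gapD(2)[OF ijk], of w u] ijk by (simp add: homs_iff)
    qed (use u in auto)
  qed
  then show ?thesis unfolding is_cokernel_def using ijk zero_amap by simp
qed

text \<open>Exactness on the left: F (i, j) -> F (i, k) is monic, hence the kernel of its
  cokernel.\<close>

lemma amap_kernel:
  assumes ijk: "i \<le> j" "j \<le> k" "k \<le> p"
  shows "is_kernel C (amap F i j i k) (amap F i k j k)"
  using mono_kernel_of_cokernel gapD(1) amap_cokernel assms by blast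

text \<open>\<open>factor_sub\<close> and \<open>factor_quot\<close> are the two universal
  properties of the short exact sequence F (i, j) -> F (i, k) -> F (j, k), in the form used
  below.\<close>

lemma factor_sub:
  assumes "i \<le> j" "j \<le> k" "k \<le> p" "x \<in> Arr C" "Cod C x = fobj F (i, k)"
    and "zero_arrow C (amap F i k j k \<cdot> x)"
  obtains u where "u \<in> Arr C" "Dom C u = Dom C x" "Cod C u = fobj F (i, j)" "amap F i j i k \<cdot> u = x"
  using kernelD(6)[OF amap_kernel[OF assms(1-3)], of x] assms by auto

lemma factor_quot:
  assumes "i \<le> j" "j \<le> k" "k \<le> p" "x \<in> Arr C" "Dom C x = fobj F (i, k)"
    and "zero_arrow C (x \<cdot> amap F i j i k)"
  obtains u where "u \<in> Arr C" "Cod C u = Cod C x" "Dom C u = fobj F (j, k)" "u \<cdot> amap F i k j k = x"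
  using cokernelD(6)[OF amap_cokernel[OF assms(1-3)], of x] assms by auto

end

text \<open>Since all \<open>F (0, j) \<rightarrow> F (0, p)\<close> are monic and all \<open>F (0, j) \<rightarrow> F (i, j)\<close> are epic, a
  transformation of gap complexes is determined by its component at \<open>(0, p)\<close>; conversely an arrow
  \<open>F (0, p) \<rightarrow> G (0, p)\<close> extends as soon as it respects the filtrations by the \<open>F (0, j)\<close>.\<close>

locale gap_pair = F: gap C p F + G: gap C p G
  for C :: "('o, 'm) cat" and p F G
begin

lemma nattrans_unique:
  assumes s: "is_nattrans (Ar {0..p}) C (F, G, s)" and t: "is_nattrans (Ar {0..p}) C (F, G, t)"
    and eq: "s (0, p) = t (0, p)"
  shows "s = t"
proof (rule extensionalityI[OF is_nattransD(7)[OF s] is_nattransD(7)[OF t]])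
  have S [simp]: "s (i, j) \<in> Arr C" "Dom C (s (i, j)) = fobj F (i, j)" "Cod C (s (i, j)) = fobj G (i, j)"
      "t (i, j) \<in> Arr C" "Dom C (t (i, j)) = fobj F (i, j)" "Cod C (t (i, j)) = fobj G (i, j)"
    if "i \<le> j" "j \<le> p" for i j
    using that is_nattransD(3-5)[OF s, of "(i, j)"] is_nattransD(3-5)[OF t, of "(i, j)"] by auto
  have nat: "Comp C (s (k, l)) (amap F i j k l) = Comp C (amap G i j k l) (s (i, j))"
      "Comp C (t (k, l)) (amap F i j k l) = Comp C (amap G i j k l) (t (i, j))"
    if "i \<le> k" "j \<le> l" "i \<le> j" "k \<le> l" "l \<le> p" for i j k l
    using that is_nattransD(6)[OF s, of "((i, j), (k, l))"] is_nattransD(6)[OF t, of "((i, j), (k, l))"]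
    by auto
  have 0: "s (0, j) = t (0, j)" if "j \<le> p" for j
    by (rule F.mono_cancel[OF G.gapD(1)[of 0 j p]])
      (use that nat[of 0 0 j p] eq in auto)
  fix x assume "x \<in> Ob (Ar {0..p})"
  then obtain i j where x: "x = (i, j)" "i \<le> j" "j \<le> p" by (cases x) auto
  have "s (i, j) = t (i, j)"
    by (rule F.epi_cancel[OF F.gapD(2)[of 0 i j]])
      (use x nat[of 0 i j j] 0[of j] in auto)
  then show "s x = t x" using x by simp
qed

text \<open>Assumption \<open>z\<close> says that \<open>t\<close> carries F (0, j) into G (0, j),
  the kernel of G (0, p) -> G (j, p). The induced arrows \<open>u j\<close> between the steps of the
  filtrations then descend to the quotients F (i, j) and G (i, j).\<close>

lemma nattrans_exists:
  assumes t [simp]: "t \<in> Arr C" "Dom C t = fobj F (0, p)" "Cod C t = fobj G (0, p)"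
    and z: "\<And>j. j \<le> p \<Longrightarrow> zero_arrow C (Comp C (amap G 0 p j p) (Comp C t (amap F 0 j 0 p)))"
  obtains s where "is_nattrans (Ar {0..p}) C (F, G, s)" "s (0, p) = t"
proof -
  have "\<exists>u. u \<in> Arr C \<and> Dom C u = fobj F (0, j) \<and> Cod C u = fobj G (0, j) \<and>
     Comp C (amap G 0 j 0 p) u = Comp C t (amap F 0 j 0 p)" if "j \<le> p" for j
    using G.factor_sub[of 0 j p "Comp C t (amap F 0 j 0 p)"] that z[OF that] by auto
  then obtain u where u: "\<And>j. j \<le> p \<Longrightarrow> u j \<in> Arr C \<and> Dom C (u j) = fobj F (0, j) \<and>
     Cod C (u j) = fobj G (0, j) \<and> Comp C (amap G 0 j 0 p) (u j) = Comp C t (amap F 0 j 0 p)"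
    by metis
  then have u0 [simp]: "u j \<in> Arr C" "Dom C (u j) = fobj F (0, j)" "Cod C (u j) = fobj G (0, j)"
    and u1: "Comp C (amap G 0 j 0 p) (u j) = Comp C t (amap F 0 j 0 p)" if "j \<le> p" for j
    using that by auto
  have u2: "Comp C (u j) (amap F 0 i 0 j) = Comp C (amap G 0 i 0 j) (u i)" if "i \<le> j" "j \<le> p" for i j
  proof (rule F.mono_cancel[OF G.gapD(1)[of 0 j p]])
    have "Comp C (amap G 0 j 0 p) (Comp C (u j) (amap F 0 i 0 j))
        = Comp C (Comp C (amap G 0 j 0 p) (u j)) (amap F 0 i 0 j)" using that by simp
    also have "\<dots> = Comp C t (amap F 0 i 0 p)" unfolding u1[OF that(2)] using that by simp
    also have "\<dots> = Comp C (amap G 0 i 0 p) (u i)" using u1[of i] that by simp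
    finally show "Comp C (amap G 0 j 0 p) (Comp C (u j) (amap F 0 i 0 j))
        = Comp C (amap G 0 j 0 p) (Comp C (amap G 0 i 0 j) (u i))" using that by simp
  qed (use that in auto)
  have "\<exists>s. s \<in> Arr C \<and> Dom C s = fobj F (i, j) \<and> Cod C s = fobj G (i, j) \<and>
      Comp C s (amap F 0 j i j) = Comp C (amap G 0 j i j) (u j)" if "i \<le> j" "j \<le> p" for i j
  proof -
    have "Comp C (Comp C (amap G 0 j i j) (u j)) (amap F 0 i 0 j) = Comp C (amap G 0 i i j) (u i)"
      using u2[OF that] that by simp
    moreover have "zero_arrow C (Comp C (amap G 0 i i j) (u i))"
      by (rule F.zero_cmp_right[OF G.zero_amap]) (use that in auto)
    ultimately show ?thesis
      using F.factor_quot[of 0 i j "Comp C (amap G 0 j i j) (u j)"] that by auto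
  qed
  then obtain s0 where s0: "\<And>i j. i \<le> j \<Longrightarrow> j \<le> p \<Longrightarrow> s0 i j \<in> Arr C \<and> Dom C (s0 i j) = fobj F (i, j) \<and>
      Cod C (s0 i j) = fobj G (i, j) \<and> Comp C (s0 i j) (amap F 0 j i j) = Comp C (amap G 0 j i j) (u j)"
    by metis
  then have s1 [simp]: "s0 i j \<in> Arr C" "Dom C (s0 i j) = fobj F (i, j)" "Cod C (s0 i j) = fobj G (i, j)"
    and s2: "Comp C (s0 i j) (amap F 0 j i j) = Comp C (amap G 0 j i j) (u j)"
    if "i \<le> j" "j \<le> p" for i j using that by auto
  define s where "s = (\<lambda>(i, j) \<in> Ob (Ar {0..p}). s0 i j)"
  have s: "s (i, j) = s0 i j" if "i \<le> j" "j \<le> p" for i j using that by (simp add: s_def)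
  \<comment> \<open>Naturality is tested after the epi F (0, j) -> F (i, j), where it reduces to
    \<open>u2\<close>, the naturality of \<open>u\<close> along the filtrations.\<close>
  have nat: "Comp C (s0 k l) (amap F i j k l) = Comp C (amap G i j k l) (s0 i j)"
    if ij: "i \<le> k" "j \<le> l" "i \<le> j" "k \<le> l" "l \<le> p" for i j k l
  proof (rule F.epi_cancel[OF F.gapD(2)[of 0 i j]])
    have "Comp C (Comp C (s0 k l) (amap F i j k l)) (amap F 0 j i j)
        = Comp C (Comp C (s0 k l) (amap F 0 l k l)) (amap F 0 j 0 l)" using ij by simp
    also have "\<dots> = Comp C (amap G 0 l k l) (Comp C (u l) (amap F 0 j 0 l))"
      unfolding s2[OF ij(4,5)] using ij by simp
    also have "\<dots> = Comp C (amap G i j k l) (Comp C (amap G 0 j i j) (u j))"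
      using u2[of j l] ij by simp
    also have "\<dots> = Comp C (Comp C (amap G i j k l) (s0 i j)) (amap F 0 j i j)"
      using s2[of i j] ij by simp
    finally show "Comp C (Comp C (s0 k l) (amap F i j k l)) (amap F 0 j i j) =
      Comp C (Comp C (amap G i j k l) (s0 i j)) (amap F 0 j i j)" .
  qed (use that in auto)
  have sp: "s (0, p) = t"
  proof -
    have "s0 0 p = u p" "u p = t" using s2[of 0 p] u1[of p] by simp_all
    then show ?thesis by (simp add: s)
  qed
  have "is_nattrans (Ar {0..p}) C (F, G, s)"
  proof (rule is_nattransI[OF F.is_functor G.is_functor])
    fix f assume "f \<in> Arr (Ar {0..p})"
    then obtain i j k l where "f = ((i, j), (k, l))" "i \<le> k" "j \<le> l" "i \<le> j" "k \<le> l" "l \<le> p"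
      by (cases f) auto
    then show "Comp C (s (Cod (Ar {0..p}) f)) (farr F f) = Comp C (farr G f) (s (Dom (Ar {0..p}) f))"
      using nat[of i k j l] by (simp add: s)
  qed (auto simp: s_def)
  with sp that show thesis by blast
qed

end

section \<open>The gap complex of a filtration\<close>

text \<open>\<open>e\<close> is an increasing chain of subobjects of \<open>T\<close> with zero
  first term, and F (i, j) is a cokernel of \<open>x i j\<close>, the inclusion of step i into step
  j. Thus F (0, j) is a chosen cokernel of an arrow out of a zero object and not the step itself;
  \<open>r\<close> records the isomorphism between the two.\<close>

lemma (in abelian_category) filtration_gap_complex:
  fixes p :: nat and e :: "nat \<Rightarrow> 'b"
  assumes mono: "\<And>j. j \<le> p \<Longrightarrow> is_mono C (e j)" and cod: "\<And>j. j \<le> p \<Longrightarrow> Cod C (e j) = T"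
    and le: "\<And>i j. \<lbrakk>i \<le> j; j \<le> p\<rbrakk> \<Longrightarrow>
      \<exists>u. u \<in> Arr C \<and> Dom C u = Dom C (e i) \<and> Cod C u = Dom C (e j) \<and> e j \<cdot> u = e i"
    and zero: "zero_object C (Dom C (e 0))"
  obtains F r where "gap_complex {0..p} C F"
    "\<And>j. j \<le> p \<Longrightarrow> is_iso C (r j) \<and> Dom C (r j) = fobj F (0, j) \<and> Cod C (r j) = Dom C (e j)"
    "\<And>i j. \<lbrakk>i \<le> j; j \<le> p\<rbrakk> \<Longrightarrow> e j \<cdot> r j \<cdot> amap F 0 i 0 j = e i \<cdot> r i"
proof -
  have e [simp]: "e j \<in> Arr C" "Cod C (e j) = T" if "j \<le> p" for j
    using mono[OF that] cod[OF that] mono_arr by auto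
  obtain x where x: "\<And>i j. \<lbrakk>i \<le> j; j \<le> p\<rbrakk> \<Longrightarrow> x i j \<in> Arr C \<and> Dom C (x i j) = Dom C (e i) \<and>
      Cod C (x i j) = Dom C (e j) \<and> e j \<cdot> x i j = e i"
    using le by metis
  then have x [simp]: "x i j \<in> Arr C" "Dom C (x i j) = Dom C (e i)" "Cod C (x i j) = Dom C (e j)"
    and ex: "e j \<cdot> x i j = e i" if "i \<le> j" "j \<le> p" for i j
    using that by auto
  \<comment> \<open>As the \<open>e j\<close> are monic, the inclusions are unique, hence
    functorial.\<close>
  have xx: "x j k \<cdot> x i j = x i k" if "i \<le> j" "j \<le> k" "k \<le> p" for i j k
  proof (rule mono_cancel[OF mono[OF that(3)]])
    have "e k \<cdot> x j k \<cdot> x i j = (e k \<cdot> x j k) \<cdot> x i j" using that by simp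
    also have "\<dots> = e k \<cdot> x i k" using ex[of j k] ex[of i j] ex[of i k] that by simp
    finally show "e k \<cdot> x j k \<cdot> x i j = e k \<cdot> x i k" .
  qed (use that in auto)
  have xid: "x i i = Id C (Dom C (e i))" if "i \<le> p" for i
    by (rule mono_cancel[OF mono[OF that]]) (use that ex[of i i] in auto)
  have xmono: "is_mono C (x i j)" if ij: "i \<le> j" "j \<le> p" for i j
  proof -
    have "u = v" if "u \<in> Arr C" "v \<in> Arr C" "Cod C u = Dom C (e i)" "Cod C v = Dom C (e i)"
      "Dom C u = Dom C v" "x i j \<cdot> u = x i j \<cdot> v" for u v
    proof (rule mono_cancel[OF mono[of i]])
      have "(e j \<cdot> x i j) \<cdot> u = (e j \<cdot> x i j) \<cdot> v" using that ij by simp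
      then show "e i \<cdot> u = e i \<cdot> v" using ex[OF ij] by simp
    qed (use that ij in auto)
    then show ?thesis using ij unfolding is_mono_def homs_def by auto
  qed
  have "\<exists>q. is_cokernel C q (x i j)" if "i \<le> j" "j \<le> p" for i j
    using ex_cokernel that by simp
  then obtain q where cok: "\<And>i j. \<lbrakk>i \<le> j; j \<le> p\<rbrakk> \<Longrightarrow> is_cokernel C (q i j) (x i j)" by metis
  have q [simp]: "q i j \<in> Arr C" "Dom C (q i j) = Dom C (e j)" and qz: "zero_arrow C (q i j \<cdot> x i j)"
    and qepi: "is_epi C (q i j)" if "i \<le> j" "j \<le> p" for i j
    using cokernelD[OF cok[OF that]] that by auto
  have ker: "is_kernel C (x i j) (q i j)" if "i \<le> j" "j \<le> p" for i j
    using mono_kernel_of_cokernel xmono cok that by blast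
  have "\<exists>m. m \<in> Arr C \<and> Dom C m = Cod C (q i j) \<and> Cod C m = Cod C (q k l) \<and> m \<cdot> q i j = q k l \<cdot> x j l"
    if "i \<le> k" "j \<le> l" "i \<le> j" "k \<le> l" "l \<le> p" for i j k l
  proof -
    have "(q k l \<cdot> x j l) \<cdot> x i j = (q k l \<cdot> x k l) \<cdot> x i k"
      using that xx[of i j l] xx[of i k l] by simp
    moreover have "zero_arrow C \<dots>" by (rule zero_cmp_right[OF qz]) (use that in auto)
    ultimately show ?thesis using cokernelD(6)[OF cok[of i j], of "q k l \<cdot> x j l"] that by simp
  qed
  note m_ex = this
  \<comment> \<open>The arrow induced between quotients. Since \<open>q i j\<close> is epic it is
    the only one with this property, which gives \<open>mid\<close> and \<open>mm\<close>, the
    functoriality of \<open>F\<close>.\<close>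
  define m where "m i j k l = (SOME m. m \<in> Arr C \<and> Dom C m = Cod C (q i j) \<and>
    Cod C m = Cod C (q k l) \<and> m \<cdot> q i j = q k l \<cdot> x j l)" for i j k l
  have m [simp]: "m i j k l \<in> Arr C" "Dom C (m i j k l) = Cod C (q i j)"
     "Cod C (m i j k l) = Cod C (q k l)"
    and mq: "m i j k l \<cdot> q i j = q k l \<cdot> x j l"
    if "i \<le> k" "j \<le> l" "i \<le> j" "k \<le> l" "l \<le> p" for i j k l
    unfolding m_def using someI_ex[OF m_ex[OF that]] by blast+
  define F where "F = \<lparr>fobj = (\<lambda>(i, j) \<in> Ob (Ar {0..p}). Cod C (q i j)),
    farr = (\<lambda>((i, j), (k, l)) \<in> Arr (Ar {0..p}). m i j k l)\<rparr>"
  have Fo [simp]: "fobj F (i, j) = Cod C (q i j)" if "i \<le> j" "j \<le> p" for i j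
    using that by (simp add: F_def)
  have Fm [simp]: "amap F i j k l = m i j k l" if "i \<le> k" "j \<le> l" "i \<le> j" "k \<le> l" "l \<le> p" for i j k l
    using that by (simp add: F_def)
  have mid: "m i j i j = Id C (Cod C (q i j))" if "i \<le> j" "j \<le> p" for i j
    by (rule epi_cancel[OF qepi[OF that]]) (use that mq[of i i j j] xid[of j] in auto)
  have mm: "m k l r s \<cdot> m i j k l = m i j r s"
    if ij: "i \<le> k" "j \<le> l" "i \<le> j" "k \<le> l" "l \<le> s" "k \<le> r" "r \<le> s" "s \<le> p" for i j k l r s
  proof (rule epi_cancel[OF qepi[of i j]])
    have "(m k l r s \<cdot> m i j k l) \<cdot> q i j = (m k l r s \<cdot> q k l) \<cdot> x j l"
      using mq[of i k j l] ij by simp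
    also have "\<dots> = q r s \<cdot> x l s \<cdot> x j l" using mq[of k r l s] ij by simp
    also have "\<dots> = m i j r s \<cdot> q i j" using mq[of i r j s] xx[of j l s] ij by simp
    finally show "(m k l r s \<cdot> m i j k l) \<cdot> q i j = m i j r s \<cdot> q i j" .
  qed (use ij in auto)
  have Ffun: "is_functor (Ar {0..p}) C F"
    unfolding is_functor_def
  proof (intro conjI ballI impI)
    fix f g assume "f \<in> Arr (Ar {0..p})" "g \<in> Arr (Ar {0..p})" "Dom (Ar {0..p}) g = Cod (Ar {0..p}) f"
    then obtain i j k l r s where "f = ((i, j), (k, l))" "g = ((k, l), (r, s))"
      "i \<le> k" "j \<le> l" "i \<le> j" "k \<le> l" "l \<le> s" "k \<le> r" "r \<le> s" "s \<le> p"
      by (cases f; cases g) auto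
    then show "farr F (Comp (Ar {0..p}) g f) = farr F g \<cdot> farr F f"
      using mm[of i k j l s r] by simp
  qed (auto simp: category_Ar category_axioms homs_iff mid F_def)
  \<comment> \<open>\<open>q i i\<close> is the cokernel of an identity, hence zero. Being epic, it
    forces the identity of its target to be zero, and then every arrow into or out of the target is
    zero.\<close>
  have zobj: "zero_object C (Cod C (q i i))" if i: "i \<le> p" for i
  proof -
    let ?Q = "Cod C (q i i)"
    have zq: "zero_arrow C (q i i)" using qz[of i i] i xid by simp
    have idz: "zero_arrow C (Id C ?Q)"
      by (rule epi_zero_cancel[OF qepi[of i i]]) (use i zq in auto)
    have "\<exists>!f. f \<in> homs C y ?Q" if y: "y \<in> Ob C" for y
    proof -
      obtain z where z: "zero_arrow C z" "Dom C z = y" "Cod C z = ?Q"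
        using zero_arrow_ex[OF y, of ?Q] i by auto
      have "f = z" if "f \<in> homs C y ?Q" for f
      proof -
        have f: "f \<in> Arr C" "Dom C f = y" "Cod C f = ?Q" using that by (auto simp: homs_iff)
        have "zero_arrow C (Id C ?Q \<cdot> f)" by (rule zero_cmp_right[OF idz]) (use f i in auto)
        then show ?thesis using f z i zero_arrow_unique by auto
      qed
      then show ?thesis using z zero_arrow_arr by (intro ex1I[of _ z]) (auto simp: homs_iff)
    qed
    moreover have "\<exists>!f. f \<in> homs C ?Q y" if y: "y \<in> Ob C" for y
    proof -
      obtain z where z: "zero_arrow C z" "Dom C z = ?Q" "Cod C z = y"
        using zero_arrow_ex[of ?Q, OF _ y] i by auto
      have "f = z" if "f \<in> homs C ?Q y" for f
      proof -
        have f: "f \<in> Arr C" "Dom C f = ?Q" "Cod C f = y" using that by (auto simp: homs_iff)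
        have "zero_arrow C (f \<cdot> Id C ?Q)" by (rule zero_cmp_left[OF idz]) (use f i in auto)
        then show ?thesis using f z i zero_arrow_unique by auto
      qed
      then show ?thesis using z zero_arrow_arr by (intro ex1I[of _ z]) (auto simp: homs_iff)
    qed
    ultimately show ?thesis using i unfolding zero_object_def by simp
  qed
  \<comment> \<open>The kernel of step j -> step k -> F (i, k) is step i, so the arrow induced on
    the coimage F (i, j) is monic.\<close>
  have Fmono: "is_mono C (m i j i k)" if ijk: "i \<le> j" "j \<le> k" "k \<le> p" for i j k
  proof (rule coimage_mono)
    show "is_kernel C (x i j) (q i k \<cdot> x j k)"
    proof (rule kernelI)
      show "zero_arrow C ((q i k \<cdot> x j k) \<cdot> x i j)" using ijk qz[of i k] xx[of i j k] by simp
      fix h assume h: "h \<in> Arr C" "Cod C h = Dom C (q i k \<cdot> x j k)" "zero_arrow C ((q i k \<cdot> x j k) \<cdot> h)"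
      then obtain u where u: "u \<in> Arr C" "Dom C u = Dom C h" "Cod C u = Dom C (e i)" "x i k \<cdot> u = x j k \<cdot> h"
        using kernelD(6)[OF ker[of i k], of "x j k \<cdot> h"] ijk by auto
      have "x i j \<cdot> u = h"
      proof (rule mono_cancel[OF xmono[of j k]])
        have "x j k \<cdot> x i j \<cdot> u = (x j k \<cdot> x i j) \<cdot> u" using ijk u by simp
        then show "x j k \<cdot> x i j \<cdot> u = x j k \<cdot> h" using xx[OF ijk] u by simp
      qed (use u h ijk in auto)
      then show "\<exists>u. u \<in> Arr C \<and> Dom C u = Dom C h \<and> Cod C u = Dom C (x i j) \<and> x i j \<cdot> u = h"
        using u ijk by auto
    qed (use ijk xmono in auto)
    show "is_cokernel C (q i j) (x i j)" using cok ijk by simp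
  qed (use ijk mq[of i i j k] in auto)
  have mqk: "m i k j k \<cdot> q i k = q j k" if "i \<le> j" "j \<le> k" "k \<le> p" for i j k
    using mq[of i j k k] xid[of k] that by simp
  have Fepi: "is_epi C (m i k j k)" if ijk: "i \<le> j" "j \<le> k" "k \<le> p" for i j k
  proof -
    have "u = v" if uv: "u \<in> Arr C" "v \<in> Arr C" "Dom C u = Cod C (q j k)" "Dom C v = Cod C (q j k)"
      "Cod C u = Cod C v" "u \<cdot> m i k j k = v \<cdot> m i k j k" for u v
    proof (rule epi_cancel[OF qepi[of j k]])
      have "(u \<cdot> m i k j k) \<cdot> q i k = (v \<cdot> m i k j k) \<cdot> q i k" using uv by simp
      then show "u \<cdot> q j k = v \<cdot> q j k" using ijk uv(1-5) mqk[OF ijk] by simp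
    qed (use ijk uv in auto)
    then show ?thesis using ijk unfolding is_epi_def homs_def by auto
  qed
  \<comment> \<open>The leg \<open>l\<close> of a cocone starts at the zero object F (j, j), so
    \<open>h\<close> kills F (i, j). Hence \<open>h \<cdot> q i k\<close> vanishes on step j and
    factors through \<open>q j k\<close>; agreement with \<open>l\<close> is automatic.\<close>
  have Fpush: "is_pushout C (m i j i k) (m i j j j) (m i k j k) (m j j j k)"
    if ijk: "i \<le> j" "j \<le> k" "k \<le> p" for i j k
    unfolding is_pushout_def
  proof (intro conjI allI ballI impI)
    show "commuting_square C (m i j i k) (m i j j j) (m i k j k) (m j j j k)"
      using ijk mm[of i i j k k j] mm[of i j j j k j] by (simp add: commuting_square_def)
    fix y h l assume "h \<in> homs C (Cod C (m i j i k)) y" and "l \<in> homs C (Cod C (m i j j j)) y"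
      and eq: "h \<cdot> m i j i k = l \<cdot> m i j j j"
    then have h: "h \<in> Arr C" "Dom C h = Cod C (q i k)" "Cod C h = y"
      and l: "l \<in> Arr C" "Dom C l = Cod C (q j j)" "Cod C l = y"
      using ijk by (auto simp: homs_iff)
    have "zero_arrow C (l \<cdot> m i j j j)" by (rule zero_arrowI) (use ijk l zobj[of j] in auto)
    then have "zero_arrow C ((h \<cdot> m i j i k) \<cdot> q i j)"
      unfolding eq by (rule zero_cmp_right) (use ijk l in auto)
    then have "zero_arrow C ((h \<cdot> q i k) \<cdot> x j k)" using mq[of i i j k] ijk h by simp
    then obtain u where u: "u \<in> Arr C" "Dom C u = Cod C (q j k)" "Cod C u = y" "u \<cdot> q j k = h \<cdot> q i k"
      using cokernelD(6)[OF cok[of j k], of "h \<cdot> q i k"] ijk h by auto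
    have uh: "u \<cdot> m i k j k = h"
      by (rule epi_cancel[OF qepi[of i k]]) (use ijk h u mqk[OF ijk] in auto)
    show "\<exists>!u. u \<in> homs C (Cod C (m i k j k)) y \<and> u \<cdot> m i k j k = h \<and> u \<cdot> m j j j k = l"
    proof (rule ex1I[of _ u])
      have "u \<cdot> m j j j k = l"
        by (rule zero_object_out_unique[OF zobj[of j]]) (use ijk u l in auto)
      then show "u \<in> homs C (Cod C (m i k j k)) y \<and> u \<cdot> m i k j k = h \<and> u \<cdot> m j j j k = l"
        using u uh ijk by (auto simp: homs_iff)
      fix v assume "v \<in> homs C (Cod C (m i k j k)) y \<and> v \<cdot> m i k j k = h \<and> v \<cdot> m j j j k = l"
      then have v: "v \<in> Arr C" "Dom C v = Cod C (q j k)" "Cod C v = y" "v \<cdot> m i k j k = h"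
        using ijk by (auto simp: homs_iff)
      show "v = u" by (rule epi_cancel[OF Fepi[OF ijk]]) (use v u uh ijk in auto)
    qed
  qed
  have gap: "gap_complex {0..p} C F"
    unfolding gap_complex_def using Ffun zobj Fmono Fepi Fpush by simp
  \<comment> \<open>\<open>x 0 j\<close> starts at a zero object, so the identity of step j factors
    through its cokernel \<open>q 0 j\<close>; this factorisation will be \<open>r j\<close>, the
    inverse of \<open>q 0 j\<close>.\<close>
  have "\<exists>u. u \<in> Arr C \<and> Dom C u = Cod C (q 0 j) \<and> Cod C u = Dom C (e j) \<and>
      u \<cdot> q 0 j = Id C (Dom C (e j))" if "j \<le> p" for j
  proof -
    have "zero_arrow C (x 0 j)" by (rule zero_arrow_outof[OF zero]) (use that in auto)
    then show ?thesis using cokernelD(6)[OF cok[of 0 j], of "Id C (Dom C (e j))"] that by simp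
  qed
  then obtain r where r: "\<And>j. j \<le> p \<Longrightarrow> r j \<in> Arr C \<and> Dom C (r j) = Cod C (q 0 j) \<and>
      Cod C (r j) = Dom C (e j) \<and> r j \<cdot> q 0 j = Id C (Dom C (e j))" by metis
  then have r [simp]: "r j \<in> Arr C" "Dom C (r j) = Cod C (q 0 j)" "Cod C (r j) = Dom C (e j)"
    "r j \<cdot> q 0 j = Id C (Dom C (e j))" if "j \<le> p" for j using that by auto
  have r2: "q 0 j \<cdot> r j = Id C (Cod C (q 0 j))" if "j \<le> p" for j
    by (rule epi_cancel[OF qepi[of 0 j]]) (use that in auto)
  show thesis
  proof (rule that[OF gap])
    fix j assume "j \<le> p"
    then show "is_iso C (r j) \<and> Dom C (r j) = fobj F (0, j) \<and> Cod C (r j) = Dom C (e j)"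
      using r2[of j] by (auto intro!: isoI[of "r j" "Cod C (q 0 j)" "Dom C (e j)" "q 0 j"] simp: homs_iff)
  next
    fix i j assume ij: "i \<le> j" "j \<le> p"
    have eq: "(e j \<cdot> r j \<cdot> m 0 i 0 j) \<cdot> q 0 i = (e i \<cdot> r i) \<cdot> q 0 i"
    proof -
      have "r j \<cdot> q 0 j \<cdot> x i j = x i j"
        using ij by (simp flip: assoc)
      then have "(e j \<cdot> r j \<cdot> m 0 i 0 j) \<cdot> q 0 i = e j \<cdot> x i j"
        using mq[of 0 0 i j] ij by simp
      then show ?thesis using ex[OF ij] ij by simp
    qed
    have "e j \<cdot> r j \<cdot> m 0 i 0 j = e i \<cdot> r i"
      by (rule epi_cancel[OF qepi[of 0 i] eq]) (use ij in auto)
    then show "e j \<cdot> r j \<cdot> amap F 0 i 0 j = e i \<cdot> r i" using ij by simp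
  qed
qed

section \<open>Pushouts in the simplex category\<close>

lemma Delta_sel [simp]:
  "Ob Delta = UNIV" "Dom Delta (m, n, f) = m" "Cod Delta (m, n, f) = n"
  "Id Delta n = (n, n, \<lambda>i \<in> {0..n}. i)"
  "Comp Delta (n, k, g) (m, n', f) = (m, k, compose {0..m} g f)"
  by (simp_all add: Delta_def)

lemma Delta_arr:
  "(m, n, f) \<in> Arr Delta \<longleftrightarrow>
     f \<in> extensional {0..m} \<and> (\<forall>i \<le> m. f i \<le> n) \<and> (\<forall>j \<le> m. \<forall>i \<le> j. f i \<le> f j)"
  by (auto simp: Delta_def mono_on_def PiE_iff)

lemma compose_at [simp]: "i \<le> m \<Longrightarrow> compose {0..m} g f i = g (f i)" for m :: nat
  by (simp add: compose_def)

lemma category_Delta: "category Delta"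
proof (unfold_locales, goal_cases)
  case (3 a)
  then show ?case by (auto simp: homs_iff Delta_arr)
next
  case (4 f a b g c)
  then show ?case by (cases f; cases g) (auto simp: homs_iff Delta_arr)
next
  case (5 f a b)
  then show ?case
    by (cases f) (auto simp: homs_iff Delta_arr compose_def extensional_def fun_eq_iff)
next
  case (6 f a b)
  then show ?case
    by (cases f) (auto simp: homs_iff Delta_arr compose_def extensional_def fun_eq_iff)
next
  case (7 f a b g c h d)
  then show ?case
    by (cases f; cases g; cases h) (auto simp: homs_iff Delta_arr compose_def fun_eq_iff)
qed auto

lemma category_opposite:
  assumes "category C" shows "category (opposite C)"
proof -
  interpret category C by fact
  show ?thesis
    by unfold_locales (auto simp: opposite_def homs_iff)
qed

lemma mono_inj_ge:
  fixes u :: "nat \<Rightarrow> nat"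
  assumes mono: "\<And>i j. \<lbrakk>i \<le> j; j \<le> q\<rbrakk> \<Longrightarrow> u i \<le> u j"
    and inj: "\<And>i j. \<lbrakk>i \<le> q; j \<le> q; u i = u j\<rbrakk> \<Longrightarrow> i = j"
  shows "i \<le> q \<Longrightarrow> i \<le> u i"
proof (induction i)
  case (Suc i)
  then have "i \<le> u i" "u i \<le> u (Suc i)" "u i \<noteq> u (Suc i)" using mono[of i "Suc i"] inj[of i "Suc i"] by auto
  then show ?case by simp
qed simp

text \<open>Monotone injections lie above the identity, so j <= v j <= u (v j) = j.\<close>

lemma Delta_iso_unique:
  fixes u v :: "nat \<Rightarrow> nat"
  assumes u: "(q, p, u) \<in> Arr Delta" and v: "(p, q, v) \<in> Arr Delta"
    and uv: "\<And>j. j \<le> p \<Longrightarrow> u (v j) = j" and vu: "\<And>i. i \<le> q \<Longrightarrow> v (u i) = i"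
  shows "p = q" "\<And>j. j \<le> p \<Longrightarrow> v j = j"
proof -
  have ge: "i \<le> u i" if "i \<le> q" for i
    by (rule mono_inj_ge[OF _ _ that]) (use u vu in \<open>auto simp: Delta_arr\<close>, metis vu)
  have ge': "j \<le> v j" if "j \<le> p" for j
    by (rule mono_inj_ge[OF _ _ that]) (use v uv in \<open>auto simp: Delta_arr\<close>, metis uv)
  have vq: "v j \<le> q" if "j \<le> p" for j using v that by (auto simp: Delta_arr)
  have uq: "u j \<le> p" if "j \<le> q" for j using u that by (auto simp: Delta_arr)
  show "v j = j" if "j \<le> p" for j
    using ge[OF vq[OF that]] ge'[OF that] uv[OF that] by simp
  show "p = q" using ge[of q] ge'[of p] uq[of q] vq[of p] by simp
qed

lemma free_shift:
  assumes "free (m, k, f)" "i \<le> m" shows "f i = f 0 + i"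
  using assms(2) by (induction i) (use assms(1) in \<open>auto simp: free_def\<close>)

text \<open>Rigidity of ordinals turns the universal property into formulas: the explicit square
  with apex [p] and the given one with apex [q] are compared by \<open>u\<close> and
  \<open>v\<close>, which are mutually inverse and therefore identities. The conclusions are stated
  as sums because n - m may be negative.\<close>

lemma Delta_pushoutE:
  assumes g: "generic (m, n, g)" and f: "free (m, k, f)"
    and po: "is_pushout Delta (m, n, g) (m, k, f) F' G'"
  obtains a p f' g' where
    "F' = (n, p, f')" "G' = (k, p, g')" "(n, p, f') \<in> Arr Delta" "(k, p, g') \<in> Arr Delta"
    "a + m \<le> k" "p + m = k + n" "\<And>i. i \<le> m \<Longrightarrow> f i = a + i" "\<And>j. j \<le> n \<Longrightarrow> f' j = a + j"
    "\<And>i. i \<le> a \<Longrightarrow> g' i = i" "\<And>i. i \<le> m \<Longrightarrow> g' (a + i) = a + g i"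
    "\<And>i. \<lbrakk>a + m \<le> i; i \<le> k\<rbrakk> \<Longrightarrow> g' i + m = i + n"
proof -
  define a where "a = f 0"
  have fa: "f i = a + i" if "i \<le> m" for i using free_shift[OF f that] by (simp add: a_def)
  have gA: "(m, n, g) \<in> Arr Delta" and fA: "(m, k, f) \<in> Arr Delta" and g0: "g 0 = 0" "g m = n"
    using g f by (auto simp: generic_def free_def)
  have am: "a + m \<le> k" using fA fa[of m] by (auto simp: Delta_arr)
  define p where "p = k + n - m"
  have pm: "p + m = k + n" using am by (simp add: p_def)
  obtain q f1 g1 where F': "F' = (n, q, f1)" and G': "G' = (k, q, g1)"
    and f1A: "(n, q, f1) \<in> Arr Delta" and g1A: "(k, q, g1) \<in> Arr Delta"
    and sq: "compose {0..m} f1 g = compose {0..m} g1 f"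
    using po unfolding is_pushout_def commuting_square_def by (cases F'; cases G') auto
  have sq: "f1 (g i) = g1 (f i)" if "i \<le> m" for i
    using fun_cong[OF sq, of i] that by simp
  have b0: "f1 0 = g1 a" and b1: "f1 n = g1 (a + m)" using sq[of 0] sq[of m] g0 fa by auto
  have gm: "g i \<le> g j" "g j \<le> n" if "i \<le> j" "j \<le> m" for i j using gA that by (auto simp: Delta_arr)
  have f1m: "f1 i \<le> f1 j" "f1 j \<le> q" if "i \<le> j" "j \<le> n" for i j using f1A that by (auto simp: Delta_arr)
  have g1m: "g1 i \<le> g1 j" "g1 j \<le> q" if "i \<le> j" "j \<le> k" for i j using g1A that by (auto simp: Delta_arr)
  define f2 where "f2 = (\<lambda>j \<in> {0..n}. a + j)"
  define g2 where "g2 = (\<lambda>i \<in> {0..k}. if i < a then i else if i \<le> a + m then a + g (i - a) else i + n - m)"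
  \<comment> \<open>The map from the explicit apex to the given one: \<open>g1\<close> outside the
    inserted copy of [n] and \<open>f1\<close> on it. The branches fit together monotonically
    because \<open>b0\<close> and \<open>b1\<close> identify \<open>f1\<close> and \<open>g1\<close>
    at the two ends, which uses that \<open>g\<close> preserves end-points.\<close>
  define v where "v = (\<lambda>j \<in> {0..p}. if j < a then g1 j else if j \<le> a + n then f1 (j - a) else g1 (j + m - n))"
  have f2A: "(n, p, f2) \<in> Arr Delta" using am by (auto simp: Delta_arr f2_def p_def)
  have "g2 i \<le> p" if "i \<le> k" for i
  proof (cases "a \<le> i \<and> i \<le> a + m")
    case True
    then have "g (i - a) \<le> n" by (intro gm(2)[of "i - a" "i - a"]) auto
    then show ?thesis using True that am by (simp add: g2_def p_def)
  next
    case False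
    then show ?thesis using that am by (auto simp: g2_def p_def)
  qed
  moreover have "g2 i \<le> g2 j" if ij: "i \<le> j" "j \<le> k" for i j
  proof -
    have "g (i - a) \<le> n" if "i \<le> a + m" using that by (intro gm(2)[of "i - a" "i - a"]) auto
    moreover have "g (i - a) \<le> g (j - a)" if "j \<le> a + m" using that ij by (intro gm(1)) auto
    ultimately show ?thesis using ij am by (auto simp: g2_def)
  qed
  ultimately have g2A: "(k, p, g2) \<in> Arr Delta" by (auto simp: Delta_arr g2_def)
  have sq2: "compose {0..m} f2 g = compose {0..m} g2 f"
    using am fa gm(2)[OF order_refl] by (auto simp: compose_def f2_def g2_def fun_eq_iff)
  have "f2 \<in> extensional {0..n}" "g2 \<in> extensional {0..k}" by (auto simp: f2_def g2_def)
  \<comment> \<open>The universal property of the given square, applied to the explicit cocone,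
    yields \<open>u\<close> from [q] to [p].\<close>
  have "\<exists>!u. u \<in> homs Delta (Cod Delta F') p \<and> Comp Delta u F' = (n, p, f2) \<and> Comp Delta u G' = (k, p, g2)"
    by (rule category.pushoutD[OF category_Delta po])
      (use f2A g2A sq2 in \<open>auto simp: homs_iff\<close>)
  then obtain w where w: "w \<in> homs Delta (Cod Delta F') p" "Comp Delta w F' = (n, p, f2)"
    "Comp Delta w G' = (k, p, g2)" by blast
  obtain u where "w = (q, p, u)" using w(1) by (cases w) (auto simp: F' homs_iff)
  then have uA: "(q, p, u) \<in> Arr Delta"
    and uf: "compose {0..n} u f1 = f2" and ug: "compose {0..k} u g1 = g2"
    using w by (auto simp: F' G' homs_iff)
  have uf: "u (f1 i) = f2 i" if "i \<le> n" for i using fun_cong[OF uf, of i] that by simp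
  have ug: "u (g1 i) = g2 i" if "i \<le> k" for i using fun_cong[OF ug, of i] that by simp
  have "v j \<le> q" if "j \<le> p" for j
    using that am f1m(2)[of "j - a" "j - a"] g1m(2)[of j j] g1m(2)[of "j + m - n" "j + m - n"]
    by (auto simp: v_def p_def)
  moreover have "v i \<le> v j" if "i \<le> j" "j \<le> p" for i j
  proof -
    consider "j < a" | "i < a" "a \<le> j" "j \<le> a + n" | "i < a" "a + n < j"
      | "a \<le> i" "j \<le> a + n" | "a \<le> i" "i \<le> a + n" "a + n < j" | "a + n < i"
      by linarith
    then show ?thesis
    proof cases
      case 1 then show ?thesis using that am g1m(1)[of i j] by (auto simp: v_def p_def)
    next
      case 2
      then have "f1 0 \<le> f1 (j - a)" "g1 i \<le> g1 a" using am by (intro f1m(1) g1m(1); simp)+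
      then show ?thesis using 2 that b0 by (simp add: v_def)
    next
      case 3 then show ?thesis using that am g1m(1)[of i "j + m - n"] by (auto simp: v_def p_def)
    next
      case 4
      then have "f1 (i - a) \<le> f1 (j - a)" using that by (intro f1m(1)) auto
      then show ?thesis using 4 that by (simp add: v_def)
    next
      case 5
      then have "f1 (i - a) \<le> f1 n" "g1 (a + m) \<le> g1 (j + m - n)"
        using that pm by (intro f1m(1) g1m(1); simp)+
      then show ?thesis using 5 that b1 by (simp add: v_def)
    next
      case 6
      then have "g1 (i + m - n) \<le> g1 (j + m - n)" using that pm by (intro g1m(1)) auto
      then show ?thesis using 6 that by (simp add: v_def)
    qed
  qed
  ultimately have vA: "(p, q, v) \<in> Arr Delta" by (auto simp: Delta_arr v_def)
  have vf: "v (f2 i) = f1 i" if "i \<le> n" for i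
    using that am by (auto simp: v_def f2_def p_def)
  have vg: "v (g2 i) = g1 i" if i: "i \<le> k" for i
  proof -
    consider "i < a" | "a \<le> i" "i \<le> a + m" | "a + m < i" by linarith
    then show ?thesis
    proof cases
      case 1 then show ?thesis using i am by (auto simp: v_def g2_def p_def)
    next
      case 2
      then have ia: "i - a \<le> m" by simp
      have "a + g (i - a) \<le> p" using gm(2)[OF order_refl ia] am pm by simp
      then show ?thesis using 2 i am gm(2)[OF order_refl ia] sq[OF ia] fa[OF ia]
        by (simp add: v_def g2_def)
    next
      case 3 then show ?thesis using i am by (auto simp: v_def g2_def p_def)
    qed
  qed
  have uv: "u (v j) = j" if j: "j \<le> p" for j
  proof -
    consider "j < a" | "a \<le> j" "j \<le> a + n" | "a + n < j" by linarith
    then show ?thesis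
    proof cases
      case 1 then show ?thesis using j am ug[of j] by (auto simp: v_def g2_def p_def)
    next
      case 2 then show ?thesis using j am uf[of "j - a"] by (auto simp: v_def f2_def p_def)
    next
      case 3 then show ?thesis using j am ug[of "j + m - n"] by (auto simp: v_def g2_def p_def)
    qed
  qed
  \<comment> \<open>Both \<open>v\<close> after \<open>u\<close> and the identity are endomorphisms
    of the given cocone, so uniqueness in the universal property identifies them.\<close>
  have vu: "v (u i) = i" if i: "i \<le> q" for i
  proof -
    let ?P = "\<lambda>w. w \<in> homs Delta (Cod Delta F') q \<and> Comp Delta w F' = F' \<and> Comp Delta w G' = G'"
    have "\<exists>!w. ?P w"
      by (rule category.pushoutD[OF category_Delta po])
        (use f1A g1A sq in \<open>auto simp: homs_iff F' G' compose_def\<close>)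
    moreover have "?P (q, q, compose {0..q} v u)"
      using uA vA f1A g1A uf vf ug vg f1m(2) g1m(2)
      by (auto simp: homs_iff F' G' Delta_arr compose_def fun_eq_iff extensional_def)
    moreover have "?P (q, q, \<lambda>i \<in> {0..q}. i)"
      using f1A g1A f1m(2) g1m(2)
      by (auto simp: homs_iff F' G' Delta_arr compose_def fun_eq_iff extensional_def)
    ultimately have "(q, q, compose {0..q} v u) = (q, q, \<lambda>i \<in> {0..q}. i)" by blast
    then have "compose {0..q} v u = (\<lambda>i \<in> {0..q}. i)" by simp
    from fun_cong[OF this, of i] show ?thesis using i by simp
  qed
  have pq: "p = q" and vid: "v j = j" if "j \<le> p" for j
    using Delta_iso_unique[OF uA vA uv vu] that by auto
  have f12: "f1 i = f2 i" if "i \<le> n" for i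
    using vf[OF that] vid[of "f2 i"] f2A that by (auto simp: Delta_arr)
  have g12: "g1 i = g2 i" if "i \<le> k" for i
    using vg[OF that] vid[of "g2 i"] g2A that by (auto simp: Delta_arr)
  show thesis
  proof (rule that[of p f1 g1 a])
    have "p = q" using pq[of 0] by simp
    then show "F' = (n, p, f1)" "G' = (k, p, g1)" "(n, p, f1) \<in> Arr Delta" "(k, p, g1) \<in> Arr Delta"
      using F' G' f1A g1A by auto
    show "f1 j = a + j" if "j \<le> n" for j using f12[OF that] that by (simp add: f2_def)
    show "g1 i = i" if "i \<le> a" for i using g12[of i] that am g0 by (auto simp: g2_def)
    show "g1 (a + i) = a + g i" if "i \<le> m" for i using g12[of "a + i"] that am by (auto simp: g2_def)
    show "g1 i + m = i + n" if "a + m \<le> i" "i \<le> k" for i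
      using g12[of i] that am g0 by (cases "i = a + m") (auto simp: g2_def)
  qed (use am pm fa in auto)
qed

section \<open>Groupoids\<close>

lemma category_full_subcat:
  assumes "category C" shows "category (full_subcat C P)"
proof -
  interpret category C by fact
  show ?thesis by unfold_locales (auto simp: full_subcat_def homs_iff)
qed

lemma groupoid_max_subgroupoid:
  assumes "category C" shows "groupoid (max_subgroupoid C)"
proof -
  interpret category C by fact
  interpret M: category "max_subgroupoid C"
    by unfold_locales (auto simp: max_subgroupoid_def homs_iff iso_id iso_cmp)
  show ?thesis
  proof unfold_locales
    fix f assume "f \<in> Arr (max_subgroupoid C)"
    then have f: "is_iso C f" by (simp add: max_subgroupoid_def)
    then obtain g where "f \<in> Arr C" "g \<in> Arr C" "Dom C g = Cod C f" "Cod C g = Dom C f"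
      "g \<cdot> f = Id C (Dom C f)" "f \<cdot> g = Id C (Cod C f)" "is_iso C g" by (rule isoE)
    then show "is_iso (max_subgroupoid C) f" using f
      by (intro M.isoI[of f "Dom C f" "Cod C f" g]) (auto simp: max_subgroupoid_def homs_iff)
  qed
qed

lemma Grpd_sel [simp]:
  "Ob Grpd = {G. groupoid G}"
  "(G, H, F) \<in> Arr Grpd \<longleftrightarrow> groupoid G \<and> groupoid H \<and> is_functor G H F"
  "Dom Grpd (G, H, F) = G" "Cod Grpd (G, H, F) = H"
  "Id Grpd G = (G, G, id_functor G)"
  "Comp Grpd (H, K, F') (G, H', F) = (G, K, comp_functor G F' F)"
  by (simp_all add: Grpd_def)

lemma category_Grpd: "category Grpd"
proof (unfold_locales, goal_cases)
  case (3 a)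
  then show ?case by (auto simp: homs_iff groupoid_def intro: id_functor_functor)
next
  case (4 f a b g c)
  then show ?case by (cases f; cases g) (auto simp: homs_iff intro: comp_functor_functor)
next
  case (5 f a b)
  then show ?case by (cases f) (auto simp: homs_iff comp_functor_id_left)
next
  case (6 f a b)
  then show ?case by (cases f) (auto simp: homs_iff comp_functor_id_right)
next
  case (7 f a b g c h d)
  then show ?case by (cases f; cases g; cases h) (auto simp: homs_iff comp_functor_assoc)
qed auto

section \<open>The S-construction is a simplicial groupoid\<close>

abbreviation restr where "restr m F f \<equiv> comp_functor (Ar {0..m}) F (Ar_map {0..m} f)"
abbreviation restr_trans where "restr_trans m t f \<equiv> compose (Ob (Ar {0..m})) t (fobj (Ar_map {0..m} f))"

lemma is_functor_Ar_map:
  assumes "(m, n, f) \<in> Arr Delta"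
  shows "is_functor (Ar {0..m}) (Ar {0..n}) (Ar_map {0..m} f)"
  unfolding is_functor_def using assms
  by (auto simp: Ar_map_def category_Ar homs_iff Delta_arr)

lemma Ar_map_apply [simp]:
  fixes m :: nat
  shows "\<lbrakk>i \<le> j; j \<le> m\<rbrakk> \<Longrightarrow> fobj (Ar_map {0..m} f) (i, j) = (f i, f j)"
    "\<lbrakk>i \<le> k; j \<le> l; i \<le> j; k \<le> l; l \<le> m\<rbrakk>
      \<Longrightarrow> amap (Ar_map {0..m} f) i j k l = ((f i, f j), (f k, f l))"
  by (simp_all add: Ar_map_def)

lemma restr_apply [simp]:
  fixes m :: nat
  shows "\<lbrakk>i \<le> j; j \<le> m\<rbrakk> \<Longrightarrow> fobj (restr m F f) (i, j) = fobj F (f i, f j)"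
    "\<lbrakk>i \<le> k; j \<le> l; i \<le> j; k \<le> l; l \<le> m\<rbrakk> \<Longrightarrow> amap (restr m F f) i j k l = amap F (f i) (f j) (f k) (f l)"
    "\<lbrakk>i \<le> j; j \<le> m\<rbrakk> \<Longrightarrow> restr_trans m t f (i, j) = t (f i, f j)"
  by (simp_all add: compose_def)

text \<open>The conditions on a gap complex range over all chains i <= j <= k, degenerate ones
  included, so they apply to the images of chains under a monotone map that need not be
  injective.\<close>

lemma gap_complex_restr:
  assumes F: "gap_complex {0..n} C F" and f: "(m, n, f) \<in> Arr Delta"
  shows "gap_complex {0..m} C (restr m F f)"
proof -
  have F': "is_functor (Ar {0..n}) C F" using F by (simp add: gap_complex_def)
  have fm: "\<And>i j. i \<le> j \<Longrightarrow> j \<le> m \<Longrightarrow> f i \<le> f j" "\<And>j. j \<le> m \<Longrightarrow> f j \<le> n"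
    using f by (auto simp: Delta_arr)
  show ?thesis
    unfolding gap_complex_def using comp_functor_functor[OF is_functor_Ar_map[OF f] F'] F fm
    by (auto simp: gap_complex_def)
qed

lemma nattrans_restr:
  assumes t: "is_nattrans (Ar {0..n}) C (F, G, t)" and f: "(m, n, f) \<in> Arr Delta"
  shows "is_nattrans (Ar {0..m}) C (restr m F f, restr m G f, restr_trans m t f)"
proof (rule is_nattransI)
  have fm: "\<And>i j. i \<le> j \<Longrightarrow> j \<le> m \<Longrightarrow> f i \<le> f j" "\<And>j. j \<le> m \<Longrightarrow> f j \<le> n"
    using f by (auto simp: Delta_arr)
  show "is_functor (Ar {0..m}) C (restr m F f)" "is_functor (Ar {0..m}) C (restr m G f)"
    using comp_functor_functor[OF is_functor_Ar_map[OF f]] is_nattransD[OF t] by auto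
  fix x assume "x \<in> Ob (Ar {0..m})"
  then show "restr_trans m t f x \<in> Arr C \<and> Dom C (restr_trans m t f x) = fobj (restr m F f) x \<and>
      Cod C (restr_trans m t f x) = fobj (restr m G f) x"
    using is_nattransD(3-5)[OF t] fm by (cases x) auto
next
  fix u assume "u \<in> Arr (Ar {0..m})"
  then obtain i j k l where u: "u = ((i, j), (k, l))" "i \<le> k" "j \<le> l" "i \<le> j" "k \<le> l" "l \<le> m"
    by (cases u) auto
  have fm: "\<And>i j. i \<le> j \<Longrightarrow> j \<le> m \<Longrightarrow> f i \<le> f j" "\<And>j. j \<le> m \<Longrightarrow> f j \<le> n"
    using f by (auto simp: Delta_arr)
  have "((f i, f j), (f k, f l)) \<in> Arr (Ar {0..n})" using u fm by auto
  from is_nattransD(6)[OF t this]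
  show "Comp C (restr_trans m t f (Cod (Ar {0..m}) u)) (farr (restr m F f) u) =
      Comp C (farr (restr m G f) u) (restr_trans m t f (Dom (Ar {0..m}) u))"
    using u by simp
qed (simp add: compose_def)

section \<open>Isomorphisms of gap complexes\<close>

lemma S_sel [simp]:
  "Ob (S_groupoid C n) = {F. gap_complex {0..n} C F}"
  "Dom (S_groupoid C n) (F, G, t) = F" "Cod (S_groupoid C n) (F, G, t) = G"
  "Id (S_groupoid C n) F = (F, F, \<lambda>a \<in> Ob (Ar {0..n}). Id C (fobj F a))"
  "Comp (S_groupoid C n) (G', H, s) (F, G, t) = (F, H, \<lambda>a \<in> Ob (Ar {0..n}). Comp C (s a) (t a))"
  by (auto simp: S_groupoid_def max_subgroupoid_def Gap_def full_subcat_def functor_cat_def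
      gap_complex_def)

lemma groupoid_S: "groupoid (S_groupoid C n)"
  unfolding S_groupoid_def Gap_def
  by (intro groupoid_max_subgroupoid category_full_subcat category_functor_cat)

lemma category_Gap: "category (Gap I C)"
  unfolding Gap_def by (intro category_full_subcat category_functor_cat)

lemma category_S: "category (S_groupoid C n)"
  using groupoid_S groupoid_def by blast

lemma Gap_sel:
  "(F, G, t) \<in> Arr (Gap I C) \<longleftrightarrow>
     is_nattrans (Ar I) C (F, G, t) \<and> gap_complex I C F \<and> gap_complex I C G"
  "Dom (Gap I C) (F, G, t) = F" "Cod (Gap I C) (F, G, t) = G"
  "Id (Gap I C) F = (F, F, \<lambda>a \<in> Ob (Ar I). Id C (fobj F a))"
  "Comp (Gap I C) (G', H, s) (F, G, t) = (F, H, \<lambda>a \<in> Ob (Ar I). Comp C (s a) (t a))"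
  by (auto simp: Gap_def full_subcat_def functor_cat_def)

lemma S_arr:
  "(F, G, t) \<in> Arr (S_groupoid C n) \<longleftrightarrow> is_iso (Gap {0..n} C) (F, G, t)"
  by (auto simp: S_groupoid_def max_subgroupoid_def is_iso_def)

lemma (in abelian_category) gap_pairI:
  "\<lbrakk>gap_complex {0..n} C F; gap_complex {0..n} C G\<rbrakk> \<Longrightarrow> gap_pair C n F G"
  by (simp add: gap_pair_def gap_def gap_axioms_def abelian_category_axioms)

text \<open>Invertibility is tested at (0, n) alone: the composites and the identities are
  transformations of gap complexes, and these are determined by that component.\<close>

lemma (in abelian_category) S_arrI:
  assumes FG: "gap_complex {0..n} C F" "gap_complex {0..n} C G"
    and s: "is_nattrans (Ar {0..n}) C (F, G, s)" and t: "is_nattrans (Ar {0..n}) C (G, F, t)"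
    and ts: "t (0, n) \<cdot> s (0, n) = Id C (fobj F (0, n))" "s (0, n) \<cdot> t (0, n) = Id C (fobj G (0, n))"
  shows "(F, G, s) \<in> Arr (S_groupoid C n)"
proof -
  have "(\<lambda>a \<in> Ob (Ar {0..n}). t a \<cdot> s a) = (\<lambda>a \<in> Ob (Ar {0..n}). Id C (fobj F a))"
    by (rule gap_pair.nattrans_unique[OF gap_pairI[OF FG(1,1)] is_nattrans_comp[OF s t]
          is_nattrans_id[OF is_nattransD(1)[OF s]]]) (simp add: ts)
  moreover have "(\<lambda>a \<in> Ob (Ar {0..n}). s a \<cdot> t a) = (\<lambda>a \<in> Ob (Ar {0..n}). Id C (fobj G a))"
    by (rule gap_pair.nattrans_unique[OF gap_pairI[OF FG(2,2)] is_nattrans_comp[OF t s]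
          is_nattrans_id[OF is_nattransD(1)[OF t]]]) (simp add: ts)
  ultimately show ?thesis
    unfolding S_arr using FG s t
    by (intro category.isoI[OF category_Gap, of "(F, G, s)" _ _ F G "(G, F, t)"])
      (auto simp: homs_iff Gap_sel)
qed

lemma S_arrD:
  assumes "(F, G, s) \<in> Arr (S_groupoid C n)"
  shows "gap_complex {0..n} C F" "gap_complex {0..n} C G" "is_nattrans (Ar {0..n}) C (F, G, s)"
proof -
  have "(F, G, s) \<in> Arr (Gap {0..n} C)" using assms unfolding S_arr is_iso_def by blast
  then show "gap_complex {0..n} C F" "gap_complex {0..n} C G" "is_nattrans (Ar {0..n}) C (F, G, s)"
    by (auto simp: Gap_sel)
qed

lemma S_arr_inverse:
  assumes "(F, G, s) \<in> Arr (S_groupoid C n)"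
  obtains t where "(G, F, t) \<in> Arr (S_groupoid C n)"
    "\<And>i j. \<lbrakk>i \<le> j; j \<le> n\<rbrakk> \<Longrightarrow> Comp C (t (i, j)) (s (i, j)) = Id C (fobj F (i, j)) \<and>
        Comp C (s (i, j)) (t (i, j)) = Id C (fobj G (i, j))"
proof -
  obtain x where x: "x \<in> Arr (Gap {0..n} C)" "Dom (Gap {0..n} C) x = G" "Cod (Gap {0..n} C) x = F"
    "Comp (Gap {0..n} C) x (F, G, s) = Id (Gap {0..n} C) F"
    "Comp (Gap {0..n} C) (F, G, s) x = Id (Gap {0..n} C) G" "is_iso (Gap {0..n} C) x"
    using assms unfolding S_arr by (rule category.isoE[OF category_Gap]) (auto simp: Gap_sel)
  obtain t where t: "x = (G, F, t)" using x by (cases x) (auto simp: Gap_sel)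
  have "Comp C (t (i, j)) (s (i, j)) = Id C (fobj F (i, j)) \<and>
        Comp C (s (i, j)) (t (i, j)) = Id C (fobj G (i, j))" if "i \<le> j" "j \<le> n" for i j
    using x(4,5) that unfolding t Gap_sel by (auto dest!: fun_cong[of _ _ "(i, j)"])
  with x that show thesis by (simp add: t S_arr)
qed

lemma S_arr_iso:
  assumes "abelian_category C" "(F, G, s) \<in> Arr (S_groupoid C n)" "i \<le> j" "j \<le> n"
  shows "is_iso C (s (i, j))"
proof -
  interpret abelian_category C by fact
  obtain t where t: "(G, F, t) \<in> Arr (S_groupoid C n)"
    "t (i, j) \<cdot> s (i, j) = Id C (fobj F (i, j)) \<and> s (i, j) \<cdot> t (i, j) = Id C (fobj G (i, j))"
    using S_arr_inverse[OF assms(2)] assms(3,4) by metis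
  show ?thesis
    by (rule isoI[of _ "fobj F (i, j)" "fobj G (i, j)" "t (i, j)"])
      (use t is_nattransD(3-5)[OF S_arrD(3)[OF assms(2)], of "(i, j)"]
        is_nattransD(3-5)[OF S_arrD(3)[OF t(1)], of "(i, j)"] assms(3,4) in \<open>auto simp: homs_iff\<close>)
qed

lemma (in abelian_category) S_arr_restr:
  assumes s: "(F, G, s) \<in> Arr (S_groupoid C n)" and f: "(m, n, f) \<in> Arr Delta"
  shows "(restr m F f, restr m G f, restr_trans m s f) \<in> Arr (S_groupoid C m)"
proof -
  obtain t where t: "(G, F, t) \<in> Arr (S_groupoid C n)"
    "\<And>i j. \<lbrakk>i \<le> j; j \<le> n\<rbrakk> \<Longrightarrow> Comp C (t (i, j)) (s (i, j)) = Id C (fobj F (i, j)) \<and>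
        Comp C (s (i, j)) (t (i, j)) = Id C (fobj G (i, j))"
    using s by (rule S_arr_inverse) blast
  have "f 0 \<le> f m" "f m \<le> n" using f by (auto simp: Delta_arr)
  then show ?thesis
    using t(2) by (intro S_arrI[OF gap_complex_restr[OF S_arrD(1)[OF s] f] gap_complex_restr[OF S_arrD(2)[OF s] f]
        nattrans_restr[OF S_arrD(3)[OF s] f] nattrans_restr[OF S_arrD(3)[OF t(1)] f]]) auto
qed

section \<open>Restriction along monotone maps as a strict functor\<close>

lemma precomp_apply [simp]:
  "F \<in> Ob E \<Longrightarrow> fobj (precomp_functor D E K) F = comp_functor D F K"
  "(F, G, s) \<in> Arr E \<Longrightarrow> farr (precomp_functor D E K) (F, G, s) =
     (comp_functor D F K, comp_functor D G K, compose (Ob D) s (fobj K))"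
  by (simp_all add: precomp_functor_def)

lemma (in abelian_category) is_functor_precomp:
  assumes f: "(m, n, f) \<in> Arr Delta"
  shows "is_functor (S_groupoid C n) (S_groupoid C m)
    (precomp_functor (Ar {0..m}) (S_groupoid C n) (Ar_map {0..m} f))"
  unfolding is_functor_def
proof (intro conjI ballI impI)
  interpret Sn: category "S_groupoid C n" by (rule category_S)
  have fm: "\<And>i j. i \<le> j \<Longrightarrow> j \<le> m \<Longrightarrow> f i \<le> f j" "\<And>j. j \<le> m \<Longrightarrow> f j \<le> n"
    using f by (auto simp: Delta_arr)
  let ?P = "precomp_functor (Ar {0..m}) (S_groupoid C n) (Ar_map {0..m} f)"
  fix F assume F: "F \<in> Ob (S_groupoid C n)"
  then show "fobj ?P F \<in> Ob (S_groupoid C m)" using gap_complex_restr[OF _ f] by simp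
  have "(F, F, \<lambda>a \<in> Ob (Ar {0..n}). Id C (fobj F a)) \<in> Arr (S_groupoid C n)"
    using Sn.id_simps(1)[OF F] by simp
  moreover have "restr_trans m (\<lambda>a \<in> Ob (Ar {0..n}). Id C (fobj F a)) f = (\<lambda>a \<in> Ob (Ar {0..m}). Id C (fobj (restr m F f) a))"
  proof (rule extensionalityI[of _ "Ob (Ar {0..m})"])
    fix x assume "x \<in> Ob (Ar {0..m})"
    then show "restr_trans m (\<lambda>a \<in> Ob (Ar {0..n}). Id C (fobj F a)) f x = (\<lambda>a \<in> Ob (Ar {0..m}). Id C (fobj (restr m F f) a)) x"
      using fm by (cases x) auto
  qed (auto simp: compose_def)
  ultimately show "farr ?P (Id (S_groupoid C n) F) = Id (S_groupoid C m) (fobj ?P F)"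
    using F by simp
next
  let ?P = "precomp_functor (Ar {0..m}) (S_groupoid C n) (Ar_map {0..m} f)"
  fix u assume u: "u \<in> Arr (S_groupoid C n)"
  then obtain F G s where us: "u = (F, G, s)" by (cases u)
  show "farr ?P u \<in> homs (S_groupoid C m) (fobj ?P (Dom (S_groupoid C n) u)) (fobj ?P (Cod (S_groupoid C n) u))"
    using S_arr_restr[OF _ f] u S_arrD(1,2)[of F G s C n] by (simp add: us homs_iff)
next
  interpret Sn: category "S_groupoid C n" by (rule category_S)
  have fm: "\<And>i j. i \<le> j \<Longrightarrow> j \<le> m \<Longrightarrow> f i \<le> f j" "\<And>j. j \<le> m \<Longrightarrow> f j \<le> n"
    using f by (auto simp: Delta_arr)
  let ?P = "precomp_functor (Ar {0..m}) (S_groupoid C n) (Ar_map {0..m} f)"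
  fix u v assume uv: "u \<in> Arr (S_groupoid C n)" "v \<in> Arr (S_groupoid C n)"
    "Dom (S_groupoid C n) v = Cod (S_groupoid C n) u"
  obtain F G s where us: "u = (F, G, s)" by (cases u)
  obtain H t where vs: "v = (G, H, t)" using uv us by (cases v) auto
  have "Sn.cmp v u \<in> Arr (S_groupoid C n)" using uv by simp
  moreover have "restr_trans m (\<lambda>a \<in> Ob (Ar {0..n}). t a \<cdot> s a) f = (\<lambda>a \<in> Ob (Ar {0..m}). restr_trans m t f a \<cdot> restr_trans m s f a)"
  proof (rule extensionalityI[of _ "Ob (Ar {0..m})"])
    fix x assume "x \<in> Ob (Ar {0..m})"
    then show "restr_trans m (\<lambda>a \<in> Ob (Ar {0..n}). t a \<cdot> s a) f x = (\<lambda>a \<in> Ob (Ar {0..m}). restr_trans m t f a \<cdot> restr_trans m s f a) x"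
      using fm by (cases x) auto
  qed (auto simp: compose_def)
  ultimately show "farr ?P (Sn.cmp v u) = Comp (S_groupoid C m) (farr ?P v) (farr ?P u)"
    using uv unfolding us vs by simp
qed (auto simp: precomp_functor_def category_S)

lemma restr_id:
  fixes n :: nat
  assumes "is_functor (Ar {0..n}) C F"
  shows "restr n F (\<lambda>i \<in> {0..n}. i) = F"
proof (rule functr_eqI[OF comp_functor_functor[OF is_functor_Ar_map[of n n] assms] assms])
  show "(n, n, \<lambda>i \<in> {0..n}. i) \<in> Arr Delta" by (simp add: Delta_arr)
next
  fix x assume "x \<in> Ob (Ar {0..n})"
  then show "fobj (restr n F (\<lambda>i \<in> {0..n}. i)) x = fobj F x" by (cases x) auto
next
  fix x assume "x \<in> Arr (Ar {0..n})"
  then show "farr (restr n F (\<lambda>i \<in> {0..n}. i)) x = farr F x" by (cases x) auto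
qed

lemma restr_comp:
  assumes F: "is_functor (Ar {0..n}) C F" and f: "(m, n, f) \<in> Arr Delta" and g: "(l, m, g) \<in> Arr Delta"
  shows "restr l (restr m F f) g = restr l F (compose {0..l} f g)"
proof (rule functr_eqI)
  have gm: "\<And>i j. i \<le> j \<Longrightarrow> j \<le> l \<Longrightarrow> g i \<le> g j" "\<And>j. j \<le> l \<Longrightarrow> g j \<le> m"
    using g by (auto simp: Delta_arr)
  have fg: "(l, n, compose {0..l} f g) \<in> Arr Delta"
    using f g by (auto simp: Delta_arr)
  show "is_functor (Ar {0..l}) C (restr l (restr m F f) g)" "is_functor (Ar {0..l}) C (restr l F (compose {0..l} f g))"
    using comp_functor_functor is_functor_Ar_map F f g fg by metis+
  fix x assume "x \<in> Ob (Ar {0..l})"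
  then show "fobj (restr l (restr m F f) g) x = fobj (restr l F (compose {0..l} f g)) x"
    using gm by (cases x) auto
next
  have gm: "\<And>i j. i \<le> j \<Longrightarrow> j \<le> l \<Longrightarrow> g i \<le> g j" "\<And>j. j \<le> l \<Longrightarrow> g j \<le> m"
    using g by (auto simp: Delta_arr)
  fix x assume "x \<in> Arr (Ar {0..l})"
  then show "farr (restr l (restr m F f) g) x = farr (restr l F (compose {0..l} f g)) x"
    using gm by (cases x) auto
qed

lemma restr_trans_comp:
  assumes g: "(l, m, g) \<in> Arr Delta"
  shows "restr_trans l (restr_trans m t f) g = restr_trans l t (compose {0..l} f g)"
proof (rule extensionalityI[of _ "Ob (Ar {0..l})"])
  have gm: "\<And>i j. i \<le> j \<Longrightarrow> j \<le> l \<Longrightarrow> g i \<le> g j" "\<And>j. j \<le> l \<Longrightarrow> g j \<le> m"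
    using g by (auto simp: Delta_arr)
  fix x assume "x \<in> Ob (Ar {0..l})"
  then show "restr_trans l (restr_trans m t f) g x = restr_trans l t (compose {0..l} f g) x" using gm by (cases x) auto
qed (auto simp: compose_def)

lemma restr_trans_id:
  fixes n :: nat
  assumes "t \<in> extensional (Ob (Ar {0..n}))"
  shows "restr_trans n t (\<lambda>i \<in> {0..n}. i) = t"
proof (rule extensionalityI[of _ "Ob (Ar {0..n})"])
  fix x assume "x \<in> Ob (Ar {0..n})"
  then show "restr_trans n t (\<lambda>i \<in> {0..n}. i) x = t x" by (cases x) auto
qed (use assms in \<open>auto simp: compose_def\<close>)

abbreviation S_map where "S_map C m n f \<equiv> precomp_functor (Ar {0..m}) (S_groupoid C n) (Ar_map {0..m} f)"

lemma waldhausen_S_sel [simp]: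
  "fobj (waldhausen_S C) n = S_groupoid C n"
  "(m, n, f) \<in> Arr Delta \<Longrightarrow> farr (waldhausen_S C) (m, n, f) = (S_groupoid C n, S_groupoid C m, S_map C m n f)"
  by (simp_all add: waldhausen_S_def)

text \<open>Restriction is strictly functorial, because functors and transformations are
  extensional; no coherence data arise.\<close>

lemma (in abelian_category) waldhausen_S_functor: "is_functor (opposite Delta) Grpd (waldhausen_S C)"
  unfolding is_functor_def
proof (intro conjI ballI impI)
  have op: "Ob (opposite Delta) = UNIV" "Arr (opposite Delta) = Arr Delta"
    "Dom (opposite Delta) = Cod Delta" "Cod (opposite Delta) = Dom Delta"
    "Id (opposite Delta) = Id Delta" "Comp (opposite Delta) = (\<lambda>g f. Comp Delta f g)"
    by (simp_all add: opposite_def)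
  show "farr (waldhausen_S C) \<in> extensional (Arr (opposite Delta))"
    "fobj (waldhausen_S C) \<in> extensional (Ob (opposite Delta))"
    by (simp_all add: op waldhausen_S_def)
  fix n :: nat
  show "fobj (waldhausen_S C) n \<in> Ob Grpd" by (simp add: groupoid_S)
  have idA: "(n, n, \<lambda>i \<in> {0..n}. i) \<in> Arr Delta" by (simp add: Delta_arr)
  have "S_map C n n (\<lambda>i \<in> {0..n}. i) = id_functor (S_groupoid C n)"
  proof (rule functr_eqI[OF is_functor_precomp[OF idA] id_functor_functor[OF category_S]])
    fix F assume F: "F \<in> Ob (S_groupoid C n)"
    then show "fobj (S_map C n n (\<lambda>i \<in> {0..n}. i)) F = fobj (id_functor (S_groupoid C n)) F"
      using restr_id[of n C F] by (simp add: gap_complex_def)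
  next
    fix u assume u: "u \<in> Arr (S_groupoid C n)"
    then obtain F G t where ut: "u = (F, G, t)" by (cases u)
    then show "farr (S_map C n n (\<lambda>i \<in> {0..n}. i)) u = farr (id_functor (S_groupoid C n)) u"
      using u S_arrD(3)[of F G t C n] is_nattransD(1,2,7)[of "Ar {0..n}" C F G t]
      by (simp add: restr_id restr_trans_id)
  qed
  then show "farr (waldhausen_S C) (Id (opposite Delta) n) = Id Grpd (fobj (waldhausen_S C) n)"
    using idA by (simp add: op)
next
  have op: "Ob (opposite Delta) = UNIV" "Arr (opposite Delta) = Arr Delta"
    "Dom (opposite Delta) = Cod Delta" "Cod (opposite Delta) = Dom Delta"
    "Id (opposite Delta) = Id Delta" "Comp (opposite Delta) = (\<lambda>g f. Comp Delta f g)"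
    by (simp_all add: opposite_def)
  fix u assume u: "u \<in> Arr (opposite Delta)"
  obtain m n f where um: "u = (m, n, f)" by (cases u)
  then have f: "(m, n, f) \<in> Arr Delta" using u by (simp add: op)
  show "farr (waldhausen_S C) u \<in> homs Grpd (fobj (waldhausen_S C) (Dom (opposite Delta) u))
      (fobj (waldhausen_S C) (Cod (opposite Delta) u))"
    using f is_functor_precomp[OF f] by (simp add: um op homs_iff groupoid_S)
  fix v assume v: "v \<in> Arr (opposite Delta)" "Dom (opposite Delta) v = Cod (opposite Delta) u"
  obtain l g where vm: "v = (l, m, g)" using v by (cases v) (auto simp: op um)
  have g: "(l, m, g) \<in> Arr Delta" using v by (simp add: op vm)
  have fg: "(l, n, compose {0..l} f g) \<in> Arr Delta"
    using f g by (auto simp: Delta_arr)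
  have "S_map C l n (compose {0..l} f g) = comp_functor (S_groupoid C n) (S_map C l m g) (S_map C m n f)"
  proof (rule functr_eqI[OF is_functor_precomp[OF fg] comp_functor_functor[OF is_functor_precomp[OF f] is_functor_precomp[OF g]]])
    fix F assume F: "F \<in> Ob (S_groupoid C n)"
    then show "fobj (S_map C l n (compose {0..l} f g)) F
        = fobj (comp_functor (S_groupoid C n) (S_map C l m g) (S_map C m n f)) F"
      using restr_comp[OF _ f g, of C F] gap_complex_restr[OF _ f, of C F] by (simp add: gap_complex_def)
  next
    fix w assume w: "w \<in> Arr (S_groupoid C n)"
    then obtain F G t where wt: "w = (F, G, t)" by (cases w)
    have a: "(restr m F f, restr m G f, restr_trans m t f) \<in> Arr (S_groupoid C m)"
      using S_arr_restr[OF _ f] w wt by simp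
    have nt: "is_nattrans (Ar {0..n}) C (F, G, t)" using S_arrD(3) w wt by simp
    show "farr (S_map C l n (compose {0..l} f g)) w
        = farr (comp_functor (S_groupoid C n) (S_map C l m g) (S_map C m n f)) w"
      using w a by (simp add: wt restr_trans_comp[OF g] restr_comp[OF is_nattransD(1)[OF nt] f g]
          restr_comp[OF is_nattransD(2)[OF nt] f g])
  qed
  then show "farr (waldhausen_S C) (Comp (opposite Delta) v u)
      = Comp Grpd (farr (waldhausen_S C) v) (farr (waldhausen_S C) u)"
    using f g fg by (simp add: op um vm)
qed (use category_opposite[OF category_Delta] category_Grpd in auto)

section \<open>Homotopy fibre products\<close>

lemma hfp_sel:
  "(a, b, \<phi>) \<in> Ob (homotopy_fibre_product A B C f g) \<longleftrightarrow>
     a \<in> Ob A \<and> b \<in> Ob B \<and> \<phi> \<in> homs C (fobj f a) (fobj g b)"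
  "((a, b, \<phi>), (a', b', \<phi>'), \<alpha>, \<beta>) \<in> Arr (homotopy_fibre_product A B C f g) \<longleftrightarrow>
     (a, b, \<phi>) \<in> Ob (homotopy_fibre_product A B C f g) \<and>
     (a', b', \<phi>') \<in> Ob (homotopy_fibre_product A B C f g) \<and>
     \<alpha> \<in> homs A a a' \<and> \<beta> \<in> homs B b b' \<and>
     Comp C \<phi>' (farr f \<alpha>) = Comp C (farr g \<beta>) \<phi>"
  "Dom (homotopy_fibre_product A B C f g) (x, y, \<alpha>, \<beta>) = x"
  "Cod (homotopy_fibre_product A B C f g) (x, y, \<alpha>, \<beta>) = y"
  "Id (homotopy_fibre_product A B C f g) (a, b, \<phi>) = ((a, b, \<phi>), (a, b, \<phi>), Id A a, Id B b)"
  "Comp (homotopy_fibre_product A B C f g) (y, z, \<alpha>', \<beta>') (x, y', \<alpha>, \<beta>)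
     = (x, z, Comp A \<alpha>' \<alpha>, Comp B \<beta>' \<beta>)"
  by (auto simp: homotopy_fibre_product_def Let_def)

locale cospan =
  fixes A :: "('o, 'm) cat" and B :: "('p, 'n) cat" and C :: "('q, 'l) cat" and f g
  assumes f: "is_functor A C f" and g: "is_functor B C g"
begin

sublocale A: category A by (rule is_functorD[OF f])
sublocale B: category B by (rule is_functorD[OF g])
sublocale C: category C by (rule is_functorD[OF f])

abbreviation "HP \<equiv> homotopy_fibre_product A B C f g"

lemmas fs [simp] = is_functorD(3-8)[OF f]
lemmas gs [simp] = is_functorD(3-8)[OF g]

text \<open>The two compatibility squares are pasted side by side.\<close>

lemma hp_cmp:
  assumes u: "((a, b, \<phi>), (a', b', \<phi>'), \<alpha>, \<beta>) \<in> Arr HP"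
    and v: "((a', b', \<phi>'), (a'', b'', \<phi>''), \<alpha>', \<beta>') \<in> Arr HP"
  shows "((a, b, \<phi>), (a'', b'', \<phi>''), A.cmp \<alpha>' \<alpha>, B.cmp \<beta>' \<beta>) \<in> Arr HP"
proof -
  have u': "\<phi> \<in> Arr C" "Dom C \<phi> = fobj f a" "Cod C \<phi> = fobj g b" "a \<in> Ob A" "b \<in> Ob B"
    "\<phi>' \<in> Arr C" "Dom C \<phi>' = fobj f a'" "Cod C \<phi>' = fobj g b'" "a' \<in> Ob A" "b' \<in> Ob B"
    "\<phi>'' \<in> Arr C" "Dom C \<phi>'' = fobj f a''" "Cod C \<phi>'' = fobj g b''" "a'' \<in> Ob A" "b'' \<in> Ob B"
    "\<alpha> \<in> Arr A" "Dom A \<alpha> = a" "Cod A \<alpha> = a'" "\<beta> \<in> Arr B" "Dom B \<beta> = b" "Cod B \<beta> = b'"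
    "\<alpha>' \<in> Arr A" "Dom A \<alpha>' = a'" "Cod A \<alpha>' = a''" "\<beta>' \<in> Arr B" "Dom B \<beta>' = b'" "Cod B \<beta>' = b''"
    and e1: "C.cmp \<phi>' (farr f \<alpha>) = C.cmp (farr g \<beta>) \<phi>"
    and e2: "C.cmp \<phi>'' (farr f \<alpha>') = C.cmp (farr g \<beta>') \<phi>'"
    using u v by (auto simp: hfp_sel homs_iff)
  have "C.cmp \<phi>'' (farr f (A.cmp \<alpha>' \<alpha>)) = C.cmp (C.cmp \<phi>'' (farr f \<alpha>')) (farr f \<alpha>)"
    using u' by simp
  also have "\<dots> = C.cmp (farr g \<beta>') (C.cmp \<phi>' (farr f \<alpha>))" unfolding e2 using u' by simp
  also have "\<dots> = C.cmp (farr g (B.cmp \<beta>' \<beta>)) \<phi>" unfolding e1 using u' by simp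
  finally show ?thesis using u' by (simp add: hfp_sel homs_iff)
qed

lemma hp_category: "category HP"
proof (unfold_locales, goal_cases)
  case (1 u)
  then show ?case by (cases u) (auto simp: hfp_sel)
next
  case (2 u)
  then show ?case by (cases u) (auto simp: hfp_sel)
next
  case (3 x)
  then show ?case by (cases x) (auto simp: hfp_sel homs_iff)
next
  case (4 u x y v z)
  then show ?case
    by (cases x; cases y; cases z; cases u; cases v) (auto simp: hfp_sel(3,4,6) homs_iff hp_cmp)
next
  case (5 u x y)
  then show ?case by (cases x; cases y; cases u) (auto simp: hfp_sel homs_iff)
next
  case (6 u x y)
  then show ?case by (cases x; cases y; cases u) (auto simp: hfp_sel homs_iff)
next
  case (7 u x y v z w t)
  then show ?case by (cases x; cases y; cases z; cases t; cases u; cases v; cases w) (auto simp: hfp_sel homs_iff)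
qed

text \<open>Compatibility of the inverse pair is the given compatibility, composed with the images
  of the inverses on either side.\<close>

lemma hp_iso:
  assumes u: "((a, b, \<phi>), (a', b', \<phi>'), \<alpha>, \<beta>) \<in> Arr HP"
    and "is_iso A \<alpha>" "is_iso B \<beta>"
  shows "is_iso HP ((a, b, \<phi>), (a', b', \<phi>'), \<alpha>, \<beta>)"
proof -
  have u': "\<phi> \<in> Arr C" "Dom C \<phi> = fobj f a" "Cod C \<phi> = fobj g b" "a \<in> Ob A" "b \<in> Ob B"
    "\<phi>' \<in> Arr C" "Dom C \<phi>' = fobj f a'" "Cod C \<phi>' = fobj g b'" "a' \<in> Ob A" "b' \<in> Ob B"
    "\<alpha> \<in> Arr A" "Dom A \<alpha> = a" "Cod A \<alpha> = a'" "\<beta> \<in> Arr B" "Dom B \<beta> = b" "Cod B \<beta> = b'"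
    and e: "C.cmp \<phi>' (farr f \<alpha>) = C.cmp (farr g \<beta>) \<phi>"
    using u by (auto simp: hfp_sel homs_iff)
  obtain \<alpha>' where \<alpha>: "\<alpha>' \<in> Arr A" "Dom A \<alpha>' = Cod A \<alpha>" "Cod A \<alpha>' = Dom A \<alpha>"
    "A.cmp \<alpha>' \<alpha> = Id A (Dom A \<alpha>)" "A.cmp \<alpha> \<alpha>' = Id A (Cod A \<alpha>)" using assms(2) by (rule A.isoE)
  obtain \<beta>' where \<beta>: "\<beta>' \<in> Arr B" "Dom B \<beta>' = Cod B \<beta>" "Cod B \<beta>' = Dom B \<beta>"
    "B.cmp \<beta>' \<beta> = Id B (Dom B \<beta>)" "B.cmp \<beta> \<beta>' = Id B (Cod B \<beta>)" using assms(3) by (rule B.isoE)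
  have f1: "C.cmp (farr f \<alpha>) (farr f \<alpha>') = Id C (fobj f a')"
    using fs(6)[of \<alpha>' \<alpha>] \<alpha> u' by simp
  have g1: "C.cmp (farr g \<beta>') (farr g \<beta>) = Id C (fobj g b)"
    using gs(6)[of \<beta> \<beta>'] \<beta> u' by simp
  have "C.cmp (farr g \<beta>') \<phi>' = C.cmp (farr g \<beta>') (C.cmp (C.cmp \<phi>' (farr f \<alpha>)) (farr f \<alpha>'))"
    using u' \<alpha>(1-3) \<beta>(1-3) f1 by simp
  also have "\<dots> = C.cmp (C.cmp (farr g \<beta>') (farr g \<beta>)) (C.cmp \<phi> (farr f \<alpha>'))"
    unfolding e using u' \<alpha>(1-3) \<beta>(1-3) by simp
  also have "\<dots> = C.cmp \<phi> (farr f \<alpha>')" unfolding g1 using u' \<alpha>(1-3) by simp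
  finally have "((a', b', \<phi>'), (a, b, \<phi>), \<alpha>', \<beta>') \<in> Arr HP"
    using u' \<alpha>(1-3) \<beta>(1-3) by (simp add: hfp_sel homs_iff)
  then show ?thesis
    using u u' \<alpha> \<beta> by (intro category.isoI[OF hp_category, of _ "(a, b, \<phi>)" "(a', b', \<phi>')"
          "((a', b', \<phi>'), (a, b, \<phi>), \<alpha>', \<beta>')"]) (auto simp: homs_iff hfp_sel(3-6))
qed

lemma comparison_functor_sel:
  "x \<in> Ob P \<Longrightarrow> fobj (comparison_functor P C p q f) x
     = (fobj p x, fobj q x, Id C (fobj f (fobj p x)))"
  "u \<in> Arr P \<Longrightarrow> farr (comparison_functor P C p q f) u =
     ((fobj p (Dom P u), fobj q (Dom P u), Id C (fobj f (fobj p (Dom P u)))),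
      (fobj p (Cod P u), fobj q (Cod P u), Id C (fobj f (fobj p (Cod P u)))), farr p u, farr q u)"
  by (simp_all add: comparison_functor_def Let_def)

lemma comparison_is_functor:
  assumes p: "is_functor P A p" and q: "is_functor P B q"
    and ob: "\<And>x. x \<in> Ob P \<Longrightarrow> fobj f (fobj p x) = fobj g (fobj q x)"
    and ar: "\<And>u. u \<in> Arr P \<Longrightarrow> farr f (farr p u) = farr g (farr q u)"
  shows "is_functor P HP (comparison_functor P C p q f)"
proof -
  note ps [simp] = is_functorD(3-8)[OF p] and qs [simp] = is_functorD(3-8)[OF q]
  interpret P: category P by (rule is_functorD[OF p])
  \<comment> \<open>An identity is a legitimate third component because the square commutes
    strictly.\<close>
  have o: "fobj (comparison_functor P C p q f) x \<in> Ob HP" if "x \<in> Ob P" for x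
    using that by (simp add: comparison_functor_sel hfp_sel homs_iff ob)
  show ?thesis
    unfolding is_functor_def
  proof (intro conjI ballI impI)
    fix u assume u: "u \<in> Arr P"
    have 1: "fobj f (fobj p (Dom P u)) = fobj g (fobj q (Dom P u))"
      "fobj f (fobj p (Cod P u)) = fobj g (fobj q (Cod P u))" using ob u by auto
    have "farr f (farr p u) \<in> Arr C" "Cod C (farr f (farr p u)) = fobj f (fobj p (Cod P u))"
      "farr g (farr q u) \<in> Arr C" "Dom C (farr g (farr q u)) = fobj g (fobj q (Dom P u))"
      using u by auto
    then show "farr (comparison_functor P C p q f) u
        \<in> homs HP (fobj (comparison_functor P C p q f) (Dom P u)) (fobj (comparison_functor P C p q f) (Cod P u))"
      using u 1 ar[OF u] by (simp add: comparison_functor_sel hfp_sel homs_iff)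
  next
    fix x assume "x \<in> Ob P"
    then show "farr (comparison_functor P C p q f) (Id P x) = Id HP (fobj (comparison_functor P C p q f) x)"
      by (simp add: comparison_functor_sel hfp_sel)
  next
    fix u v assume "u \<in> Arr P" "v \<in> Arr P" "Dom P v = Cod P u"
    then show "farr (comparison_functor P C p q f) (P.cmp v u) =
      Comp HP (farr (comparison_functor P C p q f) v) (farr (comparison_functor P C p q f) u)"
      by (simp add: comparison_functor_sel hfp_sel)
  qed (use o hp_category P.category_axioms in \<open>auto simp: comparison_functor_def Let_def\<close>)
qed

end

section \<open>The squares of the S-construction\<close>

text \<open>An epi is the cokernel of its kernel: it is the cokernel of some \<open>h\<close>, and
  \<open>h\<close> factors through \<open>k\<close>, so an arrow that kills \<open>k\<close> also
  kills \<open>h\<close>.\<close>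

lemma (in abelian_category) epi_factor_kernel:
  assumes e: "is_epi C e" and k: "is_kernel C k e"
    and y: "y \<in> Arr C" "Dom C y = Dom C e" "zero_arrow C (y \<cdot> k)"
  obtains u where "u \<in> Arr C" "Dom C u = Cod C e" "Cod C u = Cod C y" "u \<cdot> e = y"
proof -
  obtain h where h: "is_cokernel C e h" using epi_normal[OF e] by blast
  obtain h' where h': "h' \<in> Arr C" "Cod C h' = Dom C k" "k \<cdot> h' = h"
    using kernelD(6)[OF k, of h] cokernelD(1,3,4)[OF h] by auto
  have "zero_arrow C ((y \<cdot> k) \<cdot> h')"
    by (rule zero_cmp_right[OF y(3)]) (use h' y kernelD(2,3)[OF k] in auto)
  then have "zero_arrow C (y \<cdot> h)" using h' y kernelD(2,3)[OF k] by simp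
  then show thesis using cokernelD(3)[OF h] cokernelD(6)[OF h, of y] y that by auto
qed

lemma (in abelian_category) kernel_of_mono_cmp:
  assumes k: "is_kernel C k f" and m: "is_mono C m" "Dom C m = Cod C f"
  shows "is_kernel C k (m \<cdot> f)"
proof (rule kernelI)
  note [simp] = kernelD(1-3)[OF k] mono_arr[OF m(1)] m(2)
  show "zero_arrow C ((m \<cdot> f) \<cdot> k)" using zero_cmp_left[OF kernelD(4)[OF k], of m] by simp
  fix h assume h: "h \<in> Arr C" "Cod C h = Dom C (m \<cdot> f)" "zero_arrow C ((m \<cdot> f) \<cdot> h)"
  have "zero_arrow C (f \<cdot> h)" by (rule mono_zero_cancel[OF m(1)]) (use h in auto)
  then show "\<exists>u. u \<in> Arr C \<and> Dom C u = Dom C h \<and> Cod C u = Dom C k \<and> k \<cdot> u = h"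
    using kernelD(6)[OF k, of h] h by simp
qed (use kernelD[OF k] mono_arr m in auto)

lemma (in category) mono_split_iso:
  assumes "is_mono C f" "u \<in> Arr C" "Dom C u = Cod C f" "Cod C u = Dom C f" "f \<cdot> u = Id C (Cod C f)"
  shows "is_iso C f"
proof -
  note [simp] = mono_arr[OF assms(1)]
  have "f \<cdot> u \<cdot> f = (f \<cdot> u) \<cdot> f" using assms(1-4) by simp
  then have "f \<cdot> u \<cdot> f = f \<cdot> Id C (Dom C f)" unfolding assms(5) by simp
  then have "u \<cdot> f = Id C (Dom C f)"
    by (rule mono_cancel[OF assms(1)]) (use assms in auto)
  then show ?thesis using assms by (intro isoI[of f "Dom C f" "Cod C f" u]) (auto simp: homs_iff)
qed

text \<open>The explicit pushout square found in \<open>Delta_pushoutE\<close>: \<open>g'\<close> is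
  the identity up to a, a shifted copy of \<open>g\<close> on [a, a + m], and the shift by n - m
  from there on.\<close>

locale segal_square = abelian_category C for C :: "('o, 'm) cat" +
  fixes m n k p a :: nat and g f f' g' :: "nat \<Rightarrow> nat"
  assumes gA: "(m, n, g) \<in> Arr Delta" and fA: "(m, k, f) \<in> Arr Delta"
    and f'A: "(n, p, f') \<in> Arr Delta" and g'A: "(k, p, g') \<in> Arr Delta"
    and am: "a + m \<le> k" and pm: "p + m = k + n"
    and g0 [simp]: "g 0 = 0" and gm [simp]: "g m = n"
    and f_at [simp]: "\<And>i. i \<le> m \<Longrightarrow> f i = a + i"
    and f'_at [simp]: "\<And>j. j \<le> n \<Longrightarrow> f' j = a + j"
    and g'_lo: "\<And>i. i \<le> a \<Longrightarrow> g' i = i"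
    and g'_mid [simp]: "\<And>i. i \<le> m \<Longrightarrow> g' (a + i) = a + g i"
    and g'_hi: "\<And>i. \<lbrakk>a + m \<le> i; i \<le> k\<rbrakk> \<Longrightarrow> g' i + m = i + n"
begin

lemma g'_ends [simp]: "g' 0 = 0" "g' k = p" "g' a = a" "g' (a + m) = a + n"
  using g'_lo[of 0] g'_hi[of k] am pm g'_mid[of 0] g'_mid[of m] by auto

lemma bounds [simp]: "a + n \<le> p" "\<And>j. j \<le> n \<Longrightarrow> a + j \<le> p" "\<And>j. j \<le> m \<Longrightarrow> a + j \<le> k" "a \<le> k" "a \<le> p"
  using am pm by auto

lemma g_le [simp]: "\<And>i j. \<lbrakk>i \<le> j; j \<le> m\<rbrakk> \<Longrightarrow> g i \<le> g j" "\<And>j. j \<le> m \<Longrightarrow> g j \<le> n"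
  using gA by (auto simp: Delta_arr)

lemma g'_le [simp]: "\<And>i j. \<lbrakk>i \<le> j; j \<le> k\<rbrakk> \<Longrightarrow> g' i \<le> g' j" "\<And>j. j \<le> k \<Longrightarrow> g' j \<le> p"
  using g'A by (auto simp: Delta_arr)

text \<open>\<open>f'\<close> and \<open>g'\<close> are jointly surjective, so a condition on all
  steps of a filtration indexed by [p] splits into a condition over [k] and one over [n].\<close>

lemma p_cases:
  assumes "j \<le> p"
  obtains (out) i where "i \<le> k" "j = g' i" | (mid) i where "i \<le> n" "j = a + i"
proof -
  consider "j < a" | "a \<le> j" "j \<le> a + n" | "a + n < j" by linarith
  then show thesis
  proof cases
    case 1
    then show ?thesis using out[of j] g'_lo[of j] am by simp
  next
    case 2
    then show ?thesis using mid[of "j - a"] by simp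
  next
    case 3
    then show ?thesis using out[of "j + m - n"] g'_hi[of "j + m - n"] assms am pm by simp
  qed
qed

lemma square_eq: "compose {0..m} f' g = compose {0..m} g' f"
  by (auto simp: compose_def)

lemma restr_square:
  assumes "is_functor (Ar {0..p}) C F"
  shows "restr m (restr n F f') g = restr m (restr k F g') f"
  using restr_comp[OF assms f'A gA] restr_comp[OF assms g'A fA] square_eq by simp

lemma restr_trans_square: "restr_trans m (restr_trans n t f') g = restr_trans m (restr_trans k t g') f"
  by (rule trans[OF restr_trans_comp[OF gA] trans[OF _ restr_trans_comp[OF fA, symmetric]]]) (simp only: square_eq)

text \<open>As \<open>g'\<close> preserves end-points, \<open>\<beta> (0, k)\<close> already goes
  from F (0, p) to G (0, p), and \<open>\<gamma>\<close> is its extension. Steps of the form g' i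
  are respected by naturality of \<open>\<beta>\<close>; those inside the inserted interval are
  respected because \<open>eq\<close> leads from \<open>\<beta>\<close> to
  \<open>\<alpha>\<close>.\<close>

lemma nattrans_glue:
  assumes F: "gap_complex {0..p} C F" and G: "gap_complex {0..p} C G"
    and al: "is_nattrans (Ar {0..n}) C (restr n F f', restr n G f', \<alpha>)"
    and be: "is_nattrans (Ar {0..k}) C (restr k F g', restr k G g', \<beta>)"
    and eq: "\<alpha> (0, n) = \<beta> (a, a + m)"
  obtains \<gamma> where "is_nattrans (Ar {0..p}) C (F, G, \<gamma>)" "restr_trans n \<gamma> f' = \<alpha>" "restr_trans k \<gamma> g' = \<beta>"
proof -
  interpret P: gap_pair C p F G by (rule gap_pairI[OF F G])
  interpret N: gap_pair C n "restr n F f'" "restr n G f'"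
    by (rule gap_pairI[OF gap_complex_restr[OF F f'A] gap_complex_restr[OF G f'A]])
  interpret K: gap_pair C k "restr k F g'" "restr k G g'"
    by (rule gap_pairI[OF gap_complex_restr[OF F g'A] gap_complex_restr[OF G g'A]])
  have al' [simp]: "\<alpha> (i, j) \<in> Arr C" "Dom C (\<alpha> (i, j)) = fobj F (a + i, a + j)"
    "Cod C (\<alpha> (i, j)) = fobj G (a + i, a + j)" if "i \<le> j" "j \<le> n" for i j
    using is_nattransD(3-5)[OF al, of "(i, j)"] that by auto
  have be' [simp]: "\<beta> (i, j) \<in> Arr C" "Dom C (\<beta> (i, j)) = fobj F (g' i, g' j)"
    "Cod C (\<beta> (i, j)) = fobj G (g' i, g' j)" if "i \<le> j" "j \<le> k" for i j
    using is_nattransD(3-5)[OF be, of "(i, j)"] that by auto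
  have aln: "\<alpha> (r, s) \<cdot> amap F (a + i) (a + j) (a + r) (a + s) = amap G (a + i) (a + j) (a + r) (a + s) \<cdot> \<alpha> (i, j)"
    if "i \<le> r" "j \<le> s" "i \<le> j" "r \<le> s" "s \<le> n" for i j r s
    using is_nattransD(6)[OF al, of "((i, j), (r, s))"] that by simp
  have ben: "\<beta> (r, s) \<cdot> amap F (g' i) (g' j) (g' r) (g' s) = amap G (g' i) (g' j) (g' r) (g' s) \<cdot> \<beta> (i, j)"
    if "i \<le> r" "j \<le> s" "i \<le> j" "r \<le> s" "s \<le> k" for i j r s
    using is_nattransD(6)[OF be, of "((i, j), (r, s))"] that by simp
  have "zero_arrow C (amap G 0 p j p \<cdot> \<beta> (0, k) \<cdot> amap F 0 j 0 p)" if "j \<le> p" for j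
    using that
  proof (cases rule: p_cases)
    case (out i)
    have "\<beta> (0, k) \<cdot> amap F 0 j 0 p = amap G 0 j 0 p \<cdot> \<beta> (0, i)"
      using ben[of 0 0 i k] out by simp
    moreover have "zero_arrow C (amap G 0 j j p \<cdot> \<beta> (0, i))"
      by (rule zero_cmp_right[OF P.G.zero_amap]) (use out in auto)
    ultimately show ?thesis using out that by simp
  next
    case (mid i)
    \<comment> \<open>The composite is moved into the quotients F (a, a + n) and G (a, a + n), where
      the arrow is \<open>\<beta> (a, a + m)\<close>, that is \<open>\<alpha> (0, n)\<close>;
      naturality then replaces it by \<open>\<alpha> (i, n)\<close>. What stands before it is F (0,
      j) -> F (j, a + n), a zero arrow.\<close>
    have "amap G 0 p j p \<cdot> \<beta> (0, k) \<cdot> amap F 0 j 0 p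
        = amap G 0 p j p \<cdot> (\<beta> (0, k) \<cdot> amap F 0 (a + n) 0 p) \<cdot> amap F 0 j 0 (a + n)"
      using mid by simp
    also have "\<dots> = amap G 0 p j p \<cdot> (amap G 0 (a + n) 0 p \<cdot> \<beta> (0, a + m)) \<cdot> amap F 0 j 0 (a + n)"
      using ben[of 0 0 "a + m" k] am by simp
    also have "\<dots> = amap G a (a + n) j p \<cdot> (amap G 0 (a + n) a (a + n) \<cdot> \<beta> (0, a + m)) \<cdot> amap F 0 j 0 (a + n)"
      using mid am by simp
    also have "\<dots> = amap G a (a + n) j p \<cdot> (\<beta> (a, a + m) \<cdot> amap F 0 (a + n) a (a + n)) \<cdot> amap F 0 j 0 (a + n)"
      using ben[of 0 a "a + m" "a + m"] am by simp
    also have "\<dots> = amap G j (a + n) j p \<cdot> (amap G a (a + n) j (a + n) \<cdot> \<alpha> (0, n)) \<cdot> amap F 0 j a (a + n)"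
      unfolding eq[symmetric] using mid am by simp
    also have "\<dots> = amap G j (a + n) j p \<cdot> (\<alpha> (i, n) \<cdot> amap F a (a + n) j (a + n)) \<cdot> amap F 0 j a (a + n)"
      using aln[of 0 i n n] mid by simp
    also have "\<dots> = (amap G j (a + n) j p \<cdot> \<alpha> (i, n)) \<cdot> amap F 0 j j (a + n)"
      using mid by simp
    finally show ?thesis
      using zero_cmp_left[OF P.F.zero_amap[of 0 j j "a + n"], of "amap G j (a + n) j p \<cdot> \<alpha> (i, n)"] mid by simp
  qed
  then obtain \<gamma> where \<gamma>: "is_nattrans (Ar {0..p}) C (F, G, \<gamma>)" "\<gamma> (0, p) = \<beta> (0, k)"
    by (rule P.nattrans_exists[of "\<beta> (0, k)", rotated 3]) auto
  have K: "restr_trans k \<gamma> g' = \<beta>"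
    by (rule K.nattrans_unique[OF nattrans_restr[OF \<gamma>(1) g'A] be]) (simp add: \<gamma>(2))
  have "\<gamma> (a, a + n) = \<beta> (a, a + m)"
    using am unfolding K[symmetric] by simp
  then have "restr_trans n \<gamma> f' = \<alpha>"
    by (intro N.nattrans_unique[OF nattrans_restr[OF \<gamma>(1) f'A] al]) (simp add: eq)
  with \<gamma> K that show thesis by blast
qed

text \<open>\<open>g'\<close> sends (0, k) to (0, p), and the component there determines the
  transformation; the part over [k] alone is enough.\<close>

lemma nattrans_glue_unique:
  assumes F: "gap_complex {0..p} C F" and G: "gap_complex {0..p} C G"
    and "is_nattrans (Ar {0..p}) C (F, G, \<gamma>)" "is_nattrans (Ar {0..p}) C (F, G, \<delta>)"
    and eq: "restr_trans k \<gamma> g' = restr_trans k \<delta> g'"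
  shows "\<gamma> = \<delta>"
proof -
  interpret P: gap_pair C p F G by (rule gap_pairI[OF F G])
  have "restr_trans k \<gamma> g' (0, k) = restr_trans k \<delta> g' (0, k)" using eq by simp
  then show ?thesis by (intro P.nattrans_unique[OF assms(3,4)]) simp
qed

text \<open>The inverses of \<open>\<alpha>\<close> and \<open>\<beta>\<close> satisfy the gluing
  condition as well, by cancelling the isomorphism \<open>\<alpha> (0, n)\<close>, so they glue to a
  transformation \<open>\<delta>\<close>, which is inverse to \<open>\<gamma>\<close> because it is
  so at (0, p).\<close>

lemma S_arr_glue:
  assumes F: "gap_complex {0..p} C F" and G: "gap_complex {0..p} C G"
    and al: "(restr n F f', restr n G f', \<alpha>) \<in> Arr (S_groupoid C n)"
    and be: "(restr k F g', restr k G g', \<beta>) \<in> Arr (S_groupoid C k)"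
    and eq: "\<alpha> (0, n) = \<beta> (a, a + m)"
  obtains \<gamma> where "(F, G, \<gamma>) \<in> Arr (S_groupoid C p)" "restr_trans n \<gamma> f' = \<alpha>" "restr_trans k \<gamma> g' = \<beta>"
proof -
  note al' = is_nattransD[OF S_arrD(3)[OF al]]
  obtain \<gamma> where \<gamma>: "is_nattrans (Ar {0..p}) C (F, G, \<gamma>)" "restr_trans n \<gamma> f' = \<alpha>" "restr_trans k \<gamma> g' = \<beta>"
    using nattrans_glue[OF F G S_arrD(3)[OF al] S_arrD(3)[OF be] eq] by blast
  obtain \<alpha>' where \<alpha>': "(restr n G f', restr n F f', \<alpha>') \<in> Arr (S_groupoid C n)"
    "\<And>i j. \<lbrakk>i \<le> j; j \<le> n\<rbrakk> \<Longrightarrow> \<alpha>' (i, j) \<cdot> \<alpha> (i, j) = Id C (fobj (restr n F f') (i, j)) \<and>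
        \<alpha> (i, j) \<cdot> \<alpha>' (i, j) = Id C (fobj (restr n G f') (i, j))"
    using al by (rule S_arr_inverse) blast
  obtain \<beta>' where \<beta>': "(restr k G g', restr k F g', \<beta>') \<in> Arr (S_groupoid C k)"
    "\<And>i j. \<lbrakk>i \<le> j; j \<le> k\<rbrakk> \<Longrightarrow> \<beta>' (i, j) \<cdot> \<beta> (i, j) = Id C (fobj (restr k F g') (i, j)) \<and>
        \<beta> (i, j) \<cdot> \<beta>' (i, j) = Id C (fobj (restr k G g') (i, j))"
    using be by (rule S_arr_inverse) blast
  have "\<alpha>' (0, n) = \<beta>' (a, a + m)"
  proof (rule epi_cancel[OF iso_epi[OF S_arr_iso[OF abelian_category_axioms al]]])
    show "\<alpha>' (0, n) \<cdot> \<alpha> (0, n) = \<beta>' (a, a + m) \<cdot> \<alpha> (0, n)"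
      using \<alpha>'(2)[of 0 n] \<beta>'(2)[of a "a + m"] am unfolding eq by simp
  qed (use al'(3-5)[of "(0, n)"] is_nattransD(3-5)[OF S_arrD(3)[OF \<alpha>'(1)], of "(0, n)"]
      is_nattransD(3-5)[OF S_arrD(3)[OF \<beta>'(1)], of "(a, a + m)"] am in auto)
  then obtain \<delta> where \<delta>: "is_nattrans (Ar {0..p}) C (G, F, \<delta>)" "restr_trans n \<delta> f' = \<alpha>'" "restr_trans k \<delta> g' = \<beta>'"
    using nattrans_glue[OF G F S_arrD(3)[OF \<alpha>'(1)] S_arrD(3)[OF \<beta>'(1)]] by blast
  have "(F, G, \<gamma>) \<in> Arr (S_groupoid C p)"
    using \<beta>'(2)[of 0 k] unfolding \<delta>(3)[symmetric] \<gamma>(3)[symmetric]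
    by (intro S_arrI[OF F G \<gamma>(1) \<delta>(1)]) auto
  with \<gamma> that show thesis by blast
qed

end

text \<open>Gluing \<open>U\<close> and \<open>V\<close> along \<open>\<phi>\<close>: between \<open>V (0, a)\<close> and \<open>V (0, a + m)\<close> the filtration of
  \<open>V (0, k)\<close> is refined by the preimages of the filtration of \<open>U (0, n)\<close>, which is identified with
  \<open>V (a, a + m)\<close> by \<open>\<phi>\<close>.\<close>

locale gluing = segal_square C m n k p a g f f' g' + U: gap C n U + V: gap C k V
  for C :: "('o, 'm) cat" and m n k p a g f f' g' U V +
  fixes \<phi> \<psi>
  assumes phi: "is_nattrans (Ar {0..m}) C (restr m U g, restr m V f, \<phi>)"
    and psi: "is_nattrans (Ar {0..m}) C (restr m V f, restr m U g, \<psi>)"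
    and psi_phi [simp]: "\<And>i j. \<lbrakk>i \<le> j; j \<le> m\<rbrakk> \<Longrightarrow> Comp C (\<psi> (i, j)) (\<phi> (i, j)) = Id C (fobj U (g i, g j))"
    and phi_psi [simp]: "\<And>i j. \<lbrakk>i \<le> j; j \<le> m\<rbrakk> \<Longrightarrow> Comp C (\<phi> (i, j)) (\<psi> (i, j)) = Id C (fobj V (a + i, a + j))"
begin

lemma below_a_le [simp]: "j < a \<Longrightarrow> j \<le> k" "j < a \<Longrightarrow> j \<le> p"
  using bounds(4,5) by linarith+

lemma phi_simps [simp]:
  assumes "i \<le> j" "j \<le> m"
  shows "\<phi> (i, j) \<in> Arr C" "Dom C (\<phi> (i, j)) = fobj U (g i, g j)" "Cod C (\<phi> (i, j)) = fobj V (a + i, a + j)"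
    "\<psi> (i, j) \<in> Arr C" "Dom C (\<psi> (i, j)) = fobj V (a + i, a + j)" "Cod C (\<psi> (i, j)) = fobj U (g i, g j)"
  using is_nattransD(3-5)[OF phi, of "(i, j)"] is_nattransD(3-5)[OF psi, of "(i, j)"] assms by auto

lemma psi_phi_ext [simp]:
  assumes "i \<le> j" "j \<le> m" "x \<in> Arr C"
  shows "Cod C x = fobj U (g i, g j) \<Longrightarrow> \<psi> (i, j) \<cdot> \<phi> (i, j) \<cdot> x = x"
    "Cod C x = fobj V (a + i, a + j) \<Longrightarrow> \<phi> (i, j) \<cdot> \<psi> (i, j) \<cdot> x = x"
  using assms by (simp_all flip: assoc)

lemma phi_iso: "\<lbrakk>i \<le> j; j \<le> m\<rbrakk> \<Longrightarrow> is_iso C (\<phi> (i, j))" "\<lbrakk>i \<le> j; j \<le> m\<rbrakk> \<Longrightarrow> is_iso C (\<psi> (i, j))"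
  by (rule isoI[of _ "fobj U (g i, g j)" "fobj V (a + i, a + j)" "\<psi> (i, j)"]; simp add: homs_iff)
    (rule isoI[of _ "fobj V (a + i, a + j)" "fobj U (g i, g j)" "\<phi> (i, j)"]; simp add: homs_iff)

text \<open>The composite V (0, a + m) -> V (a, a + m) -> U (0, n) -> U (j, n), whose middle arrow
  is an isomorphism. Its kernel is the preimage of U (0, j) in V (0, a + m).\<close>

definition "\<kappa> j = amap U 0 n j n \<cdot> \<psi> (0, m) \<cdot> amap V 0 (a + m) a (a + m)"

lemma kap_simps [simp]:
  assumes "j \<le> n"
  shows "\<kappa> j \<in> Arr C" "Dom C (\<kappa> j) = fobj V (0, a + m)" "Cod C (\<kappa> j) = fobj U (j, n)"
  using assms am by (simp_all add: \<kappa>_def)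

lemma psi_V_epi: "is_epi C (\<psi> (0, m) \<cdot> amap V 0 (a + m) a (a + m))"
  by (rule epi_cmp[OF V.gapD(2) iso_epi[OF phi_iso(2)]]) (use am in auto)

lemma kap_epi: "j \<le> n \<Longrightarrow> is_epi C (\<kappa> j)"
  unfolding \<kappa>_def by (rule epi_cmp[OF psi_V_epi U.gapD(2)]) (use am in auto)

text \<open>At positions coming from [m] nothing new is inserted: up to the isomorphism
  \<open>\<psi> (i, m)\<close> the arrow is the quotient of V (0, a + m) by V (0, a + i).\<close>

lemma kap_g:
  assumes "i \<le> m"
  shows "\<kappa> (g i) = \<psi> (i, m) \<cdot> amap V 0 (a + m) (a + i) (a + m)"
proof -
  have "amap U 0 n (g i) n \<cdot> \<psi> (0, m) = \<psi> (i, m) \<cdot> amap V a (a + m) (a + i) (a + m)"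
    using is_nattransD(6)[OF psi, of "((0, m), (i, m))"] assms by simp
  then have "(amap U 0 n (g i) n \<cdot> \<psi> (0, m)) \<cdot> amap V 0 (a + m) a (a + m)
      = (\<psi> (i, m) \<cdot> amap V a (a + m) (a + i) (a + m)) \<cdot> amap V 0 (a + m) a (a + m)" by simp
  then show ?thesis using assms am by (simp add: \<kappa>_def)
qed

lemma kap_le: "\<lbrakk>i \<le> j; j \<le> n\<rbrakk> \<Longrightarrow> \<kappa> j = amap U i n j n \<cdot> \<kappa> i"
  using am by (simp add: \<kappa>_def)

text \<open>The special choice of the kernel for \<open>j = 0\<close> makes \<open>E 0\<close> a zero object when \<open>a = 0\<close>.\<close>

definition "\<iota> j = (if j = 0 then amap V 0 a 0 (a + m) else SOME l. is_kernel C l (\<kappa> j))"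

lemma iota_kernel:
  assumes "j \<le> n" shows "is_kernel C (\<iota> j) (\<kappa> j)"
proof (cases "j = 0")
  case True
  have "is_kernel C (amap V 0 a 0 (a + m)) (\<psi> (0, m) \<cdot> amap V 0 (a + m) a (a + m))"
    by (rule kernel_of_mono_cmp[OF V.amap_kernel iso_mono[OF phi_iso(2)]]) (use am in auto)
  then show ?thesis using True am by (simp add: \<iota>_def \<kappa>_def)
next
  case False
  then show ?thesis unfolding \<iota>_def using someI_ex[OF ex_kernel[OF kap_simps(1)[OF assms]]] by simp
qed

lemma iota_simps [simp]:
  assumes "j \<le> n"
  shows "\<iota> j \<in> Arr C" "Cod C (\<iota> j) = fobj V (0, a + m)"
  using kernelD(2,3)[OF iota_kernel[OF assms]] assms by simp_all

text \<open>The inclusions of the refined filtration of V (0, k). For a + n < j the index j + m - n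
  is the point of [k] that \<open>g'\<close> sends to j. At the lower end of the middle branch,
  \<open>\<iota> 0\<close> is the inclusion of V (0, a); at the upper end, \<open>\<iota> n\<close>
  is a kernel of an arrow into the zero object U (n, n).\<close>

definition "E j = (if j < a then amap V 0 j 0 k
  else if j \<le> a + n then amap V 0 (a + m) 0 k \<cdot> \<iota> (j - a) else amap V 0 (j + m - n) 0 k)"

lemma E_at:
  "j < a \<Longrightarrow> E j = amap V 0 j 0 k"
  "j \<le> n \<Longrightarrow> E (a + j) = amap V 0 (a + m) 0 k \<cdot> \<iota> j"
  "a + n < j \<Longrightarrow> E j = amap V 0 (j + m - n) 0 k"
  by (simp_all add: E_def)

lemma E_cases:
  assumes "j \<le> p"
  obtains "j < a" | i where "i \<le> n" "j = a + i" | "a + n < j" "j + m - n \<le> k" "a + m \<le> j + m - n"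
proof -
  consider "j < a" | "a \<le> j" "j \<le> a + n" | "a + n < j" by linarith
  then show thesis
  proof cases
    case 2
    then show ?thesis using that(2)[of "j - a"] by simp
  qed (use that am pm assms in auto)
qed

lemma E_simps [simp]:
  assumes "j \<le> p"
  shows "E j \<in> Arr C" "Cod C (E j) = fobj V (0, k)"
proof -
  have "E j \<in> Arr C \<and> Cod C (E j) = fobj V (0, k)"
    using assms
  proof (cases rule: E_cases)
    case (2 i)
    then show ?thesis using am by (simp add: E_at)
  qed (use am in \<open>simp_all add: E_at\<close>)
  then show "E j \<in> Arr C" "Cod C (E j) = fobj V (0, k)" by auto
qed

lemma E_mono:
  assumes "j \<le> p" shows "is_mono C (E j)"
  using assms
proof (cases rule: E_cases)
  case (2 i)
  then show ?thesis
    using am by (auto simp: E_at intro!: mono_cmp[OF kernelD(5)[OF iota_kernel] V.gapD(1)])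
qed (use am V.gapD(1) in \<open>auto simp: E_at\<close>)

text \<open>An arrow into V (0, a + m) factors through the middle step a + j' as soon as
  \<open>\<kappa> j'\<close> kills it; this is the local fact \<open>*\<close>. Steps outside the
  middle are entries of \<open>V\<close>, and their inclusions come from \<open>V\<close>.\<close>

lemma E_le:
  assumes ij: "i \<le> j" "j \<le> p"
  shows "\<exists>u. u \<in> Arr C \<and> Dom C u = Dom C (E i) \<and> Cod C u = Dom C (E j) \<and> E j \<cdot> u = E i"
proof -
  have ip: "i \<le> p" using ij by simp
  show ?thesis
    using ij(2)
  proof (cases rule: E_cases)
    case 1
    then show ?thesis using ij am by (intro exI[of _ "amap V 0 i 0 j"]) (simp add: E_at)
  next
    case j: (2 j')
    have *: "\<exists>u. u \<in> Arr C \<and> Dom C u = Dom C x \<and> Cod C u = Dom C (E j) \<and> E j \<cdot> u = amap V 0 (a + m) 0 k \<cdot> x"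
      if x: "x \<in> Arr C" "Cod C x = fobj V (0, a + m)" "zero_arrow C (\<kappa> j' \<cdot> x)" for x
    proof -
      obtain u where "u \<in> Arr C" "Dom C u = Dom C x" "Cod C u = Dom C (\<iota> j')" "\<iota> j' \<cdot> u = x"
        using kernelD(6)[OF iota_kernel[OF j(1)] x(1)] x j by auto
      then show ?thesis using j am by (intro exI[of _ u]) (simp add: E_at)
    qed
    show ?thesis
      using ip
    proof (cases rule: E_cases)
      case 1
      \<comment> \<open>A step before a already vanishes in V (a, a + m).\<close>
      have "zero_arrow C ((amap U 0 n j' n \<cdot> \<psi> (0, m)) \<cdot> amap V 0 i a (a + m))"
        by (rule zero_cmp_left[OF V.zero_amap]) (use j 1 am in auto)
      then show ?thesis using *[of "amap V 0 i 0 (a + m)"] 1 j am by (simp add: E_at \<kappa>_def)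
    next
      case i: (2 i')
      have "zero_arrow C (amap U i' n j' n \<cdot> \<kappa> i' \<cdot> \<iota> i')"
        by (rule zero_cmp_left[OF kernelD(4)[OF iota_kernel]]) (use i j ij in auto)
      then show ?thesis using *[of "\<iota> i'"] i j ij am kap_le[of i' j'] by (simp add: E_at)
    next
      case 3
      then show ?thesis using j ij by simp
    qed
  next
    case j: 3
    show ?thesis
      using ip
    proof (cases rule: E_cases)
      case 1
      then show ?thesis using j am by (intro exI[of _ "amap V 0 i 0 (j + m - n)"]) (simp add: E_at)
    next
      case i: (2 i')
      then show ?thesis using j am
        by (intro exI[of _ "amap V 0 (a + m) 0 (j + m - n) \<cdot> \<iota> i'"]) (simp add: E_at)
    next
      case 3
      then have "i + m - n \<le> j + m - n" using ij by simp
      then show ?thesis using j 3 am by (intro exI[of _ "amap V 0 (i + m - n) 0 (j + m - n)"]) (simp add: E_at)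
    qed
  qed
qed

lemma E_zero: "zero_object C (Dom C (E 0))"
proof (cases "a = 0")
  case True
  have "E 0 = amap V 0 (a + m) 0 k \<cdot> \<iota> 0" using E_at(2)[of 0] True by simp
  moreover have "Dom C (amap V 0 (a + m) 0 k \<cdot> \<iota> 0) = fobj V (0, a)" by (simp add: \<iota>_def)
  ultimately show ?thesis using V.gapD(3)[of 0 0 0] True by simp
next
  case False
  then show ?thesis using V.gapD(3)[of 0 0 0] by (simp add: E_at)
qed

lemma g'_cases:
  assumes "j \<le> k"
  obtains "j < a" "g' j = j" | i where "i \<le> m" "j = a + i" "g' j = a + g i"
    | "a + m < j" "a + n < g' j" "g' j + m - n = j"
proof -
  consider "j < a" | "a \<le> j" "j \<le> a + m" | "a + m < j" by linarith
  then show thesis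
  proof cases
    case 1
    then show ?thesis using that(1) g'_lo[of j] by simp
  next
    case 2
    then show ?thesis using that(2)[of "j - a"] g'_mid[of "j - a"] by simp
  next
    case 3
    then have "g' j + m = j + n" using g'_hi[of j] assms by simp
    then show ?thesis using that(3) 3 by linarith
  qed
qed

text \<open>\<open>E (g' j)\<close> and V (0, j) are the same subobject of V (0, k). This is one
  inclusion; \<open>E_le_V\<close> is the other, as a vanishing composite. Equality of arrows cannot
  be expected, since \<open>\<iota> (g i)\<close> is in general a chosen kernel.\<close>

lemma V_le_E:
  assumes "j \<le> k"
  obtains u where "u \<in> Arr C" "Dom C u = fobj V (0, j)" "Cod C u = Dom C (E (g' j))" "E (g' j) \<cdot> u = amap V 0 j 0 k"
  using assms
proof (cases rule: g'_cases)
  case 1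
  then show ?thesis using that[of "Id C (fobj V (0, j))"] assms by (simp add: E_at)
next
  case (2 i)
  have "zero_arrow C (\<psi> (i, m) \<cdot> amap V 0 j j (a + m))"
    by (rule zero_cmp_left[OF V.zero_amap]) (use 2 am in auto)
  then obtain u where "u \<in> Arr C" "Dom C u = fobj V (0, j)" "Cod C u = Dom C (\<iota> (g i))"
      "\<iota> (g i) \<cdot> u = amap V 0 j 0 (a + m)"
    using kernelD(6)[OF iota_kernel[of "g i"], of "amap V 0 j 0 (a + m)"] 2 am kap_g[of i] by auto
  then show ?thesis using that[of u] 2 am by (simp add: E_at)
next
  case 3
  then show ?thesis using that[of "Id C (fobj V (0, j))"] assms by (simp add: E_at)
qed

lemma E_le_V:
  assumes "j \<le> k" shows "zero_arrow C (amap V 0 k j k \<cdot> E (g' j))"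
  using assms
proof (cases rule: g'_cases)
  case 1
  then show ?thesis using assms V.zero_amap[of 0 j j k] by (simp add: E_at)
next
  case (2 i)
  \<comment> \<open>By \<open>kap_g\<close>, \<open>\<phi> (i, m) \<cdot> \<kappa> (g i)\<close> is
    the quotient V (0, a + m) -> V (a + i, a + m), and \<open>\<iota> (g i)\<close> is the kernel of
    \<open>\<kappa> (g i)\<close>.\<close>
  have "zero_arrow C ((amap V j (a + m) j k \<cdot> \<phi> (i, m)) \<cdot> \<kappa> (g i) \<cdot> \<iota> (g i))"
    by (rule zero_cmp_left[OF kernelD(4)[OF iota_kernel]]) (use 2 am in auto)
  then show ?thesis using 2 am kap_g[of i] by (simp add: E_at)
next
  case 3
  then show ?thesis using assms V.zero_amap[of 0 j j k] by (simp add: E_at)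
qed

text \<open>\<open>F\<close> is the complex of the filtration \<open>E\<close>, with an isomorphism
  \<open>t\<close> from F (0, p) to V (0, k). \<open>\<beta>\<close> extends \<open>t\<close>, and
  \<open>\<alpha>\<close> extends \<open>s\<close>, the arrow that the required equation forces on F
  (a, a + n). Both are invertible because the inverse arrows \<open>t'\<close> and \<open>s'\<close>
  respect the filtrations too.\<close>

lemma ex_glued:
  obtains F \<alpha> \<beta> where "gap_complex {0..p} C F" "(restr n F f', U, \<alpha>) \<in> Arr (S_groupoid C n)"
    "(restr k F g', V, \<beta>) \<in> Arr (S_groupoid C k)" "\<phi> (0, m) \<cdot> \<alpha> (0, n) = \<beta> (a, a + m)"
proof -
  obtain F r where F: "gap_complex {0..p} C F"
    and r0: "\<And>j. j \<le> p \<Longrightarrow> is_iso C (r j) \<and> Dom C (r j) = fobj F (0, j) \<and> Cod C (r j) = Dom C (E j)"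
    and r1: "\<And>i j. \<lbrakk>i \<le> j; j \<le> p\<rbrakk> \<Longrightarrow> E j \<cdot> r j \<cdot> amap F 0 i 0 j = E i \<cdot> r i"
    by (rule filtration_gap_complex[of p E "fobj V (0, k)", OF _ _ _ E_zero])
      ((rule E_mono E_simps(2) E_le; assumption)+, blast)
  interpret F: gap C p F by unfold_locales (rule F)
  have r [simp]: "r j \<in> Arr C" "Dom C (r j) = fobj F (0, j)" "Cod C (r j) = Dom C (E j)"
    and riso: "is_iso C (r j)" if "j \<le> p" for j
    using r0[OF that] mono_arr[OF iso_mono, of "r j"] by simp_all
  have "\<exists>s. s \<in> Arr C \<and> Dom C s = Dom C (E j) \<and> Cod C s = fobj F (0, j) \<and> r j \<cdot> s = Id C (Dom C (E j))"
    if "j \<le> p" for j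
    by (rule isoE[OF riso[OF that]]) (use that in auto)
  then obtain r' where "\<And>j. j \<le> p \<Longrightarrow> r' j \<in> Arr C \<and> Dom C (r' j) = Dom C (E j) \<and>
      Cod C (r' j) = fobj F (0, j) \<and> r j \<cdot> r' j = Id C (Dom C (E j))" by metis
  then have r' [simp]: "r' j \<in> Arr C" "Dom C (r' j) = Dom C (E j)" "Cod C (r' j) = fobj F (0, j)"
    "r j \<cdot> r' j = Id C (Dom C (E j))" if "j \<le> p" for j using that by auto
  define t where "t = E p \<cdot> r p"
  have t [simp]: "t \<in> Arr C" "Dom C t = fobj F (0, p)" "Cod C t = fobj V (0, k)"
    by (simp_all add: t_def)
  have tE: "t \<cdot> amap F 0 j 0 p = E j \<cdot> r j" if "j \<le> p" for j
    using r1[OF that] that by (simp add: t_def)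
  \<comment> \<open>As g' k = p, all of V (0, k) factors through step p, so the mono
    \<open>E p\<close> splits. It need not be an identity: for p = a + n it is built from the kernel
    \<open>\<iota> n\<close>.\<close>
  obtain u where u: "u \<in> Arr C" "Dom C u = fobj V (0, k)" "Cod C u = Dom C (E p)" "E p \<cdot> u = Id C (fobj V (0, k))"
    using V_le_E[of k] by auto
  have "is_iso C (E p)" by (rule mono_split_iso[OF E_mono, of p u]) (use u in auto)
  then have "is_iso C t" unfolding t_def by (intro iso_cmp riso) auto
  obtain t' where t' [simp]: "t' \<in> Arr C" "Dom C t' = fobj V (0, k)" "Cod C t' = fobj F (0, p)"
    "t' \<cdot> t = Id C (fobj F (0, p))" "t \<cdot> t' = Id C (fobj V (0, k))"
    by (rule isoE[OF \<open>is_iso C t\<close>]) auto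
  have t't: "t' \<cdot> t \<cdot> y = y" if "y \<in> Arr C" "Cod C y = fobj F (0, p)" for y
    using that by (simp flip: assoc)
  have rk: "gap_complex {0..k} C (restr k F g')" and rn: "gap_complex {0..n} C (restr n F f')"
    using gap_complex_restr[OF F g'A] gap_complex_restr[OF F f'A] by auto
  interpret K: gap_pair C k "restr k F g'" V by (rule gap_pairI[OF rk V.gap_complex])
  interpret K': gap_pair C k V "restr k F g'" by (rule gap_pairI[OF V.gap_complex rk])
  interpret N: gap_pair C n "restr n F f'" U by (rule gap_pairI[OF rn U.gap_complex])
  interpret N': gap_pair C n U "restr n F f'" by (rule gap_pairI[OF U.gap_complex rn])
  have "zero_arrow C (amap V 0 k j k \<cdot> t \<cdot> amap F 0 (g' j) 0 p)" if "j \<le> k" for j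
    using zero_cmp_right[OF E_le_V[OF that], of "r (g' j)"] that tE[of "g' j"] by simp
  then have "zero_arrow C (amap V 0 k j k \<cdot> t \<cdot> amap (restr k F g') 0 j 0 k)" if "j \<le> k" for j
    using that by simp
  then obtain \<beta> where \<beta>: "is_nattrans (Ar {0..k}) C (restr k F g', V, \<beta>)" "\<beta> (0, k) = t"
    by (rule K.nattrans_exists[of t, rotated 3]) auto
  \<comment> \<open>V (0, j) is factored through \<open>E (g' j)\<close> and brought to
    \<open>F\<close> by \<open>r'\<close>; hence \<open>t'\<close> carries it into F (0, g'
    j).\<close>
  have "zero_arrow C (amap F 0 p (g' j) p \<cdot> t' \<cdot> amap V 0 j 0 k)" if j: "j \<le> k" for j
  proof -
    obtain u where u: "u \<in> Arr C" "Dom C u = fobj V (0, j)" "Cod C u = Dom C (E (g' j))"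
      "E (g' j) \<cdot> u = amap V 0 j 0 k" using V_le_E[OF j] by blast
    have "r (g' j) \<cdot> r' (g' j) \<cdot> u = u" using u j by (simp flip: assoc)
    then have "amap V 0 j 0 k = (E (g' j) \<cdot> r (g' j)) \<cdot> r' (g' j) \<cdot> u" using u j by simp
    also have "\<dots> = (t \<cdot> amap F 0 (g' j) 0 p) \<cdot> r' (g' j) \<cdot> u"
      using tE[of "g' j"] j by simp
    finally have "t' \<cdot> amap V 0 j 0 k = amap F 0 (g' j) 0 p \<cdot> r' (g' j) \<cdot> u"
      using u(1-3) j t't by simp
    then have "amap F 0 p (g' j) p \<cdot> t' \<cdot> amap V 0 j 0 k = amap F 0 (g' j) (g' j) p \<cdot> r' (g' j) \<cdot> u"
      using u(1-3) j by simp
    moreover have "zero_arrow C \<dots>" by (rule zero_cmp_right[OF F.zero_amap]) (use j u in auto)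
    ultimately show ?thesis by simp
  qed
  then have "zero_arrow C (amap (restr k F g') 0 k j k \<cdot> t' \<cdot> amap V 0 j 0 k)" if "j \<le> k" for j
    using that by simp
  then obtain \<beta>' where \<beta>': "is_nattrans (Ar {0..k}) C (V, restr k F g', \<beta>')" "\<beta>' (0, k) = t'"
    by (rule K'.nattrans_exists[of t', rotated 3]) auto
  have bA: "(restr k F g', V, \<beta>) \<in> Arr (S_groupoid C k)"
    by (rule S_arrI[OF rk V.gap_complex \<beta>(1) \<beta>'(1)]) (simp_all add: \<beta>(2) \<beta>'(2))
  obtain \<beta>'' where b'': "(V, restr k F g', \<beta>'') \<in> Arr (S_groupoid C k)"
    "\<And>i j. \<lbrakk>i \<le> j; j \<le> k\<rbrakk> \<Longrightarrow> \<beta>'' (i, j) \<cdot> \<beta> (i, j) = Id C (fobj (restr k F g') (i, j)) \<and>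
        \<beta> (i, j) \<cdot> \<beta>'' (i, j) = Id C (fobj V (i, j))"
    using bA by (rule S_arr_inverse) blast
  note \<gamma> = S_arrD(3)[OF b''(1)]
  have b [simp]: "\<beta> (i, j) \<in> Arr C" "Dom C (\<beta> (i, j)) = fobj F (g' i, g' j)" "Cod C (\<beta> (i, j)) = fobj V (i, j)"
    "\<beta>'' (i, j) \<in> Arr C" "Dom C (\<beta>'' (i, j)) = fobj V (i, j)" "Cod C (\<beta>'' (i, j)) = fobj F (g' i, g' j)"
    "\<beta>'' (i, j) \<cdot> \<beta> (i, j) = Id C (fobj F (g' i, g' j))" "\<beta> (i, j) \<cdot> \<beta>'' (i, j) = Id C (fobj V (i, j))"
    if "i \<le> j" "j \<le> k" for i j
    using that is_nattransD(3-5)[OF \<beta>(1), of "(i, j)"] is_nattransD(3-5)[OF \<gamma>, of "(i, j)"] b''(2)[OF that] by auto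
  have bn: "\<beta> (r, s) \<cdot> amap F (g' i) (g' j) (g' r) (g' s) = amap V i j r s \<cdot> \<beta> (i, j)"
    "\<beta>'' (r, s) \<cdot> amap V i j r s = amap F (g' i) (g' j) (g' r) (g' s) \<cdot> \<beta>'' (i, j)"
    if "i \<le> r" "j \<le> s" "i \<le> j" "r \<le> s" "s \<le> k" for i j r s
    using is_nattransD(6)[OF \<beta>(1), of "((i, j), (r, s))"] is_nattransD(6)[OF \<gamma>, of "((i, j), (r, s))"] that
    by auto
  have bn0: "\<beta> (a, a + m) \<cdot> amap F 0 (a + n) a (a + n) = amap V 0 (a + m) a (a + m) \<cdot> \<beta> (0, a + m)"
    and bn1: "\<beta>'' (a, a + m) \<cdot> amap V 0 (a + m) a (a + m) = amap F 0 (a + n) a (a + n) \<cdot> \<beta>'' (0, a + m)"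
    using bn[of 0 a "a + m" "a + m"] am by auto
  \<comment> \<open>Under \<open>\<beta> (0, a + m)\<close> the step F (0, a + j) becomes the
    preimage \<open>\<iota> j\<close> of U (0, j); this links the filtration of \<open>F\<close> to
    that of \<open>U\<close>.\<close>
  have bl: "\<beta> (0, a + m) \<cdot> amap F 0 (a + j) 0 (a + n) = \<iota> j \<cdot> r (a + j)" if j: "j \<le> n" for j
  proof (rule mono_cancel[OF V.gapD(1)[of 0 "a + m" k]])
    have "amap V 0 (a + m) 0 k \<cdot> \<beta> (0, a + m) \<cdot> amap F 0 (a + j) 0 (a + n)
        = (amap V 0 (a + m) 0 k \<cdot> \<beta> (0, a + m)) \<cdot> amap F 0 (a + j) 0 (a + n)" using j am by simp
    also have "\<dots> = (t \<cdot> amap F 0 (a + n) 0 p) \<cdot> amap F 0 (a + j) 0 (a + n)"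
      using bn(1)[of 0 0 "a + m" k] am \<beta>(2) by simp
    also have "\<dots> = E (a + j) \<cdot> r (a + j)" using tE[of "a + j"] j by simp
    also have "\<dots> = amap V 0 (a + m) 0 k \<cdot> \<iota> j \<cdot> r (a + j)"
      using j am r(3)[of "a + j"] E_at(2)[of j] by simp
    finally show "amap V 0 (a + m) 0 k \<cdot> \<beta> (0, a + m) \<cdot> amap F 0 (a + j) 0 (a + n)
        = amap V 0 (a + m) 0 k \<cdot> \<iota> j \<cdot> r (a + j)" .
  qed (use j am r(3)[of "a + j"] E_at(2)[of j] in auto)
  have rE: "Cod C (r (a + j)) = Dom C (\<iota> j)" "Dom C (r' (a + j)) = Dom C (\<iota> j)"
    "r (a + j) \<cdot> r' (a + j) = Id C (Dom C (\<iota> j))" if j: "j \<le> n" for j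
    using j am r(3)[of "a + j"] r'(2,4)[of "a + j"] E_at(2)[of j] by auto
  define s where "s = \<psi> (0, m) \<cdot> \<beta> (a, a + m)"
  have s [simp]: "s \<in> Arr C" "Dom C s = fobj F (a, a + n)" "Cod C s = fobj U (0, n)"
    using am by (auto simp: s_def)
  \<comment> \<open>Tested after the epi F (0, a + j) -> F (a, a + j), the composite becomes
    \<open>(\<kappa> j \<cdot> \<iota> j) \<cdot> r (a + j)\<close>, which vanishes.\<close>
  have "zero_arrow C (amap U 0 n j n \<cdot> s \<cdot> amap F a (a + j) a (a + n))" if j: "j \<le> n" for j
  proof (rule epi_zero_cancel[OF F.gapD(2)[of 0 a "a + j"]])
    have "(amap U 0 n j n \<cdot> s \<cdot> amap F a (a + j) a (a + n)) \<cdot> amap F 0 (a + j) a (a + j)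
        = amap U 0 n j n \<cdot> \<psi> (0, m) \<cdot> (\<beta> (a, a + m) \<cdot> amap F 0 (a + n) a (a + n)) \<cdot> amap F 0 (a + j) 0 (a + n)"
      using j am by (simp add: s_def)
    also have "\<dots> = \<kappa> j \<cdot> \<beta> (0, a + m) \<cdot> amap F 0 (a + j) 0 (a + n)"
      unfolding bn0 using j am by (simp add: \<kappa>_def)
    also have "\<dots> = (\<kappa> j \<cdot> \<iota> j) \<cdot> r (a + j)" unfolding bl[OF j] using j rE by simp
    finally show "zero_arrow C ((amap U 0 n j n \<cdot> s \<cdot> amap F a (a + j) a (a + n)) \<cdot> amap F 0 (a + j) a (a + j))"
      using zero_cmp_right[OF kernelD(4)[OF iota_kernel[OF j]], of "r (a + j)"] j rE by simp
  qed (use j am in auto)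
  then have "zero_arrow C (amap U 0 n j n \<cdot> s \<cdot> amap (restr n F f') 0 j 0 n)" if "j \<le> n" for j
    using that by simp
  then obtain \<alpha> where \<alpha>: "is_nattrans (Ar {0..n}) C (restr n F f', U, \<alpha>)" "\<alpha> (0, n) = s"
    by (rule N.nattrans_exists[of s, rotated 3]) auto
  define s' where "s' = \<beta>'' (a, a + m) \<cdot> \<phi> (0, m)"
  have s' [simp]: "s' \<in> Arr C" "Cod C s' = fobj F (a, a + n)" "Dom C s' = fobj U (0, n)"
    using am by (auto simp: s'_def)
  \<comment> \<open>\<open>x\<close> kills the kernel \<open>\<iota> j\<close> of the epi
    \<open>\<kappa> j\<close>, hence equals \<open>w \<cdot> \<kappa> j\<close>. Cancelling the epi
    V (0, a + m) -> U (0, n) shows that \<open>s'\<close> followed by the quotient to F (a + j, a +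
    n) factors through U (j, n), so it vanishes on U (0, j).\<close>
  have "zero_arrow C (amap F a (a + n) (a + j) (a + n) \<cdot> s' \<cdot> amap U 0 j 0 n)" if j: "j \<le> n" for j
  proof -
    define x where "x = amap F 0 (a + n) (a + j) (a + n) \<cdot> \<beta>'' (0, a + m)"
    have x: "x \<in> Arr C" "Dom C x = fobj V (0, a + m)" "Cod C x = fobj F (a + j, a + n)"
      using j am by (auto simp: x_def)
    have "x \<cdot> \<iota> j = x \<cdot> (\<iota> j \<cdot> r (a + j)) \<cdot> r' (a + j)" using j x rE by simp
    also have "\<dots> = amap F 0 (a + j) (a + j) (a + n) \<cdot> r' (a + j)"
    proof -
      have "\<beta>'' (0, a + m) \<cdot> \<beta> (0, a + m) \<cdot> amap F 0 (a + j) 0 (a + n) \<cdot> r' (a + j)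
          = amap F 0 (a + j) 0 (a + n) \<cdot> r' (a + j)"
        using j am by (simp flip: assoc)
      then show ?thesis unfolding bl[OF j, symmetric] using j am by (simp add: x_def)
    qed
    finally have "zero_arrow C (x \<cdot> \<iota> j)"
      using zero_cmp_right[OF F.zero_amap[of 0 "a + j" "a + j" "a + n"], of "r' (a + j)"] j by simp
    then obtain w where w: "w \<in> Arr C" "Dom C w = fobj U (j, n)" "Cod C w = fobj F (a + j, a + n)" "w \<cdot> \<kappa> j = x"
      using epi_factor_kernel[OF kap_epi[OF j] iota_kernel[OF j] x(1)] x j by auto
    have "amap F a (a + n) (a + j) (a + n) \<cdot> s' = w \<cdot> amap U 0 n j n"
    proof (rule epi_cancel[OF psi_V_epi])
      have "(amap F a (a + n) (a + j) (a + n) \<cdot> s') \<cdot> \<psi> (0, m) \<cdot> amap V 0 (a + m) a (a + m)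
          = amap F a (a + n) (a + j) (a + n) \<cdot> \<beta>'' (a, a + m) \<cdot> amap V 0 (a + m) a (a + m)"
        using j am by (simp add: s'_def)
      also have "\<dots> = x" unfolding bn1 using j am by (simp add: x_def)
      also have "\<dots> = (w \<cdot> amap U 0 n j n) \<cdot> \<psi> (0, m) \<cdot> amap V 0 (a + m) a (a + m)"
        unfolding w(4)[symmetric] using w(1-3) j am by (simp add: \<kappa>_def)
      finally show "(amap F a (a + n) (a + j) (a + n) \<cdot> s') \<cdot> \<psi> (0, m) \<cdot> amap V 0 (a + m) a (a + m)
          = (w \<cdot> amap U 0 n j n) \<cdot> \<psi> (0, m) \<cdot> amap V 0 (a + m) a (a + m)" .
    qed (use j am w in auto)
    then have "(amap F a (a + n) (a + j) (a + n) \<cdot> s') \<cdot> amap U 0 j 0 n = (w \<cdot> amap U 0 n j n) \<cdot> amap U 0 j 0 n" by simp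
    then show ?thesis using zero_cmp_left[OF U.zero_amap[of 0 j j n], of w] j w by simp
  qed
  then have "zero_arrow C (amap (restr n F f') 0 n j n \<cdot> s' \<cdot> amap U 0 j 0 n)" if "j \<le> n" for j
    using that by simp
  then obtain \<alpha>' where \<alpha>': "is_nattrans (Ar {0..n}) C (U, restr n F f', \<alpha>')" "\<alpha>' (0, n) = s'"
    by (rule N'.nattrans_exists[of s', rotated 3]) auto
  have ss: "s' \<cdot> s = Id C (fobj F (a, a + n))" "s \<cdot> s' = Id C (fobj U (0, n))"
  proof -
    have bb: "\<beta> (a, a + m) \<cdot> \<beta>'' (a, a + m) \<cdot> \<phi> (0, m) = \<phi> (0, m)"
      using am by (simp flip: assoc)
    show "s' \<cdot> s = Id C (fobj F (a, a + n))" "s \<cdot> s' = Id C (fobj U (0, n))"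
      using am bb by (simp_all add: s_def s'_def)
  qed
  have aA: "(restr n F f', U, \<alpha>) \<in> Arr (S_groupoid C n)"
    by (rule S_arrI[OF rn U.gap_complex \<alpha>(1) \<alpha>'(1)]) (simp_all add: \<alpha>(2) \<alpha>'(2) ss)
  have "\<phi> (0, m) \<cdot> \<alpha> (0, n) = \<beta> (a, a + m)"
    using am by (simp add: \<alpha>(2) s_def)
  with F aA bA that show thesis by blast
qed

end

section \<open>The comparison functor is an equivalence\<close>

context segal_square
begin

lemma S_square_functors:
  "is_functor (S_groupoid C p) (S_groupoid C n) (S_map C n p f')"
  "is_functor (S_groupoid C p) (S_groupoid C k) (S_map C k p g')"
  "is_functor (S_groupoid C n) (S_groupoid C m) (S_map C m n g)"
  "is_functor (S_groupoid C k) (S_groupoid C m) (S_map C m k f)"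
  by (rule is_functor_precomp, rule f'A g'A gA fA)+

lemma S_square_fobj:
  assumes "F \<in> Ob (S_groupoid C p)"
  shows "fobj (S_map C m n g) (fobj (S_map C n p f') F) = fobj (S_map C m k f) (fobj (S_map C k p g') F)"
proof -
  have F: "gap_complex {0..p} C F" using assms by simp
  then have "is_functor (Ar {0..p}) C F" by (simp add: gap_complex_def)
  then show ?thesis
    using F gap_complex_restr[OF F f'A] gap_complex_restr[OF F g'A] by (simp add: restr_square)
qed

lemma S_square_farr:
  assumes "u \<in> Arr (S_groupoid C p)"
  shows "farr (S_map C m n g) (farr (S_map C n p f') u) = farr (S_map C m k f) (farr (S_map C k p g') u)"
proof -
  obtain F G t where u: "u = (F, G, t)" by (cases u)
  note t = assms[unfolded u]
  have "is_functor (Ar {0..p}) C F" "is_functor (Ar {0..p}) C G"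
    using S_arrD(1,2)[OF t] by (auto simp: gap_complex_def)
  then show ?thesis
    using t S_arr_restr[OF t f'A] S_arr_restr[OF t g'A] by (simp add: u restr_square restr_trans_square)
qed

lemma S_square_commutes:
  "commuting_square Grpd (S_groupoid C p, S_groupoid C n, S_map C n p f')
    (S_groupoid C p, S_groupoid C k, S_map C k p g') (S_groupoid C n, S_groupoid C m, S_map C m n g)
    (S_groupoid C k, S_groupoid C m, S_map C m k f)"
proof -
  have "comp_functor (S_groupoid C p) (S_map C m n g) (S_map C n p f')
      = comp_functor (S_groupoid C p) (S_map C m k f) (S_map C k p g')"
    by (rule functr_eqI[OF comp_functor_functor[OF S_square_functors(1,3)]
          comp_functor_functor[OF S_square_functors(2,4)]])
      (simp_all only: comp_functor_apply S_square_fobj S_square_farr)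
  then show ?thesis
    by (simp add: commuting_square_def groupoid_S S_square_functors)
qed

lemma S_square_pullback:
  "is_homotopy_pullback (S_groupoid C p, S_groupoid C n, S_map C n p f')
    (S_groupoid C p, S_groupoid C k, S_map C k p g') (S_groupoid C n, S_groupoid C m, S_map C m n g)
    (S_groupoid C k, S_groupoid C m, S_map C m k f)"
proof -
  let ?p = "S_map C n p f'" and ?q = "S_map C k p g'" and ?f = "S_map C m n g" and ?g = "S_map C m k f"
  interpret cospan "S_groupoid C n" "S_groupoid C k" "S_groupoid C m" ?f ?g
    by unfold_locales (rule S_square_functors)+
  let ?K = "comparison_functor (S_groupoid C p) (S_groupoid C m) ?p ?q ?f"
  have K: "is_functor (S_groupoid C p) HP ?K"
    by (rule comparison_is_functor[OF S_square_functors(1,2) S_square_fobj S_square_farr])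
  have "is_equivalence (S_groupoid C p) HP ?K"
  proof (rule equivalenceI[OF K])
    \<comment> \<open>Faithfulness, already decided by the part over [k].\<close>
    fix u v assume u: "u \<in> Arr (S_groupoid C p)" and v: "v \<in> Arr (S_groupoid C p)"
      and dc: "Dom (S_groupoid C p) u = Dom (S_groupoid C p) v" "Cod (S_groupoid C p) u = Cod (S_groupoid C p) v"
      and eq: "farr ?K u = farr ?K v"
    obtain F G \<gamma> where ug: "u = (F, G, \<gamma>)" by (cases u)
    obtain \<delta> where vd: "v = (F, G, \<delta>)" using dc by (cases v) (simp add: ug)
    have "restr_trans k \<gamma> g' = restr_trans k \<delta> g'"
      using eq u v by (simp add: comparison_functor_sel ug vd)
    then show "u = v"
      using nattrans_glue_unique S_arrD[OF u[unfolded ug]] S_arrD[OF v[unfolded vd]] by (auto simp: ug vd)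
  next
    fix F G h assume "F \<in> Ob (S_groupoid C p)" "G \<in> Ob (S_groupoid C p)" and h: "h \<in> homs HP (fobj ?K F) (fobj ?K G)"
    then have F: "gap_complex {0..p} C F" and G: "gap_complex {0..p} C G" by auto
    interpret F: gap C p F by unfold_locales (rule F)
    interpret G: gap C p G by unfold_locales (rule G)
    let ?F = "(restr n F f', restr k F g', Id (S_groupoid C m) (restr m (restr n F f') g))"
    let ?G = "(restr n G f', restr k G g', Id (S_groupoid C m) (restr m (restr n G f') g))"
    have FG: "gap_complex {0..n} C (restr n F f')" "gap_complex {0..n} C (restr n G f')"
      using gap_complex_restr[OF _ f'A] F G by auto
    have KF: "fobj ?K F = ?F" "fobj ?K G = ?G" using F G FG by (simp_all add: comparison_functor_sel)
    obtain x y where hxy: "h = (?F, ?G, x, y)" and hA: "(?F, ?G, x, y) \<in> Arr HP"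
      using h unfolding KF by (cases h) (auto simp: homs_iff hfp_sel(3,4))
    have xy: "x \<in> homs (S_groupoid C n) (restr n F f') (restr n G f')" "y \<in> homs (S_groupoid C k) (restr k F g') (restr k G g')"
      and compat: "Comp (S_groupoid C m) (Id (S_groupoid C m) (restr m (restr n G f') g)) (farr ?f x)
        = Comp (S_groupoid C m) (farr ?g y) (Id (S_groupoid C m) (restr m (restr n F f') g))"
      using hA unfolding hfp_sel by auto
    obtain \<alpha> where x: "x = (restr n F f', restr n G f', \<alpha>)" using xy(1) by (cases x) (auto simp: homs_iff)
    obtain \<beta> where y: "y = (restr k F g', restr k G g', \<beta>)" using xy(2) by (cases y) (auto simp: homs_iff)
    have al: "(restr n F f', restr n G f', \<alpha>) \<in> Arr (S_groupoid C n)"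
      and be: "(restr k F g', restr k G g', \<beta>) \<in> Arr (S_groupoid C k)"
      using xy by (auto simp: homs_iff x y)
    have rm: "restr m (restr n F f') g = restr m (restr k F g') f" "restr m (restr n G f') g = restr m (restr k G g') f"
      using restr_square F.is_functor G.is_functor by auto
    have fx: "farr ?f x = (restr m (restr n F f') g, restr m (restr n G f') g, restr_trans m \<alpha> g)" using al by (simp add: x)
    have gy: "farr ?g y = (restr m (restr n F f') g, restr m (restr n G f') g, restr_trans m \<beta> f)" using be by (simp add: y rm)
    have "fobj ?f (restr n F f') = restr m (restr n F f') g" "fobj ?f (restr n G f') = restr m (restr n G f') g"
      using FG by simp_all
    have "farr ?f x \<in> Arr (S_groupoid C m)" "farr ?g y \<in> Arr (S_groupoid C m)"
      using fs(2)[of x] gs(2)[of y] xy by (auto simp: homs_iff)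
    \<comment> \<open>The objects in the image of the comparison functor carry identities, so
      compatibility says that the two restrictions to [m] agree. At (0, m) this is the gluing
      condition, because \<open>g\<close> preserves end-points and \<open>f\<close> is the shift by
      a.\<close>
    then have "farr ?f x = farr ?g y"
      using compat C.ident_left[of "farr ?f x"] C.ident_right[of "farr ?g y"]
      unfolding fx gy S_sel(2,3) by metis
    then have "restr_trans m \<alpha> g (0, m) = restr_trans m \<beta> f (0, m)" by (simp add: fx gy)
    then have eq: "\<alpha> (0, n) = \<beta> (a, a + m)" by simp
    obtain \<gamma> where \<gamma>: "(F, G, \<gamma>) \<in> Arr (S_groupoid C p)" "restr_trans n \<gamma> f' = \<alpha>" "restr_trans k \<gamma> g' = \<beta>"
      using S_arr_glue[OF F G al be eq] by blast
    have "farr ?K (F, G, \<gamma>) = h"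
      using \<gamma> F G FG by (simp add: comparison_functor_sel hxy x y)
    then show "\<exists>u \<in> homs (S_groupoid C p) F G. farr ?K u = h"
      using \<gamma>(1) by (intro bexI[of _ "(F, G, \<gamma>)"]) (auto simp: homs_iff)
  next
    \<comment> \<open>Essential surjectivity. The third component of \<open>d\<close> is an arrow of
      a groupoid; it and its inverse supply the \<open>\<phi>\<close> and \<open>\<psi>\<close> of
      the gluing.\<close>
    fix d assume d: "d \<in> Ob HP"
    obtain U V w where dw: "d = (U, V, w)" by (cases d)
    have U: "gap_complex {0..n} C U" and V: "gap_complex {0..k} C V"
      and w: "w \<in> homs (S_groupoid C m) (restr m U g) (restr m V f)"
      using d unfolding dw hfp_sel by auto
    obtain \<phi> where wp: "w = (restr m U g, restr m V f, \<phi>)" using w by (cases w) (auto simp: homs_iff)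
    have phA: "(restr m U g, restr m V f, \<phi>) \<in> Arr (S_groupoid C m)" using w by (simp add: homs_iff wp)
    obtain \<psi> where psA: "(restr m V f, restr m U g, \<psi>) \<in> Arr (S_groupoid C m)"
      "\<And>i j. \<lbrakk>i \<le> j; j \<le> m\<rbrakk> \<Longrightarrow> \<psi> (i, j) \<cdot> \<phi> (i, j) = Id C (fobj (restr m U g) (i, j)) \<and>
        \<phi> (i, j) \<cdot> \<psi> (i, j) = Id C (fobj (restr m V f) (i, j))"
      using phA by (rule S_arr_inverse) blast
    interpret glue: gluing C m n k p a g f f' g' U V \<phi> \<psi>
      by unfold_locales (use U V S_arrD(3)[OF phA] S_arrD(3)[OF psA(1)] psA(2) in auto)
    obtain F \<alpha> \<beta> where F: "gap_complex {0..p} C F" and al: "(restr n F f', U, \<alpha>) \<in> Arr (S_groupoid C n)"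
      and be: "(restr k F g', V, \<beta>) \<in> Arr (S_groupoid C k)" and eq: "\<phi> (0, m) \<cdot> \<alpha> (0, n) = \<beta> (a, a + m)"
      by (rule glue.ex_glued)
    interpret F: gap C p F by unfold_locales (rule F)
    let ?x = "(restr n F f', U, \<alpha>)" and ?y = "(restr k F g', V, \<beta>)"
    have Fn: "gap_complex {0..n} C (restr n F f')" "gap_complex {0..m} C (restr m (restr n F f') g)"
      "gap_complex {0..k} C (restr k F g')"
      using gap_complex_restr[OF F f'A] gap_complex_restr[OF _ gA] gap_complex_restr[OF F g'A] by auto
    have rm: "restr m (restr n F f') g = restr m (restr k F g') f" using restr_square F.is_functor by auto
    have KF: "fobj ?K F = (restr n F f', restr k F g', Id (S_groupoid C m) (restr m (restr n F f') g))"
      using F Fn by (simp add: comparison_functor_sel)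
    have fx: "farr ?f ?x = (restr m (restr n F f') g, restr m U g, restr_trans m \<alpha> g)" using al by simp
    have gy: "farr ?g ?y = (restr m (restr n F f') g, restr m V f, restr_trans m \<beta> f)" using be by (simp add: rm)
    have fxA: "farr ?f ?x \<in> Arr (S_groupoid C m)" "farr ?g ?y \<in> Arr (S_groupoid C m)"
      using fs(2)[OF al] gs(2)[OF be] by auto
    have wfx: "C.cmp w (farr ?f ?x) \<in> Arr (S_groupoid C m)"
      by (rule C.cmp_simps(1)[OF fxA(1)]) (use phA in \<open>simp_all add: fx wp del: precomp_apply\<close>)
    \<comment> \<open>An equation of transformations on [m], so it suffices to compare components at
      (0, m), where it is \<open>eq\<close>.\<close>
    have "C.cmp w (farr ?f ?x) = farr ?g ?y"
    proof -
      have "(\<lambda>x \<in> Ob (Ar {0..m}). \<phi> x \<cdot> restr_trans m \<alpha> g x) = restr_trans m \<beta> f"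
        by (rule gap_pair.nattrans_unique[OF gap_pairI[OF Fn(2) gap_complex_restr[OF V fA]]
              S_arrD(3)[OF wfx[unfolded fx wp S_sel(5)]] S_arrD(3)[OF fxA(2)[unfolded gy]]])
          (simp add: eq)
      then show ?thesis by (simp add: fx gy wp del: precomp_apply)
    qed
    moreover have "C.cmp (farr ?g ?y) (Id (S_groupoid C m) (restr m (restr n F f') g)) = farr ?g ?y"
      by (rule C.ident_right[OF fxA(2)]) (simp add: gy del: precomp_apply)
    ultimately have compat: "C.cmp w (farr ?f ?x)
        = C.cmp (farr ?g ?y) (Id (S_groupoid C m) (restr m (restr n F f') g))" by simp
    have "fobj ?K F \<in> Ob HP" by (rule is_functorD(3)[OF K]) (simp add: F)
    moreover have "?x \<in> homs (S_groupoid C n) (restr n F f') U" "?y \<in> homs (S_groupoid C k) (restr k F g') V"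
      using al be by (simp_all add: homs_iff)
    ultimately have hA: "(fobj ?K F, d, ?x, ?y) \<in> Arr HP"
      using d compat unfolding KF dw hfp_sel(2) by blast
    have "is_iso HP (fobj ?K F, d, ?x, ?y)"
      unfolding KF dw by (rule hp_iso[OF hA[unfolded KF dw]])
        (use groupoid.arr_iso[OF groupoid_S al] groupoid.arr_iso[OF groupoid_S be] in auto)
    then show "\<exists>F \<in> Ob (S_groupoid C p). \<exists>e \<in> homs HP (fobj ?K F) d. is_iso HP e"
      using F hA by (intro bexI[of _ F] bexI[of _ "(fobj ?K F, d, ?x, ?y)"]) (auto simp: homs_iff hfp_sel(3,4))
  qed
  then show ?thesis
    unfolding is_homotopy_pullback_def using S_square_commutes by simp
qed

end

theorem theorem5p6p4:
  fixes A :: "('o, 'm) cat"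
  assumes "abelian_category A"
  shows "decomposition_space (waldhausen_S A)"
proof -
  interpret abelian_category A by fact
  show ?thesis
    unfolding decomposition_space_def
  proof (intro conjI allI impI)
    show "is_functor (opposite Delta) Grpd (waldhausen_S A)" by (rule waldhausen_S_functor)
    fix G F F' G' assume gen: "generic G" and fr: "free F" and po: "is_pushout Delta G F F' G'"
    have "Dom Delta G = Dom Delta F" using po by (simp add: is_pushout_def commuting_square_def)
    then obtain m n k g f where G: "G = (m, n, g)" and F: "F = (m, k, f)"
      by (cases G; cases F) auto
    obtain a p f' g' where eqs: "F' = (n, p, f')" "G' = (k, p, g')"
      and A: "(n, p, f') \<in> Arr Delta" "(k, p, g') \<in> Arr Delta"
      and props: "a + m \<le> k" "p + m = k + n" "\<And>i. i \<le> m \<Longrightarrow> f i = a + i" "\<And>j. j \<le> n \<Longrightarrow> f' j = a + j"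
        "\<And>i. i \<le> a \<Longrightarrow> g' i = i" "\<And>i. i \<le> m \<Longrightarrow> g' (a + i) = a + g i"
        "\<And>i. \<lbrakk>a + m \<le> i; i \<le> k\<rbrakk> \<Longrightarrow> g' i + m = i + n"
      by (rule Delta_pushoutE[OF gen[unfolded G] fr[unfolded F] po[unfolded G F]]) (rule that)
    have gA: "(m, n, g) \<in> Arr Delta" "(m, k, f) \<in> Arr Delta" "g 0 = 0" "g m = n"
      using gen fr by (auto simp: G F generic_def free_def)
    interpret segal_square A m n k p a g f f' g'
      by unfold_locales (fact gA A props | (rule props; assumption))+
    show "is_homotopy_pullback (farr (waldhausen_S A) F') (farr (waldhausen_S A) G')
        (farr (waldhausen_S A) G) (farr (waldhausen_S A) F)"
      unfolding eqs G F waldhausen_S_sel(2)[OF f'A] waldhausen_S_sel(2)[OF g'A] waldhausen_S_sel(2)[OF gA] waldhausen_S_sel(2)[OF fA]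
      by (rule S_square_pullback)
  qed
qed

end
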